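(* Let $H=([k],\mathcal{E})$ be a fixed graph on $k$ vertices and let $\star\in\{\mathrm{ind},\mathrm{sub}\}$. Suppose that the corresponding optimization problem (the general problem (P) if $\star=\mathrm{sub}$, the induced problem (P-ind) if $\star=\mathrm{ind}$) has a unique solution $(\boldsymbol{\alpha}^*,\boldsymbol{\beta}^* )$, and that $(\boldsymbol{\alpha}^*,\boldsymbol{\beta}^* )\equiv(1/2,0)$ (all $\alpha_i^*=1/2$, all $\beta^*_{\{i,j\}}=0$) or $(\boldsymbol{\alpha}^*,\boldsymbol{\beta}^* )\equiv(0,-1/d)$ (all $\alpha_i^*=0$, all $\beta^*_{\{i,j\}}=-1/d$). Then, for any fixed $\varepsilon\in(0,1)$, $$\lim_{n\to\infty}\mathbb{P}\left(g_1(\varepsilon)\le\frac{N^{(\star)}(H;M_\varepsilon^{(\boldsymbol{\alpha}^*,\boldsymbol{\beta}^* )})}{n^{f_H(\boldsymbol{\alpha}^*,\boldsymbol{\beta}^* )}}\le g_2(\varepsilon)\right)=1$$ for some positive functions $g_1,g_2$ not depending on $n$. Moreover, since $(\boldsymbol{\alpha}^*,\boldsymbol{\beta}^* )$ is the unique solution of the optimization problem, for any $(\boldsymbol{\alpha},\boldsymbol{\beta})\in\mathcal{F}\setminus\{(\boldsymbol{\alpha}^*,\boldsymbol{\beta}^* )\}$ and $\varepsilon\in(0,1)$, $$\frac{N^{(\star)}(H;M_\varepsilon^{(\boldsymbol{\alpha},\boldsymbol{\beta})})}{N^{(\star)}(H;M_\varepsilon^{(\boldsymbol{\alpha}^*,\boldsymbol{\beta}^*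 )})}\longrightarrow 0\quad\text{in probability as } n\to\infty.$$
   Context: Model (geometric inhomogeneous random graph, $\mathrm{GIRG}^{(n)}$). Fix an integer $d\ge 1$, $\tau\in(2,3)$ and $\gamma\in(1,\infty]$. The vertex set is $V=[n]=\{1,\dots,n\}$. Vertex weights $w_1,\dots,w_n$ are i.i.d. copies of a random variable $W$ with values in $[w_0,\infty)$, $w_0=1$, satisfying $\mathbb{P}(W>x)=c\,x^{1-\tau}(1+o(1))$ for $x\ge w_0$ (with $o(1)\to0$ as $x\to\infty$) for a constant $c>0$; $\mu=\mathbb{E}[W]<\infty$. Positions $x_1,\dots,x_n$ are i.i.d. uniform on the torus $\mathbb{T}^d=\mathbb{R}^d/\mathbb{Z}^d$, independent of the weights, with distance $\|x-y\|=\max_{1\le j\le d}\min\{|x^{(j)}-y^{(j)}|,1-|x^{(j)}-y^{(j)}|\}$. Given weights and positions, each pair $u\ne v$ is joined independently with probability $p_{uv}=1\wedge\left(\frac{w_uw_v}{n\mu\|x_u-x_v\|^d}\right)^\gamma$ if $\gamma<\infty$, and $p_{uv}=\mathbb{1}\{w_uw_v>n\mu\|x_u-x_v\|^d\}$ if $\gamma=\infty$. Subgraph counts. $V_k$ is the set of ordered $k$-tuples $\boldsymbol{v}=(v_1,\dots,v_k)$ of distinct vertices of $V$, and $\mathrm{GIRG}^{(n)}|_{\boldsymbol v}$ is the induced graph on $\boldsymbol{v}$. For $H=([k],\mathcal{E})$ with $k$ fixed, $H=\mathrm{GIRG}^{(n)}|_{\boldsymbol v}$ means that $\{v_i,v_j\}$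 is an edge if and only if $\{i,j\}\in\mathcal{E}$, and $H\subseteq\mathrm{GIRG}^{(n)}|_{\boldsymbol v}$ means that $\{v_i,v_j\}$ is an edge whenever $\{i,j\}\in\mathcal{E}$. For $A\subseteq V_k$, $N^{(\mathrm{ind})}(H;A)=\sum_{\boldsymbol v\in A}\mathbb{1}\{H=\mathrm{GIRG}^{(n)}|_{\boldsymbol v}\}$ and $N^{(\mathrm{sub})}(H;A)=\sum_{\boldsymbol v\in A}\mathbb{1}\{H\subseteq\mathrm{GIRG}^{(n)}|_{\boldsymbol v}\}$. Vertex classes. $I_\varepsilon(n^\zeta)=[\varepsilon n^\zeta,n^\zeta/\varepsilon]$. For $\boldsymbol\alpha=(\alpha_i)_{i\in[k]}$ and $\boldsymbol\beta=(\beta_{\{i,j\}})_{i\neq j\in[k]}$, $M_\varepsilon^{(\boldsymbol\alpha,\boldsymbol\beta)}=\{(v_1,\dots,v_k)\in V_k: w_{v_i}\in I_\varepsilon(n^{\alpha_i})\ \forall i,\ \|x_{v_i}-x_{v_j}\|\in I_\varepsilon(n^{\beta_{\{i,j\}}})\ \forall i\ne j\}$. Feasible region. $\mathcal{F}$ is the set of $(\boldsymbol\alpha,\boldsymbol\beta)$ with $\alpha_i\in[0,1/(\tau-1)]$ for all $i$, $\beta_{\{i,j\}}\in[-1/d,0]$ for all $i\neq j$, and $\beta_{\{i,j\}}\le\max(\beta_{\{i,s\}},\beta_{\{j,s\}})$ for all distinct $i,j,s\in[k]$. Optimization problems. Let $f_H(\boldsymbol\alpha,\boldsymbol\beta)=k+(1-\tau)\sum_{i=1}^k\alpha_i+d\sum_{j=2}^k\min_{i<j}\beta_{\{i,j\}}+\gamma\sum_{\{i,j\}\in\mathcal{E}}\min(\alpha_i+\alpha_j-d\beta_{\{i,j\}}-1,0)$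 (for $\gamma=\infty$, $\infty\cdot 0=0$ and $\infty\cdot(\text{negative})=-\infty$). Problem (P): maximize $f_H$ over $\mathcal{F}$. Problem (P-ind): maximize $f_H$ over those $(\boldsymbol\alpha,\boldsymbol\beta)\in\mathcal{F}$ with $\alpha_i+\alpha_j\le 1+d\beta_{\{i,j\}}$ for all pairs $\{i,j\}\notin\mathcal{E}$, $i\ne j$.
   Formalization: The claims for ε are made only when N(H;M_ε) at the optimum is not a.s. zero for all large n (it is 0, e.g., for the optimum (1/2,0), k≥2, ε>1/2, since torus distances are ≤1/2); this is shown to hold for all small ε if ⋆=sub or γ<∞. *)

theory Defs
  imports "HOL-Probability.Probability"
begin

section \<open>The geometric inhomogeneous random graph\<close>

definition vertex_pairs :: "nat \<Rightarrow> nat set set" where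
  "vertex_pairs k = {e. e \<subseteq> {1..k} \<and> card e = 2}"

(* The torus R^d / Z^d is represented by the half-open unit cube, d = CARD('d). *)
definition torus :: "(real ^ 'd) set" where
  "torus = {x. \<forall>j. 0 \<le> x $ j \<and> x $ j < 1}"

definition torus_dist :: "real ^ 'd \<Rightarrow> real ^ 'd \<Rightarrow> real" where
  "torus_dist x y = Max (range (\<lambda>j. min \<bar>x $ j - y $ j\<bar> (1 - \<bar>x $ j - y $ j\<bar>)))"

(* For distinct vertices r > 0 almost surely, so the junk value at r = 0 in the case
   gamma < \<infinity> (division by zero) concerns a null event only. *)
definition connection_prob ::
    "ereal \<Rightarrow> real \<Rightarrow> nat \<Rightarrow> real \<times> (real ^ 'd) \<Rightarrow> real \<times> (real ^ 'd) \<Rightarrow> real" where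
  "connection_prob \<gamma> \<mu> n a b =
     (let r = torus_dist (snd a) (snd b) in
      if \<gamma> = \<infinity>
      then of_bool (fst a * fst b > real n * \<mu> * r ^ CARD('d))
      else min 1 ((fst a * fst b / (real n * \<mu> * r ^ CARD('d))) powr real_of_ereal \<gamma>))"

(* nu is the law of the weight W. *)
definition weight_law :: "real \<Rightarrow> real \<Rightarrow> real measure \<Rightarrow> bool" where
  "weight_law \<tau> c \<nu> \<longleftrightarrow>
     real_distribution \<nu> \<and>
     (AE x in \<nu>. 1 \<le> x) \<and>
     ((\<lambda>x. measure \<nu> {x<..} / (c * x powr (1 - \<tau>))) \<longlongrightarrow> 1) at_top \<and>
     integrable \<nu> (\<lambda>x. x)"

(* One graph on n vertices, on an arbitrary probability space: w i and x i are the weight and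
   the position of vertex i, and G is the random edge set. *)
locale girg = prob_space M
  for M :: "'a measure" +
  fixes \<gamma> :: ereal and \<nu> :: "real measure" and n :: nat
    and w :: "nat \<Rightarrow> 'a \<Rightarrow> real" and x :: "nat \<Rightarrow> 'a \<Rightarrow> real ^ 'd"
    and G :: "'a \<Rightarrow> nat set set"
  (* The pairs (w i, x i) are independent over i, and each has a product law. Together this
     says that the weights are iid, the positions are iid, and both are independent. *)
  assumes indep_vertices:
    "indep_vars (\<lambda>_. borel \<Otimes>\<^sub>M borel) (\<lambda>i \<omega>. (w i \<omega>, x i \<omega>)) {1..n}"
  and vertex_law:
    "\<And>i. i \<in> {1..n} \<Longrightarrow>
       distr M (borel \<Otimes>\<^sub>M borel) (\<lambda>\<omega>. (w i \<omega>, x i \<omega>)) = \<nu> \<Otimes>\<^sub>M uniform_measure lborel torus"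
  and edges_measurable:
    "G \<in> measurable M (count_space (Pow (vertex_pairs n)))"
  (* The conditional law of the edge set, given the sigma-algebra generated by all weights
     and positions, is a product of Bernoulli laws. *)
  and edges_law:
    "\<And>F. F \<subseteq> vertex_pairs n \<Longrightarrow>
       AE \<omega> in M.
         real_cond_exp M
           (vimage_algebra (space M) (\<lambda>\<omega>'. \<lambda>i\<in>{1..n}. (w i \<omega>', x i \<omega>'))
             (\<Pi>\<^sub>M i\<in>{1..n}. borel \<Otimes>\<^sub>M borel))
           (indicator {\<omega>' \<in> space M. G \<omega>' = F}) \<omega>
         = (\<Prod>(u, v) \<in> {(u, v). 1 \<le> u \<and> u < v \<and> v \<le> n}.
              let p = connection_prob \<gamma> (\<integral>y. y \<partial>\<nu>) n (w u \<omega>, x u \<omega>) (w v \<omega>, x v \<omega>)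
              in if {u, v} \<in> F then p else 1 - p)"


section \<open>Subgraph counts\<close>

datatype mode = Ind | Sub

definition vertex_tuples :: "nat \<Rightarrow> nat \<Rightarrow> (nat \<Rightarrow> nat) set" where
  "vertex_tuples k n = {v \<in> {1..k} \<rightarrow>\<^sub>E {1..n}. inj_on v {1..k}}"

definition occurs :: "mode \<Rightarrow> nat \<Rightarrow> nat set set \<Rightarrow> nat set set \<Rightarrow> (nat \<Rightarrow> nat) \<Rightarrow> bool" where
  "occurs m k E F v \<longleftrightarrow>
     (\<forall>i\<in>{1..k}. \<forall>j\<in>{1..k}. i \<noteq> j \<longrightarrow>
        (case m of Ind \<Rightarrow> {v i, v j} \<in> F \<longleftrightarrow> {i, j} \<in> E
                 | Sub \<Rightarrow> {i, j} \<in> E \<longrightarrow> {v i, v j} \<in> F))"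

definition subgraph_count ::
    "mode \<Rightarrow> nat \<Rightarrow> nat set set \<Rightarrow> nat set set \<Rightarrow> (nat \<Rightarrow> nat) set \<Rightarrow> real" where
  "subgraph_count m k E F A = (\<Sum>v\<in>A. of_bool (occurs m k E F v))"

definition scale_interval :: "real \<Rightarrow> nat \<Rightarrow> real \<Rightarrow> real set" where
  "scale_interval \<epsilon> n \<zeta> = {\<epsilon> * real n powr \<zeta> .. real n powr \<zeta> / \<epsilon>}"

definition tuple_class ::
    "nat \<Rightarrow> nat \<Rightarrow> real \<Rightarrow> (nat \<Rightarrow> real) \<times> (nat set \<Rightarrow> real)
      \<Rightarrow> (nat \<Rightarrow> real) \<Rightarrow> (nat \<Rightarrow> real ^ 'd) \<Rightarrow> (nat \<Rightarrow> nat) set" where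
  "tuple_class k n \<epsilon> p wt pos =
     {v \<in> vertex_tuples k n.
        (\<forall>i\<in>{1..k}. wt (v i) \<in> scale_interval \<epsilon> n (fst p i)) \<and>
        (\<forall>i\<in>{1..k}. \<forall>j\<in>{1..k}. i \<noteq> j \<longrightarrow>
           torus_dist (pos (v i)) (pos (v j)) \<in> scale_interval \<epsilon> n (snd p {i, j}))}"

definition class_count ::
    "mode \<Rightarrow> nat \<Rightarrow> nat set set \<Rightarrow> nat \<Rightarrow> real \<Rightarrow> (nat \<Rightarrow> real) \<times> (nat set \<Rightarrow> real)
      \<Rightarrow> (nat \<Rightarrow> 'a \<Rightarrow> real) \<Rightarrow> (nat \<Rightarrow> 'a \<Rightarrow> real ^ 'd) \<Rightarrow> ('a \<Rightarrow> nat set set) \<Rightarrow> 'a \<Rightarrow> real" where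
  "class_count m k E n \<epsilon> p w x G \<omega> =
     subgraph_count m k E (G \<omega>) (tuple_class k n \<epsilon> p (\<lambda>i. w i \<omega>) (\<lambda>i. x i \<omega>))"

(* The count in the class of p and eps is not almost surely zero for all large n. It is zero,
   for instance, when p = (1/2,0) and eps > 1/2 (k \<ge> 2), because torus distances are at most
   1/2; when p = (0,-1/d) and W > 1/eps almost surely; and, for gamma = \<infinity> and induced
   counts, when the threshold rule cannot produce H as an induced subgraph. *)
definition class_attainable ::
    "mode \<Rightarrow> nat \<Rightarrow> nat set set \<Rightarrow> real \<Rightarrow> (nat \<Rightarrow> real) \<times> (nat set \<Rightarrow> real)
      \<Rightarrow> (nat \<Rightarrow> 'a measure) \<Rightarrow> (nat \<Rightarrow> nat \<Rightarrow> 'a \<Rightarrow> real) \<Rightarrow> (nat \<Rightarrow> nat \<Rightarrow> 'a \<Rightarrow> real ^ 'd)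
      \<Rightarrow> (nat \<Rightarrow> 'a \<Rightarrow> nat set set) \<Rightarrow> bool" where
  "class_attainable m k E \<epsilon> p M w x G \<longleftrightarrow>
     (\<exists>\<^sub>F n in sequentially.
        0 < measure (M n) {\<omega> \<in> space (M n). 0 < class_count m k E n \<epsilon> p (w n) (x n) (G n) \<omega>})"


section \<open>The optimization problems\<close>

(* The exponents (alpha, beta) are extensional functions, so that equality of exponent pairs,
   and hence uniqueness of a maximizer, is not affected by values outside the index sets. *)
definition feasible :: "nat \<Rightarrow> nat \<Rightarrow> real \<Rightarrow> ((nat \<Rightarrow> real) \<times> (nat set \<Rightarrow> real)) set" where
  "feasible d k \<tau> =
     {(\<alpha>, \<beta>).
        \<alpha> \<in> {1..k} \<rightarrow>\<^sub>E {0 .. 1 / (\<tau> - 1)} \<and>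
        \<beta> \<in> vertex_pairs k \<rightarrow>\<^sub>E {- 1 / real d .. 0} \<and>
        (\<forall>i\<in>{1..k}. \<forall>j\<in>{1..k}. \<forall>s\<in>{1..k}. i \<noteq> j \<longrightarrow> i \<noteq> s \<longrightarrow> j \<noteq> s \<longrightarrow>
           \<beta> {i, j} \<le> max (\<beta> {i, s}) (\<beta> {j, s}))}"

definition mode_feasible ::
    "mode \<Rightarrow> nat \<Rightarrow> nat \<Rightarrow> nat set set \<Rightarrow> real \<Rightarrow> ((nat \<Rightarrow> real) \<times> (nat set \<Rightarrow> real)) set" where
  "mode_feasible m d k E \<tau> =
     (case m of
        Sub \<Rightarrow> feasible d k \<tau>
      | Ind \<Rightarrow> {(\<alpha>, \<beta>) \<in> feasible d k \<tau>.
                 \<forall>i\<in>{1..k}. \<forall>j\<in>{1..k}. i \<noteq> j \<longrightarrow> {i, j} \<notin> E \<longrightarrow>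
                   \<alpha> i + \<alpha> j \<le> 1 + real d * \<beta> {i, j}})"

(* For an edge e = {i,j}, the inner sum over e is alpha_i + alpha_j. Arithmetic on ereal has
   \<infinity> * 0 = 0 and \<infinity> * r = -\<infinity> for r < 0. *)
definition objective ::
    "nat \<Rightarrow> nat \<Rightarrow> nat set set \<Rightarrow> real \<Rightarrow> ereal \<Rightarrow> (nat \<Rightarrow> real) \<times> (nat set \<Rightarrow> real) \<Rightarrow> ereal" where
  "objective d k E \<tau> \<gamma> = (\<lambda>(\<alpha>, \<beta>).
     ereal (real k + (1 - \<tau>) * (\<Sum>i=1..k. \<alpha> i)
            + real d * (\<Sum>j=2..k. Min ((\<lambda>i. \<beta> {i, j}) ` {1..<j})))
     + \<gamma> * ereal (\<Sum>e\<in>E. min ((\<Sum>i\<in>e. \<alpha> i) - real d * \<beta> e - 1) 0))"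

end

theory Submission
  imports Defs "HOL-Real_Asymp.Real_Asymp"
begin

text \<open>Both candidates for the optimum have constant exponents: all weights are of order \<open>n^a\<close> and all
  distances of order \<open>n^b\<close>, with (a, b) = (1/2, 0) or (0, -1/d). In both cases \<open>2 a = 1 + d b\<close>, which
  puts all pairs at the connection threshold: the ratio \<open>w w' / (n \<mu> r^d)\<close>, which governs the
  probability of an edge, is of order one. After rescaling weights by \<open>n^a\<close> and distances by \<open>n^b\<close>
  nothing depends on n except the number of places where a copy can sit.

  First moment. For an arbitrary class the probability that a given tuple lies in it and spans the
  pattern is at most of order \<open>n^(F - k)\<close>, where F is the value of the objective function
  (\<open>tuple_prob_upper\<close>). Weights contribute their tails, and positions are revealed one after the
  other, each in a ball around an earlier one (\<open>tree_bound\<close>). Since there are at most \<open>n^k\<close> tuples, F is an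
  upper bound for the exponent of the mean, and Markov's inequality shows that every class with
  smaller objective value is negligible against \<open>n^f\<close>, f being the optimal value. A class that
  violates a constraint of the induced problem eventually contains no copy at all
  (\<open>eventually_tuple_prob_eq_0\<close>).

  For the optimal class there is a matching lower bound (\<open>tuple_prob_lower\<close>) as soon as there is one
  configuration of rescaled weights and positions that satisfies the conditions on distances and
  ratios strictly. Such a configuration may be perturbed, and the number of disjoint places of the
  torus at which it fits is of order \<open>n^(-d b)\<close>.

  Second moment. Copies without a common vertex are independent (\<open>prob_appears_disjoint\<close>). Two copies
  with a common vertex have at most 2k - 1 vertices, all of them with weight of order \<open>n^a\<close> and within
  distance of order \<open>n^b\<close> of the common one, and this makes their number small against the squared
  mean (\<open>variance_class_count_le\<close>). Chebyshev's inequality gives concentration.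

  The link with attainability is that null sets may be removed (\<open>strict_tuple_of_positive_count\<close>): if
  a copy exists with positive probability for infinitely many n, then for some large n there is a
  realization in which no distance is at a boundary of its window, no ratio equals 1, and no pair is
  in an impossible state. Rescaled, and unrolled from the torus to \<open>\<real>^d\<close> if b = -1/d, the copy is a
  strict configuration, which then serves for all n. For subgraph counts and for finite \<open>\<gamma>\<close> such
  configurations are written down explicitly when \<open>\<epsilon>\<close> is small.\<close>

section \<open>Distances and volumes on the torus\<close>

lemma continuous_on_Max_image:
  fixes f :: "'i \<Rightarrow> 'b::topological_space \<Rightarrow> real"
  assumes "finite I" "I \<noteq> {}" "\<And>i. i \<in> I \<Longrightarrow> continuous_on S (f i)"
  shows "continuous_on S (\<lambda>x. Max ((\<lambda>i. f i x) ` I))"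
  using assms
proof (induction I rule: finite_ne_induct)
  case (insert i I)
  then show ?case
    by (auto intro!: continuous_on_max)
qed auto

definition sup_dist :: "real ^ 'd \<Rightarrow> real ^ 'd \<Rightarrow> real" where
  "sup_dist x y = Max (range (\<lambda>j. \<bar>x $ j - y $ j\<bar>))"

lemma continuous_on_torus_dist:
  "continuous_on UNIV (\<lambda>p. torus_dist (fst p) (snd p :: real ^ 'd))"
  unfolding torus_dist_def
  by (rule continuous_on_Max_image) (auto intro!: continuous_intros)

lemma continuous_on_sup_dist:
  "continuous_on UNIV (\<lambda>p. sup_dist (fst p) (snd p :: real ^ 'd))"
  unfolding sup_dist_def
  by (rule continuous_on_Max_image) (auto intro!: continuous_intros)

lemma torus_dist_measurable [measurable (raw)]:
  assumes [measurable]: "f \<in> borel_measurable N" "g \<in> borel_measurable N"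
  shows "(\<lambda>\<omega>. torus_dist (f \<omega>) (g \<omega> :: real ^ 'd)) \<in> borel_measurable N"
proof -
  have "(\<lambda>p. torus_dist (fst p) (snd p :: real ^ 'd)) \<in> borel_measurable (borel \<Otimes>\<^sub>M borel)"
    by (simp add: borel_prod borel_measurable_continuous_onI continuous_on_torus_dist)
  from measurable_compose[OF measurable_Pair[OF assms] this] show ?thesis
    by simp
qed

lemma torus_dist_commute: "torus_dist x y = torus_dist y x"
  by (simp add: torus_dist_def abs_minus_commute)

lemma torus_dist_le_half: "torus_dist x y \<le> 1 / 2"
  unfolding torus_dist_def by (subst Max_le_iff) (auto simp: min_def)

text \<open>Half-open cubes are used because translates of them by multiples of their side length
  are disjoint, and because the torus itself is represented by one.\<close>

definition half_open_cube :: "real ^ 'd \<Rightarrow> real \<Rightarrow> (real ^ 'd) set" where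
  "half_open_cube a s = {x. \<forall>j. a $ j \<le> x $ j \<and> x $ j < a $ j + s}"

lemma half_open_cube_measurable [measurable]: "half_open_cube a s \<in> sets borel"
  unfolding half_open_cube_def by measurable

lemma measure_cbox_cube:
  fixes a :: "real ^ 'd"
  assumes "0 \<le> s"
  shows "measure lborel (cbox a (\<chi> j. a $ j + s)) = s ^ CARD('d)"
proof -
  have "a \<in> cbox a (\<chi> j. a $ j + s)"
    using assms by (auto simp: mem_box_cart)
  then have "cbox a (\<chi> j. a $ j + s) \<noteq> {}" by blast
  then show ?thesis
    using content_cbox_cart[of a "\<chi> j. a $ j + s"] by simp
qed

lemma measure_half_open_cube:
  fixes a :: "real ^ 'd"
  assumes "0 \<le> s"
  shows "measure lborel (half_open_cube a s) = s ^ CARD('d)"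
proof -
  let ?b = "\<chi> j. a $ j + s"
  have sub: "box a ?b \<subseteq> half_open_cube a s" "half_open_cube a s \<subseteq> cbox a ?b"
    by (auto simp: half_open_cube_def mem_box_cart less_imp_le)
  have fin: "emeasure lborel (cbox a ?b) \<noteq> \<infinity>"
    using emeasure_lborel_cbox_finite[of a ?b] by simp
  have fin2: "emeasure lborel (half_open_cube a s) \<noteq> \<infinity>"
    using emeasure_mono[OF sub(2), of lborel] fin by (auto simp: top_unique)
  have "measure lborel (box a ?b) \<le> measure lborel (half_open_cube a s)"
    using sub fin2 by (intro measure_mono_fmeasurable fmeasurableI) (auto simp: top.not_eq_extremum)
  moreover have "measure lborel (half_open_cube a s) \<le> measure lborel (cbox a ?b)"
    using sub fin by (intro measure_mono_fmeasurable fmeasurableI) (auto simp: top.not_eq_extremum)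
  moreover have "measure lborel (box a ?b) = measure lborel (cbox a ?b)"
    unfolding measure_def by (simp add: emeasure_lborel_box_eq emeasure_lborel_cbox_eq)
  ultimately show ?thesis
    using measure_cbox_cube[OF assms, of a] by simp
qed

lemma emeasure_half_open_cube:
  fixes a :: "real ^ 'd"
  assumes "0 \<le> s"
  shows "emeasure lborel (half_open_cube a s) = ennreal (s ^ CARD('d))"
proof -
  have "half_open_cube a s \<subseteq> cbox a (\<chi> j. a $ j + s)"
    by (auto simp: half_open_cube_def mem_box_cart less_imp_le)
  from emeasure_mono[OF this, of lborel] emeasure_lborel_cbox_finite[of a "\<chi> j. a $ j + s"]
  have "emeasure lborel (half_open_cube a s) \<noteq> \<infinity>" by (auto simp: top_unique)
  from emeasure_eq_ennreal_measure[OF this[unfolded infinity_ennreal_def]]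
  show ?thesis by (simp add: measure_half_open_cube assms)
qed

lemma torus_eq_half_open_cube: "(torus :: (real ^ 'd) set) = half_open_cube 0 1"
  by (auto simp: torus_def half_open_cube_def)

lemma torus_measurable [measurable]: "(torus :: (real ^ 'd) set) \<in> sets borel"
  unfolding torus_eq_half_open_cube by simp

lemma emeasure_torus: "emeasure lborel (torus :: (real ^ 'd) set) = 1"
  unfolding torus_eq_half_open_cube by (simp add: emeasure_half_open_cube)

abbreviation uniform_torus :: "(real ^ 'd) measure" where
  "uniform_torus \<equiv> uniform_measure lborel torus"

lemma prob_space_uniform_torus: "prob_space (uniform_torus :: (real ^ 'd) measure)"
  by (rule prob_space_uniform_measure) (auto simp: emeasure_torus)

lemma emeasure_uniform_torus:
  "A \<in> sets borel \<Longrightarrow>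
     emeasure (uniform_torus :: (real ^ 'd) measure) A = emeasure lborel (torus \<inter> A)"
  by (simp add: emeasure_torus divide_ennreal_def)

lemma AE_uniform_torus: "AE y in (uniform_torus :: (real ^ 'd) measure). y \<in> torus"
  by (rule AE_uniform_measureI) auto

text \<open>Unrolling the torus around z, a ball is covered by the translates of a cube of side 2R by
  the \<open>3^d\<close> integer vectors with entries -1, 0, 1; this is where the constant 6 comes from.\<close>

lemma emeasure_torus_ball_le:
  fixes z :: "real ^ 'd"
  assumes z: "z \<in> torus" and R: "0 \<le> R"
  shows "emeasure uniform_torus {y. torus_dist z y \<le> R} \<le> ennreal ((6 * R) ^ CARD('d))"
proof -
  let ?C = "PiE (UNIV :: 'd set) (\<lambda>_. {-1, 0, 1 :: real})"
  define B where "B c = cbox (\<chi> j. z $ j + c j - R) (\<chi> j. z $ j + c j + R)" for c :: "'d \<Rightarrow> real"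
  have finC: "finite ?C" by (intro finite_PiE) auto
  have B: "emeasure lborel (B c) = ennreal ((2 * R) ^ CARD('d))" for c
  proof -
    have eq: "B c = cbox (\<chi> j. z $ j + c j - R) (\<chi> j. (\<chi> j. z $ j + c j - R) $ j + 2 * R)"
      unfolding B_def by (intro arg_cong2[where f = cbox]) (auto simp: vec_eq_iff)
    have "emeasure lborel (B c) = ennreal (measure lborel (B c))"
      using emeasure_lborel_cbox_finite
      by (intro emeasure_eq_ennreal_measure) (auto simp: B_def top.not_eq_extremum)
    then show ?thesis using measure_cbox_cube[of "2 * R" "\<chi> j. z $ j + c j - R"] R eq by simp
  qed
  have cover: "torus \<inter> {y. torus_dist z y \<le> R} \<subseteq> (\<Union>c\<in>?C. B c)"
  proof
    fix y assume y: "y \<in> torus \<inter> {y. torus_dist z y \<le> R}"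
    then have *: "min \<bar>z $ j - y $ j\<bar> (1 - \<bar>z $ j - y $ j\<bar>) \<le> R" for j
      by (auto simp: torus_dist_def)
    have "\<exists>c. c \<in> {-1, 0, 1} \<and> \<bar>y $ j - z $ j - c\<bar> \<le> R" for j
    proof -
      have "0 \<le> y $ j" "y $ j < 1" "0 \<le> z $ j" "z $ j < 1"
        using y z by (auto simp: torus_def)
      then have "\<bar>y $ j - z $ j - (-1)\<bar> \<le> R \<or> \<bar>y $ j - z $ j - 0\<bar> \<le> R \<or> \<bar>y $ j - z $ j - 1\<bar> \<le> R"
        using *[of j] by (auto simp: min_def abs_if split: if_splits)
      then show ?thesis by blast
    qed
    then obtain c where c: "\<And>j. c j \<in> {-1, 0, 1}" "\<And>j. \<bar>y $ j - z $ j - c j\<bar> \<le> R" by metis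
    have "y \<in> B c"
      unfolding B_def using c(2) by (auto simp: mem_box_cart abs_le_iff algebra_simps)
    moreover have "c \<in> ?C" using c(1) by auto
    ultimately show "y \<in> (\<Union>c\<in>?C. B c)" by blast
  qed
  have "emeasure uniform_torus {y. torus_dist z y \<le> R}
      = emeasure lborel (torus \<inter> {y. torus_dist z y \<le> R})"
    by (intro emeasure_uniform_torus) measurable
  also have "\<dots> \<le> emeasure lborel (\<Union>c\<in>?C. B c)"
    by (rule emeasure_mono[OF cover]) (auto intro!: sets.finite_UN finC simp: B_def)
  also have "\<dots> \<le> (\<Sum>c\<in>?C. emeasure lborel (B c))"
    by (rule emeasure_subadditive_finite[OF finC]) (auto simp: B_def)
  also have "\<dots> = of_nat (card ?C) * ennreal ((2 * R) ^ CARD('d))"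
    by (simp add: B)
  also have "\<dots> = ennreal (real (card ?C) * (2 * R) ^ CARD('d))"
    using R by (simp add: ennreal_of_nat_eq_real_of_nat ennreal_mult)
  also have "real (card ?C) * (2 * R) ^ CARD('d) = (6 * R) ^ CARD('d)"
  proof -
    have "real (card ?C) = 3 ^ CARD('d)" by (simp add: card_PiE)
    then have "real (card ?C) * (2 * R) ^ CARD('d) = (3 * (2 * R)) ^ CARD('d)"
      by (simp only: power_mult_distrib)
    then show ?thesis by (simp only: mult.assoc[symmetric]) simp
  qed
  finally show ?thesis .
qed

lemma null_hyperplane: "{y :: real ^ 'd. y $ j = c} \<in> null_sets lborel"
proof -
  have "negligible {y :: real ^ 'd. y $ j = c}"
    unfolding cart_eq_inner_axis
    by (rule negligible_standard_hyperplane) (simp add: axis_in_Basis_iff)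
  moreover have "{y :: real ^ 'd. y $ j = c} \<in> sets lborel" by measurable
  ultimately show ?thesis
    by (simp add: negligible_iff_null_sets null_sets_completion_iff)
qed

text \<open>A sphere of the torus metric is contained in finitely many hyperplanes: one coordinate of
  y is at one of four values determined by z and r.\<close>

lemma AE_torus_dist_neq:
  fixes z :: "real ^ 'd"
  shows "AE y in uniform_torus. torus_dist z y \<noteq> r"
proof -
  let ?N = "\<Union>j\<in>UNIV. \<Union>c\<in>{z $ j - r, z $ j + r, z $ j - (1 - r), z $ j + (1 - r)}. {y :: real ^ 'd. y $ j = c}"
  have "?N \<in> null_sets lborel"
    by (intro null_sets.finite_UN) (auto intro: null_hyperplane)
  moreover have "{y. torus_dist z y = r} \<subseteq> ?N"
  proof
    fix y assume "y \<in> {y. torus_dist z y = r}"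
    then have "r \<in> range (\<lambda>j. min \<bar>z $ j - y $ j\<bar> (1 - \<bar>z $ j - y $ j\<bar>))"
      unfolding torus_dist_def using Max_in[of "range (\<lambda>j. min \<bar>z $ j - y $ j\<bar> (1 - \<bar>z $ j - y $ j\<bar>))"]
      by auto
    then obtain j where "r = min \<bar>z $ j - y $ j\<bar> (1 - \<bar>z $ j - y $ j\<bar>)" by blast
    then have "y $ j = z $ j - r \<or> y $ j = z $ j + r \<or> y $ j = z $ j - (1 - r) \<or> y $ j = z $ j + (1 - r)"
      by (auto simp: min_def abs_if split: if_splits)
    then show "y \<in> ?N" by blast
  qed
  ultimately have "AE y in lborel. torus_dist z y \<noteq> r"
    by (intro AE_I'[of ?N]) auto
  then show ?thesis
    by (intro AE_uniform_measureI) (auto elim: eventually_mono)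
qed

section \<open>Independent weighted points\<close>

definition vertex_measure :: "real measure \<Rightarrow> (real \<times> (real ^ 'd)) measure" where
  "vertex_measure \<nu> = \<nu> \<Otimes>\<^sub>M uniform_torus"

context real_distribution
begin

lemma sets_vertex_measure [measurable_cong]:
  "sets (vertex_measure M :: (real \<times> (real ^ 'd)) measure) = sets (borel \<Otimes>\<^sub>M borel)"
  unfolding vertex_measure_def by (intro sets_pair_measure_cong) auto

lemma space_vertex_measure [simp]: "space (vertex_measure M :: (real \<times> (real ^ 'd)) measure) = UNIV"
  using sets_eq_imp_space_eq[OF sets_vertex_measure] by (simp add: space_pair_measure)

lemma prob_space_vertex_measure: "prob_space (vertex_measure M :: (real \<times> (real ^ 'd)) measure)"
proof -
  interpret U: prob_space "uniform_torus :: (real ^ 'd) measure" by (rule prob_space_uniform_torus)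
  interpret pair_prob_space M "uniform_torus :: (real ^ 'd) measure" ..
  show ?thesis unfolding vertex_measure_def by unfold_locales
qed

lemma product_prob_space_vertex_measure:
  "product_prob_space (\<lambda>_. vertex_measure M :: (real \<times> (real ^ 'd)) measure)"
  by (intro product_prob_spaceI prob_space_vertex_measure)

lemma emeasure_vertex_measure_Times:
  fixes B :: "(real ^ 'd) set"
  assumes "A \<in> sets borel" "B \<in> sets borel"
  shows "emeasure (vertex_measure M) (A \<times> B) = emeasure M A * emeasure uniform_torus B"
proof -
  interpret U: prob_space "uniform_torus :: (real ^ 'd) measure" by (rule prob_space_uniform_torus)
  show ?thesis
    unfolding vertex_measure_def using assms by (intro U.emeasure_pair_measure_Times) auto
qed

lemma AE_vertex_measure_torus:
  "AE p in (vertex_measure M :: (real \<times> (real ^ 'd)) measure). snd p \<in> torus"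
proof -
  interpret U: prob_space "uniform_torus :: (real ^ 'd) measure" by (rule prob_space_uniform_torus)
  interpret pair_prob_space M "uniform_torus :: (real ^ 'd) measure" ..
  show ?thesis
    unfolding vertex_measure_def
    by (rule AE_pair_measure, measurable) (simp add: AE_uniform_torus)
qed

text \<open>Points are revealed one after the other. Given the earlier ones, the next position falls
  into the ball around its predecessor in the tree \<open>\<sigma>\<close> with probability at most the volume of
  the ball, whatever the earlier positions are; so the tree structure alone yields the product.\<close>

lemma tree_bound:
  fixes a R :: "nat \<Rightarrow> real" and \<sigma> :: "nat \<Rightarrow> nat"
  assumes "\<And>j. j \<in> {2..K} \<Longrightarrow> \<sigma> j \<in> {1..<j}" and "\<And>j. j \<in> {2..K} \<Longrightarrow> 0 \<le> R j"
  defines "P \<equiv> PiM {1..K} (\<lambda>_. vertex_measure M :: (real \<times> (real ^ 'd)) measure)"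
  shows "emeasure P
      {y \<in> space P. (\<forall>i\<in>{1..K}. a i \<le> fst (y i) \<and> snd (y i) \<in> torus) \<and>
                    (\<forall>j\<in>{2..K}. torus_dist (snd (y (\<sigma> j))) (snd (y j)) \<le> R j)}
    \<le> ennreal ((\<Prod>i\<in>{1..K}. measure M {a i..}) * (\<Prod>j\<in>{2..K}. (6 * R j) ^ CARD('d)))"
  using assms(1,2) unfolding P_def
proof (induction K)
  case 0
  show ?case by (auto intro!: order_trans[OF prob_space.emeasure_le_1[OF prob_space_PiM]] prob_space_vertex_measure)
next
  case (Suc K)
  let ?L = "vertex_measure M :: (real \<times> (real ^ 'd)) measure"
  interpret P: product_prob_space "\<lambda>_. ?L" by (rule product_prob_space_vertex_measure)
  define S where "S K = {y \<in> space (PiM {1..K} (\<lambda>_. ?L)).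
      (\<forall>i\<in>{1..K}. a i \<le> fst (y i) \<and> snd (y i) \<in> torus) \<and>
      (\<forall>j\<in>{2..K}. torus_dist (snd (y (\<sigma> j))) (snd (y j)) \<le> R j)}" for K
  have meas: "S N \<in> sets (PiM {1..N} (\<lambda>_. ?L))" if "N \<le> Suc K" for N
  proof -
    have \<sigma>': "\<sigma> j \<in> {1..N}" if "j \<in> {2..N}" for j
      using Suc.prems(1)[of j] that \<open>N \<le> Suc K\<close> by auto
    have [measurable]: "(\<lambda>y. torus_dist (snd (y (\<sigma> j))) (snd (y j))) \<in>
        borel_measurable (PiM {1..N} (\<lambda>_. ?L))" if "j \<in> {2..N}" for j
    proof -
      have "\<sigma> j \<in> {1..N}" "j \<in> {1..N}" using \<sigma>'[OF that] that by auto
      then show ?thesis by measurable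
    qed
    show ?thesis unfolding S_def by measurable
  qed
  have meas_Suc: "S (Suc K) \<in> sets (PiM (insert (Suc K) {1..K}) (\<lambda>_. ?L))"
    using meas[of "Suc K"] by (simp add: atLeastAtMostSuc_conv)
  \<comment> \<open>The first point has no predecessor and contributes no ball.\<close>
  define q where "q = (if K = 0 then 1 else (6 * R (Suc K)) ^ CARD('d))"
  have q0: "0 \<le> q" using Suc.prems(2)[of "Suc K"] by (auto simp: q_def)
  define D where "D y = {a (Suc K)..} \<times>
      (if K = 0 then UNIV else {x. torus_dist (snd (y (\<sigma> (Suc K)))) x \<le> R (Suc K)})"
    for y :: "nat \<Rightarrow> real \<times> (real ^ 'd)"
  have D_meas: "D y \<in> sets ?L" for y
    unfolding D_def sets_vertex_measure by (intro pair_measureI) auto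
  have D_le: "emeasure ?L (D y) \<le> ennreal (measure M {a (Suc K)..} * q)" if y: "y \<in> S K" for y
  proof (cases "K = 0")
    case True
    have "emeasure uniform_torus (UNIV :: (real ^ 'd) set) = 1"
      using prob_space.emeasure_space_1[OF prob_space_uniform_torus] by simp
    then show ?thesis unfolding D_def using True
      by (subst emeasure_vertex_measure_Times) (simp_all add: q_def emeasure_eq_measure)
  next
    case False
    then have "\<sigma> (Suc K) \<in> {1..K}" using Suc.prems(1)[of "Suc K"] by auto
    with y have "snd (y (\<sigma> (Suc K))) \<in> torus" by (auto simp: S_def)
    with emeasure_torus_ball_le[OF this, of "R (Suc K)"] Suc.prems(2)[of "Suc K"] False
    have "emeasure uniform_torus {x. torus_dist (snd (y (\<sigma> (Suc K)))) x \<le> R (Suc K)} \<le> ennreal q"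
      by (auto simp: q_def)
    then show ?thesis unfolding D_def using False q0
      by (subst emeasure_vertex_measure_Times)
         (auto simp: emeasure_eq_measure ennreal_mult intro!: mult_left_mono)
  qed
  have "emeasure (PiM {1..Suc K} (\<lambda>_. ?L)) (S (Suc K))
      = (\<integral>\<^sup>+ y. (\<integral>\<^sup>+ z. indicator (S (Suc K)) (y(Suc K := z)) \<partial>?L) \<partial>PiM {1..K} (\<lambda>_. ?L))"
    using meas_Suc
    by (simp add: atLeastAtMostSuc_conv nn_integral_indicator[symmetric] P.product_nn_integral_insert
        del: nn_integral_indicator)
  also have "\<dots> \<le> (\<integral>\<^sup>+ y. indicator (S K) y * ennreal (measure M {a (Suc K)..} * q) \<partial>PiM {1..K} (\<lambda>_. ?L))"
  proof (intro nn_integral_mono)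
    fix y assume y: "y \<in> space (PiM {1..K} (\<lambda>_. ?L))"
    have "(\<integral>\<^sup>+ z. indicator (S (Suc K)) (y(Suc K := z)) \<partial>?L)
        \<le> (\<integral>\<^sup>+ z. indicator (S K) y * indicator (D y) z \<partial>?L)"
    proof (intro nn_integral_mono)
      fix z :: "real \<times> (real ^ 'd)"
      have "y \<in> S K \<and> z \<in> D y" if *: "y(Suc K := z) \<in> S (Suc K)"
      proof
        have i: "a i \<le> fst (y i) \<and> snd (y i) \<in> torus" if "i \<in> {1..K}" for i
        proof -
          have "i \<in> {1..Suc K}" "i \<noteq> Suc K" using that by auto
          then show ?thesis using * by (auto simp: S_def dest!: bspec[of _ _ i])
        qed
        have j: "torus_dist (snd (y (\<sigma> j))) (snd (y j)) \<le> R j" if "j \<in> {2..K}" for j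
        proof -
          have "j \<in> {2..Suc K}" "j \<noteq> Suc K" "\<sigma> j \<noteq> Suc K"
            using that Suc.prems(1)[of j] by auto
          then show ?thesis using * by (auto simp: S_def dest!: bspec[of _ _ j])
        qed
        from i j y show "y \<in> S K" by (auto simp: S_def)
        have "a (Suc K) \<le> fst z" using * by (auto simp: S_def dest!: bspec[of _ _ "Suc K"])
        moreover have "torus_dist (snd (y (\<sigma> (Suc K)))) (snd z) \<le> R (Suc K)" if "K \<noteq> 0"
        proof -
          have "Suc K \<in> {2..Suc K}" "\<sigma> (Suc K) \<noteq> Suc K"
            using that Suc.prems(1)[of "Suc K"] by auto
          then show ?thesis using * by (auto simp: S_def dest!: bspec[of _ _ "Suc K"])
        qed
        ultimately show "z \<in> D y" by (cases z) (auto simp: D_def)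
      qed
      then show "indicator (S (Suc K)) (y(Suc K := z)) \<le> (indicator (S K) y * indicator (D y) z :: ennreal)"
        by (auto split: split_indicator)
    qed
    also have "\<dots> = indicator (S K) y * emeasure ?L (D y)"
      using D_meas by (simp add: nn_integral_cmult)
    also have "\<dots> \<le> indicator (S K) y * ennreal (measure M {a (Suc K)..} * q)"
      using D_le by (auto split: split_indicator)
    finally show "(\<integral>\<^sup>+ z. indicator (S (Suc K)) (y(Suc K := z)) \<partial>?L) \<le> \<dots>" .
  qed
  also have "\<dots> = emeasure (PiM {1..K} (\<lambda>_. ?L)) (S K) * ennreal (measure M {a (Suc K)..} * q)"
    using meas[of K] by (simp add: nn_integral_multc)
  also have "\<dots> \<le> ennreal ((\<Prod>i\<in>{1..K}. measure M {a i..}) * (\<Prod>j\<in>{2..K}. (6 * R j) ^ CARD('d)))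
      * ennreal (measure M {a (Suc K)..} * q)"
    using Suc.IH Suc.prems by (intro mult_right_mono) (auto simp: S_def)
  also have "\<dots> = ennreal (((\<Prod>i\<in>{1..K}. measure M {a i..}) * (\<Prod>j\<in>{2..K}. (6 * R j) ^ CARD('d)))
      * (measure M {a (Suc K)..} * q))"
    using Suc.prems(2) q0
    by (intro ennreal_mult[symmetric] mult_nonneg_nonneg prod_nonneg) auto
  also have "((\<Prod>i\<in>{1..K}. measure M {a i..}) * (\<Prod>j\<in>{2..K}. (6 * R j) ^ CARD('d)))
      * (measure M {a (Suc K)..} * q)
      = (\<Prod>i\<in>{1..Suc K}. measure M {a i..}) * (\<Prod>j\<in>{2..Suc K}. (6 * R j) ^ CARD('d))"
    by (cases "K = 0") (simp_all add: q_def atLeastAtMostSuc_conv)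
  finally show ?case unfolding S_def .
qed

text \<open>Conditionally on the first point and on the second weight, the second position is uniform,
  and the forbidden event is that it lies on one given sphere.\<close>

lemma AE_torus_dist_neq_weights:
  fixes h :: "real \<Rightarrow> real \<Rightarrow> real"
  assumes [measurable]: "case_prod h \<in> borel_measurable (borel \<Otimes>\<^sub>M borel)"
  shows "AE p in vertex_measure M \<Otimes>\<^sub>M (vertex_measure M :: (real \<times> (real ^ 'd)) measure).
    torus_dist (snd (fst p)) (snd (snd p)) \<noteq> h (fst (fst p)) (fst (snd p))"
proof -
  let ?L = "vertex_measure M :: (real \<times> (real ^ 'd)) measure"
  interpret U: prob_space "uniform_torus :: (real ^ 'd) measure" by (rule prob_space_uniform_torus)
  interpret MU: pair_prob_space M "uniform_torus :: (real ^ 'd) measure" ..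
  interpret L: prob_space ?L by (rule prob_space_vertex_measure)
  interpret LL: pair_prob_space ?L ?L ..
  have inner: "AE b in ?L. torus_dist (snd a) (snd b) \<noteq> h (fst a) (fst b)"
    for a :: "real \<times> (real ^ 'd)"
    unfolding vertex_measure_def
  proof (rule MU.AE_pair_measure)
    show "AE t in M. AE y in uniform_torus. torus_dist (snd a) (snd (t, y)) \<noteq> h (fst a) (fst (t, y))"
      by (simp add: AE_torus_dist_neq)
  qed measurable
  show ?thesis
  proof (rule LL.AE_pair_measure)
    show "AE a in ?L. AE b in ?L. torus_dist (snd (fst (a, b))) (snd (snd (a, b)))
        \<noteq> h (fst (fst (a, b))) (fst (snd (a, b)))"
      using inner by simp
  qed measurable
qed

end

section \<open>The conditional law of a finite pattern of edges\<close>

lemma finite_vertex_pairs [simp]: "finite (vertex_pairs k)"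
  unfolding vertex_pairs_def by (rule finite_subset[of _ "Pow {1..k}"]) auto

lemma vertex_pairs_cases:
  assumes "e \<in> vertex_pairs k"
  obtains i j where "e = {i, j}" "i < j" "1 \<le> i" "j \<le> k" "Min e = i" "Max e = j"
proof -
  from assms obtain a b where ab: "e = {a, b}" "a \<noteq> b" "{a, b} \<subseteq> {1..k}"
    unfolding vertex_pairs_def by (auto simp: card_2_iff)
  show thesis
  proof (cases "a < b")
    case True
    with ab show thesis by (intro that[of a b]) (auto simp: insert_commute)
  next
    case False
    with ab show thesis by (intro that[of b a]) (auto simp: insert_commute)
  qed
qed

lemma doubleton_in_vertex_pairs:
  "i \<in> {1..k} \<Longrightarrow> j \<in> {1..k} \<Longrightarrow> i \<noteq> j \<Longrightarrow> {i, j} \<in> vertex_pairs k"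
  by (auto simp: vertex_pairs_def)

lemma bij_betw_ordered_pairs:
  "bij_betw (\<lambda>(u, v). {u, v}) {(u, v). 1 \<le> u \<and> u < v \<and> v \<le> n} (vertex_pairs n)"
proof (intro bij_betwI')
  fix e assume "e \<in> vertex_pairs n"
  then obtain i j where "e = {i, j}" "i < j" "1 \<le> i" "j \<le> n" by (rule vertex_pairs_cases)
  then show "\<exists>p\<in>{(u, v). 1 \<le> u \<and> u < v \<and> v \<le> n}. e = (case p of (u, v) \<Rightarrow> {u, v})"
    by (intro bexI[of _ "(i, j)"]) auto
qed (auto simp: doubleton_eq_iff doubleton_in_vertex_pairs)

text \<open>Summing the product law over the states of the pairs that are not prescribed gives the
  factor \<open>c + (1 - c) = 1\<close> for each of them.\<close>

lemma sum_prod_prescribed: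
  fixes c :: "'b \<Rightarrow> real"
  assumes "finite P" "S \<subseteq> P" "T \<subseteq> P" "S \<inter> T = {}"
  shows "(\<Sum>F | F \<subseteq> P \<and> S \<subseteq> F \<and> T \<inter> F = {}. \<Prod>e\<in>P. if e \<in> F then c e else 1 - c e)
    = (\<Prod>e\<in>S. c e) * (\<Prod>e\<in>T. 1 - c e)"
proof -
  \<comment> \<open>Setting the excluded factor of a prescribed pair to 0 turns the restricted sum into the
    full expansion of a product of sums.\<close>
  define f1 where "f1 e = (if e \<in> T then 0 else c e)" for e
  define f2 where "f2 e = (if e \<in> S then 0 else 1 - c e)" for e
  have fin: "finite S" "finite T" using assms by (auto intro: finite_subset)
  have "(\<Prod>e\<in>P. f1 e + f2 e)
      = (\<Prod>e\<in>S. f1 e + f2 e) * (\<Prod>e\<in>T. f1 e + f2 e) * (\<Prod>e\<in>P - (S \<union> T). f1 e + f2 e)"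
    using assms fin
    by (subst prod.subset_diff[of "S \<union> T"]) (auto simp: prod.union_disjoint mult.commute)
  also have "(\<Prod>e\<in>S. f1 e + f2 e) = (\<Prod>e\<in>S. c e)"
    using assms by (intro prod.cong) (auto simp: f1_def f2_def)
  also have "(\<Prod>e\<in>T. f1 e + f2 e) = (\<Prod>e\<in>T. 1 - c e)"
    using assms by (intro prod.cong) (auto simp: f1_def f2_def)
  also have "(\<Prod>e\<in>P - (S \<union> T). f1 e + f2 e) = 1"
    by (intro prod.neutral) (auto simp: f1_def f2_def)
  finally have 1: "(\<Prod>e\<in>P. f1 e + f2 e) = (\<Prod>e\<in>S. c e) * (\<Prod>e\<in>T. 1 - c e)" by simp
  have "(\<Prod>e\<in>P. f1 e + f2 e) = (\<Sum>X\<in>Pow P. (\<Prod>e\<in>X. f1 e) * (\<Prod>e\<in>P - X. f2 e))"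
    by (rule prod_add[OF assms(1)])
  also have "\<dots> = (\<Sum>X | X \<subseteq> P \<and> S \<subseteq> X \<and> T \<inter> X = {}. (\<Prod>e\<in>X. f1 e) * (\<Prod>e\<in>P - X. f2 e))"
  proof (rule sum.mono_neutral_right)
    show "\<forall>X\<in>Pow P - {X. X \<subseteq> P \<and> S \<subseteq> X \<and> T \<inter> X = {}}. (\<Prod>e\<in>X. f1 e) * (\<Prod>e\<in>P - X. f2 e) = 0"
    proof
      fix X assume "X \<in> Pow P - {X. X \<subseteq> P \<and> S \<subseteq> X \<and> T \<inter> X = {}}"
      then have X: "X \<subseteq> P" "\<not> S \<subseteq> X \<or> T \<inter> X \<noteq> {}" by auto
      then have finX: "finite X" using assms(1) finite_subset by auto
      from X(2) show "(\<Prod>e\<in>X. f1 e) * (\<Prod>e\<in>P - X. f2 e) = 0"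
      proof
        assume "\<not> S \<subseteq> X"
        then obtain e where "e \<in> S" "e \<notin> X" by auto
        then have "e \<in> P - X" "f2 e = 0" using assms(2) by (auto simp: f2_def)
        then have "(\<Prod>e\<in>P - X. f2 e) = 0" using assms(1) by (intro prod_zero) auto
        then show ?thesis by simp
      next
        assume "T \<inter> X \<noteq> {}"
        then obtain e where "e \<in> X" "e \<in> T" by auto
        then have "e \<in> X" "f1 e = 0" by (auto simp: f1_def)
        then have "(\<Prod>e\<in>X. f1 e) = 0" using finX by (intro prod_zero) auto
        then show ?thesis by simp
      qed
    qed
  qed (use assms in auto)
  also have "\<dots> = (\<Sum>F | F \<subseteq> P \<and> S \<subseteq> F \<and> T \<inter> F = {}. \<Prod>e\<in>P. if e \<in> F then c e else 1 - c e)"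
  proof (intro sum.cong refl)
    fix X assume "X \<in> {X. X \<subseteq> P \<and> S \<subseteq> X \<and> T \<inter> X = {}}"
    then have X: "X \<subseteq> P" "S \<subseteq> X" "T \<inter> X = {}" by auto
    have "(\<Prod>e\<in>P. if e \<in> X then c e else 1 - c e)
        = (\<Prod>e\<in>P - X. if e \<in> X then c e else 1 - c e) * (\<Prod>e\<in>X. if e \<in> X then c e else 1 - c e)"
      by (rule prod.subset_diff[OF X(1) assms(1)])
    also have "(\<Prod>e\<in>P - X. if e \<in> X then c e else 1 - c e) = (\<Prod>e\<in>P - X. f2 e)"
      using X by (intro prod.cong) (auto simp: f2_def)
    also have "(\<Prod>e\<in>X. if e \<in> X then c e else 1 - c e) = (\<Prod>e\<in>X. f1 e)"
      using X by (intro prod.cong) (auto simp: f1_def)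
    finally show "(\<Prod>e\<in>X. f1 e) * (\<Prod>e\<in>P - X. f2 e) = (\<Prod>e\<in>P. if e \<in> X then c e else 1 - c e)"
      by simp
  qed
  finally show ?thesis using 1 by simp
qed

lemma connection_prob_commute: "connection_prob \<gamma> \<mu> n a b = connection_prob \<gamma> \<mu> n b a"
  unfolding connection_prob_def torus_dist_commute[of "snd a" "snd b"] mult.commute[of "fst a" "fst b"]
  by (rule refl)

lemma connection_prob_bounds: "0 \<le> connection_prob \<gamma> \<mu> n a b" "connection_prob \<gamma> \<mu> n a b \<le> 1"
  by (auto simp: connection_prob_def Let_def)

lemma connection_prob_measurable [measurable (raw)]:
  assumes [measurable]: "f \<in> N \<rightarrow>\<^sub>M borel \<Otimes>\<^sub>M borel" "g \<in> N \<rightarrow>\<^sub>M borel \<Otimes>\<^sub>M borel"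
  shows "(\<lambda>\<omega>. connection_prob \<gamma> \<mu> n (f \<omega>) (g \<omega> :: real \<times> (real ^ 'd))) \<in> borel_measurable N"
  unfolding connection_prob_def Let_def by measurable

text \<open>Pairs of vertices are unordered; since the connection probability is symmetric, its two
  arguments may be taken in the order of the indices.\<close>

definition pair_prob :: "ereal \<Rightarrow> real \<Rightarrow> nat \<Rightarrow> (nat \<Rightarrow> real \<times> (real ^ 'd)) \<Rightarrow> nat set \<Rightarrow> real" where
  "pair_prob \<gamma> \<mu> n y e = connection_prob \<gamma> \<mu> n (y (Min e)) (y (Max e))"

lemma pair_prob_bounds: "0 \<le> pair_prob \<gamma> \<mu> n y e" "pair_prob \<gamma> \<mu> n y e \<le> 1"
  by (auto simp: pair_prob_def connection_prob_bounds)

lemma pair_prob_doubleton: "i \<noteq> j \<Longrightarrow> pair_prob \<gamma> \<mu> n y {i, j} = connection_prob \<gamma> \<mu> n (y i) (y j)"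
proof -
  assume "i \<noteq> j"
  have "Min {i, j} = min i j" "Max {i, j} = max i j" by auto
  then show ?thesis
    using connection_prob_commute[of \<gamma> \<mu> n "y i" "y j"]
    by (cases "i \<le> j") (simp_all only: pair_prob_def max_def min_def if_True if_False)
qed

lemma pair_prob_image:
  assumes "e \<in> vertex_pairs k" "inj_on v {1..k}"
  shows "pair_prob \<gamma> \<mu> n y (v ` e) = pair_prob \<gamma> \<mu> n (\<lambda>i. y (v i)) e"
proof -
  from assms(1) obtain i j where *: "e = {i, j}" "i < j" "1 \<le> i" "j \<le> k" by (rule vertex_pairs_cases)
  have "v i \<noteq> v j" using inj_onD[OF assms(2), of i j] *(2-4) by auto
  then have "pair_prob \<gamma> \<mu> n y {v i, v j} = connection_prob \<gamma> \<mu> n (y (v i)) (y (v j))"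
    by (rule pair_prob_doubleton)
  moreover have "pair_prob \<gamma> \<mu> n (\<lambda>i. y (v i)) {i, j} = connection_prob \<gamma> \<mu> n (y (v i)) (y (v j))"
    using *(2) by (intro pair_prob_doubleton) auto
  ultimately show ?thesis unfolding *(1) by (simp only: image_insert image_empty)
qed

lemma pair_prob_cong:
  assumes "e \<in> vertex_pairs k" "\<And>i. i \<in> {1..k} \<Longrightarrow> y i = z i"
  shows "pair_prob \<gamma> \<mu> n y e = pair_prob \<gamma> \<mu> n z e"
proof -
  have "Min e \<in> {1..k}" "Max e \<in> {1..k}" using assms(1) by (auto elim!: vertex_pairs_cases)
  then show ?thesis by (simp only: pair_prob_def assms(2))
qed

lemma pair_prob_measurable [measurable]:
  assumes "e \<in> vertex_pairs k"
  shows "(\<lambda>y. pair_prob \<gamma> \<mu> n y e) \<in> borel_measurable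
    (PiM {1..k} (\<lambda>_. borel \<Otimes>\<^sub>M borel :: (real \<times> (real ^ 'd)) measure))"
proof -
  have "Min e \<in> {1..k}" "Max e \<in> {1..k}" using assms by (auto elim!: vertex_pairs_cases)
  then show ?thesis unfolding pair_prob_def by measurable
qed

locale weighted_girg = girg M \<gamma> \<nu> n w x G + W: real_distribution \<nu>
  for M :: "'a measure" and \<gamma> :: ereal and \<nu> :: "real measure" and n :: nat
    and w :: "nat \<Rightarrow> 'a \<Rightarrow> real" and x :: "nat \<Rightarrow> 'a \<Rightarrow> real ^ 'd" and G :: "'a \<Rightarrow> nat set set" +
  assumes n_pos: "1 \<le> n"
begin

abbreviation \<mu> :: real where "\<mu> \<equiv> \<integral>y. y \<partial>\<nu>"

abbreviation coords :: "'a \<Rightarrow> nat \<Rightarrow> real \<times> (real ^ 'd)" where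
  "coords \<omega> i \<equiv> (w i \<omega>, x i \<omega>)"

abbreviation config_space :: "nat set \<Rightarrow> (nat \<Rightarrow> real \<times> (real ^ 'd)) measure" where
  "config_space I \<equiv> PiM I (\<lambda>_. borel \<Otimes>\<^sub>M borel)"

lemma coords_measurable: "i \<in> {1..n} \<Longrightarrow> (\<lambda>\<omega>. coords \<omega> i) \<in> M \<rightarrow>\<^sub>M borel \<Otimes>\<^sub>M borel"
  using indep_vertices by (auto simp: indep_vars_def)

lemma configuration_measurable:
  "v \<in> I \<rightarrow> {1..n} \<Longrightarrow> (\<lambda>\<omega>. \<lambda>i\<in>I. coords \<omega> (v i)) \<in> M \<rightarrow>\<^sub>M config_space I"
  by (rule measurable_restrict) (auto intro!: coords_measurable)

lemma distr_configuration:
  "distr M (config_space {1..n}) (\<lambda>\<omega>. \<lambda>i\<in>{1..n}. coords \<omega> i) = PiM {1..n} (\<lambda>_. vertex_measure \<nu>)"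
proof -
  have "{1..n} \<noteq> {}" using n_pos by auto
  from indep_vars_iff_distr_eq_PiM'[OF this, of "\<lambda>i \<omega>. coords \<omega> i" "\<lambda>_. borel \<Otimes>\<^sub>M borel"]
  have "distr M (config_space {1..n}) (\<lambda>\<omega>. \<lambda>i\<in>{1..n}. coords \<omega> i)
      = PiM {1..n} (\<lambda>i. distr M (borel \<Otimes>\<^sub>M borel) (\<lambda>\<omega>. coords \<omega> i))"
    using indep_vertices coords_measurable by auto
  also have "\<dots> = PiM {1..n} (\<lambda>_. vertex_measure \<nu>)"
    by (intro PiM_cong) (auto simp: vertex_law vertex_measure_def)
  finally show ?thesis .
qed

lemma distr_tuple:
  assumes v: "v \<in> {1..K} \<rightarrow> {1..n}" "inj_on v {1..K}"
  shows "distr M (config_space {1..K}) (\<lambda>\<omega>. \<lambda>i\<in>{1..K}. coords \<omega> (v i))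
    = PiM {1..K} (\<lambda>_. vertex_measure \<nu>)"
proof -
  have m: "(\<lambda>\<omega>. \<lambda>i\<in>{1..n}. coords \<omega> i) \<in> M \<rightarrow>\<^sub>M config_space {1..n}"
    using configuration_measurable[of "\<lambda>i. i"] by auto
  have m2: "(\<lambda>y. \<lambda>i\<in>{1..K}. y (v i)) \<in> config_space {1..n} \<rightarrow>\<^sub>M config_space {1..K}"
    using v by (intro measurable_restrict measurable_component_singleton) auto
  have s: "sets (PiM I (\<lambda>_. vertex_measure \<nu>)) = sets (config_space I)" for I
    by (intro sets_PiM_cong refl W.sets_vertex_measure)
  have "PiM {1..K} (\<lambda>_. vertex_measure \<nu>) = distr (PiM {1..n} (\<lambda>_. vertex_measure \<nu>))
      (PiM {1..K} (\<lambda>_. vertex_measure \<nu>)) (\<lambda>y. \<lambda>i\<in>{1..K}. y (v i))"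
    using v by (intro distr_PiM_reindex[symmetric] W.prob_space_vertex_measure) auto
  also have "\<dots> = distr (distr M (config_space {1..n}) (\<lambda>\<omega>. \<lambda>i\<in>{1..n}. coords \<omega> i))
      (config_space {1..K}) (\<lambda>y. \<lambda>i\<in>{1..K}. y (v i))"
    by (intro distr_cong distr_configuration[symmetric] s refl)
  also have "\<dots> = distr M (config_space {1..K})
      ((\<lambda>y. \<lambda>i\<in>{1..K}. y (v i)) \<circ> (\<lambda>\<omega>. \<lambda>i\<in>{1..n}. coords \<omega> i))"
    by (rule distr_distr[OF m2 m])
  also have "(\<lambda>y. \<lambda>i\<in>{1..K}. y (v i)) \<circ> (\<lambda>\<omega>. \<lambda>i\<in>{1..n}. coords \<omega> i)
      = (\<lambda>\<omega>. \<lambda>i\<in>{1..K}. coords \<omega> (v i))"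
    using v by (auto simp: fun_eq_iff restrict_def Pi_iff)
  finally show ?thesis by (rule sym)
qed

lemma edge_event_measurable [measurable]: "{\<omega> \<in> space M. G \<omega> \<in> Q} \<in> events"
proof -
  have "{\<omega> \<in> space M. G \<omega> \<in> Q} = G -` (Q \<inter> Pow (vertex_pairs n)) \<inter> space M"
    using measurable_space[OF edges_measurable] by auto
  also have "\<dots> \<in> events" by (rule measurable_sets[OF edges_measurable]) auto
  finally show ?thesis .
qed

text \<open>The conditional law of the edge set is tested against a function of the weights and
  positions, and then summed over the edge sets that are compatible with the pattern.\<close>

lemma expectation_edge_pattern:
  assumes S: "S \<subseteq> vertex_pairs n" and T: "T \<subseteq> vertex_pairs n" and disj: "S \<inter> T = {}"
    and h: "h \<in> borel_measurable (config_space {1..n})" "\<And>y. \<bar>h y\<bar> \<le> 1"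
  shows "expectation (\<lambda>\<omega>. h (\<lambda>i\<in>{1..n}. coords \<omega> i) * of_bool (S \<subseteq> G \<omega> \<and> T \<inter> G \<omega> = {}))
    = expectation (\<lambda>\<omega>. h (\<lambda>i\<in>{1..n}. coords \<omega> i) *
        ((\<Prod>e\<in>S. pair_prob \<gamma> \<mu> n (coords \<omega>) e) * (\<Prod>e\<in>T. 1 - pair_prob \<gamma> \<mu> n (coords \<omega>) e)))"
proof -
  let ?X = "\<lambda>\<omega>. \<lambda>i\<in>{1..n}. coords \<omega> i"
  let ?F = "vimage_algebra (space M) ?X (config_space {1..n})"
  have X: "?X \<in> M \<rightarrow>\<^sub>M config_space {1..n}"
    using configuration_measurable[of "\<lambda>i. i"] by auto
  have sub: "subalgebra M ?F"
    unfolding subalgebra_def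
  proof
    have "?X \<in> space M \<rightarrow> space (config_space {1..n})" using measurable_space[OF X] by auto
    from sets_vimage_algebra2[OF this] show "sets ?F \<subseteq> events"
      using measurable_sets[OF X] by auto
  qed auto
  interpret S: sigma_finite_subalgebra M ?F
    by (rule finite_measure_subalgebra_is_sigma_finite) (unfold_locales, rule sub)
  let ?c = "\<lambda>\<omega> e. pair_prob \<gamma> \<mu> n (coords \<omega>) e"
  let ?C = "{F. F \<subseteq> vertex_pairs n \<and> S \<subseteq> F \<and> T \<inter> F = {}}"
  let ?p = "\<lambda>\<omega> F. \<Prod>e\<in>vertex_pairs n. if e \<in> F then ?c \<omega> e else 1 - ?c \<omega> e"
  have finC: "finite ?C" by (rule finite_subset[of _ "Pow (vertex_pairs n)"]) auto
  have hF: "(\<lambda>\<omega>. h (?X \<omega>)) \<in> borel_measurable ?F"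
  proof -
    have "?X \<in> ?F \<rightarrow>\<^sub>M config_space {1..n}"
      by (rule measurable_vimage_algebra1) (use measurable_space[OF X] in auto)
    from measurable_compose[OF this h(1)] show ?thesis .
  qed
  have hM: "(\<lambda>\<omega>. h (?X \<omega>)) \<in> borel_measurable M"
    using measurable_compose[OF X h(1)] .
  have law: "AE \<omega> in M. real_cond_exp M ?F (indicator {\<omega>' \<in> space M. G \<omega>' = F}) \<omega> = ?p \<omega> F"
    if "F \<subseteq> vertex_pairs n" for F
  proof -
    have "(\<Prod>(u, v) \<in> {(u, v). 1 \<le> u \<and> u < v \<and> v \<le> n}.
              let p = connection_prob \<gamma> \<mu> n (w u \<omega>, x u \<omega>) (w v \<omega>, x v \<omega>)
              in if {u, v} \<in> F then p else 1 - p) = ?p \<omega> F" for \<omega>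
      by (subst prod.reindex_bij_betw[OF bij_betw_ordered_pairs, symmetric])
         (auto intro!: prod.cong simp: Let_def pair_prob_doubleton)
    with edges_law[OF that] show ?thesis by simp
  qed
  have meas_G: "(indicator {\<omega> \<in> space M. G \<omega> = F} :: 'a \<Rightarrow> real) \<in> borel_measurable M" for F
    using edge_event_measurable[of "{F}"] by simp
  have intg: "integrable M (\<lambda>\<omega>. h (?X \<omega>) * indicator {\<omega> \<in> space M. G \<omega> = F} \<omega>)" for F
    using hM meas_G h(2)
    by (intro integrable_const_bound[of _ 1] borel_measurable_times)
       (auto intro!: AE_I2 split: split_indicator)
  have intg2: "integrable M (\<lambda>\<omega>. h (?X \<omega>) * real_cond_exp M ?F (indicator {\<omega> \<in> space M. G \<omega> = F}) \<omega>)" for F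
    by (rule S.real_cond_exp_intg(1)[OF intg hF meas_G])
  have "expectation (\<lambda>\<omega>. h (?X \<omega>) * of_bool (S \<subseteq> G \<omega> \<and> T \<inter> G \<omega> = {}))
      = expectation (\<lambda>\<omega>. \<Sum>F\<in>?C. h (?X \<omega>) * indicator {\<omega> \<in> space M. G \<omega> = F} \<omega>)"
  proof (intro Bochner_Integration.integral_cong refl)
    fix \<omega> assume \<omega>: "\<omega> \<in> space M"
    then have "G \<omega> \<subseteq> vertex_pairs n" using measurable_space[OF edges_measurable] by auto
    have "(\<Sum>F\<in>?C. h (?X \<omega>) * indicator {\<omega> \<in> space M. G \<omega> = F} \<omega>)
        = (\<Sum>F\<in>?C. if F = G \<omega> then h (?X \<omega>) else 0)"
      using \<omega> by (intro sum.cong) auto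
    also have "\<dots> = h (?X \<omega>) * of_bool (S \<subseteq> G \<omega> \<and> T \<inter> G \<omega> = {})"
      using \<open>G \<omega> \<subseteq> vertex_pairs n\<close> finC by (subst sum.delta) auto
    finally show "h (?X \<omega>) * of_bool (S \<subseteq> G \<omega> \<and> T \<inter> G \<omega> = {})
        = (\<Sum>F\<in>?C. h (?X \<omega>) * indicator {\<omega> \<in> space M. G \<omega> = F} \<omega>)" by (rule sym)
  qed
  also have "\<dots> = (\<Sum>F\<in>?C. expectation (\<lambda>\<omega>. h (?X \<omega>) * indicator {\<omega> \<in> space M. G \<omega> = F} \<omega>))"
    using intg by (intro Bochner_Integration.integral_sum) auto
  also have "\<dots> = (\<Sum>F\<in>?C. expectation (\<lambda>\<omega>. h (?X \<omega>) *
      real_cond_exp M ?F (indicator {\<omega> \<in> space M. G \<omega> = F}) \<omega>))"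
    by (intro sum.cong refl S.real_cond_exp_intg(2)[OF intg hF meas_G, symmetric])
  also have "\<dots> = expectation (\<lambda>\<omega>. \<Sum>F\<in>?C. h (?X \<omega>) *
      real_cond_exp M ?F (indicator {\<omega> \<in> space M. G \<omega> = F}) \<omega>)"
    using intg2 by (intro Bochner_Integration.integral_sum[symmetric]) auto
  also have "\<dots> = expectation (\<lambda>\<omega>. h (?X \<omega>) *
      ((\<Prod>e\<in>S. ?c \<omega> e) * (\<Prod>e\<in>T. 1 - ?c \<omega> e)))"
  proof (rule integral_cong_AE)
    have [measurable]: "(\<lambda>\<omega>. ?c \<omega> e) \<in> borel_measurable M" if "e \<in> vertex_pairs n" for e
    proof -
      have "(\<lambda>\<omega>. pair_prob \<gamma> \<mu> n (?X \<omega>) e) \<in> borel_measurable M"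
        by (rule measurable_compose[OF X pair_prob_measurable[OF that]])
      also have "(\<lambda>\<omega>. pair_prob \<gamma> \<mu> n (?X \<omega>) e) = (\<lambda>\<omega>. ?c \<omega> e)"
        using that by (intro ext pair_prob_cong) auto
      finally show ?thesis .
    qed
    show "(\<lambda>\<omega>. h (?X \<omega>) * ((\<Prod>e\<in>S. ?c \<omega> e) * (\<Prod>e\<in>T. 1 - ?c \<omega> e))) \<in> borel_measurable M"
      using S T by (intro borel_measurable_times hM borel_measurable_prod borel_measurable_diff) auto
    have "AE \<omega> in M. \<forall>F\<in>?C. real_cond_exp M ?F (indicator {\<omega> \<in> space M. G \<omega> = F}) \<omega> = ?p \<omega> F"
      using law by (intro AE_finite_allI finC) auto
    then show "AE \<omega> in M. (\<Sum>F\<in>?C. h (?X \<omega>) *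
        real_cond_exp M ?F (indicator {\<omega> \<in> space M. G \<omega> = F}) \<omega>)
        = h (?X \<omega>) * ((\<Prod>e\<in>S. ?c \<omega> e) * (\<Prod>e\<in>T. 1 - ?c \<omega> e))"
    proof eventually_elim
      case (elim \<omega>)
      then show ?case
        using sum_prod_prescribed[OF finite_vertex_pairs S T disj, of "?c \<omega>"]
        by (simp add: sum_distrib_left[symmetric])
    qed
  qed (use intg2 in auto)
  finally show ?thesis .
qed

end

section \<open>First and second moments of class counts\<close>

definition forbidden_pairs :: "mode \<Rightarrow> nat \<Rightarrow> nat set set \<Rightarrow> nat set set" where
  "forbidden_pairs m k E = (case m of Ind \<Rightarrow> vertex_pairs k - E | Sub \<Rightarrow> {})"

definition class_region ::
    "nat \<Rightarrow> nat \<Rightarrow> real \<Rightarrow> (nat \<Rightarrow> real) \<times> (nat set \<Rightarrow> real) \<Rightarrow> (nat \<Rightarrow> real \<times> (real ^ 'd)) set" where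
  "class_region k n \<epsilon> p = {y.
     (\<forall>i\<in>{1..k}. fst (y i) \<in> scale_interval \<epsilon> n (fst p i)) \<and>
     (\<forall>i\<in>{1..k}. \<forall>j\<in>{1..k}. i \<noteq> j \<longrightarrow>
        torus_dist (snd (y i)) (snd (y j)) \<in> scale_interval \<epsilon> n (snd p {i, j}))}"

text \<open>This is the conditional probability, given the weights and positions of its vertices, that a
  tuple lies in the class and spans the pattern.\<close>

definition pattern_density ::
    "mode \<Rightarrow> nat \<Rightarrow> nat set set \<Rightarrow> ereal \<Rightarrow> real \<Rightarrow> nat \<Rightarrow> real \<Rightarrow> (nat \<Rightarrow> real) \<times> (nat set \<Rightarrow> real)
      \<Rightarrow> (nat \<Rightarrow> real \<times> (real ^ 'd)) \<Rightarrow> real" where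
  "pattern_density m k E \<gamma> \<mu> n \<epsilon> p y = indicator (class_region k n \<epsilon> p) y *
     ((\<Prod>e\<in>E. pair_prob \<gamma> \<mu> n y e) * (\<Prod>e\<in>forbidden_pairs m k E. 1 - pair_prob \<gamma> \<mu> n y e))"

definition tuple_prob ::
    "'d::finite itself \<Rightarrow> mode \<Rightarrow> nat \<Rightarrow> nat set set \<Rightarrow> ereal \<Rightarrow> real measure \<Rightarrow> nat \<Rightarrow> real
      \<Rightarrow> (nat \<Rightarrow> real) \<times> (nat set \<Rightarrow> real) \<Rightarrow> real" where
  "tuple_prob _ m k E \<gamma> \<nu> n \<epsilon> p =
     (\<integral>y. pattern_density m k E \<gamma> (\<integral>t. t \<partial>\<nu>) n \<epsilon> p y
        \<partial>PiM {1..k} (\<lambda>_. vertex_measure \<nu> :: (real \<times> (real ^ 'd)) measure))"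

lemma forbidden_pairs_subset: "forbidden_pairs m k E \<subseteq> vertex_pairs k"
  by (auto simp: forbidden_pairs_def split: mode.splits)

lemma forbidden_pairs_disjoint: "E \<inter> forbidden_pairs m k E = {}"
  by (auto simp: forbidden_pairs_def split: mode.splits)

lemma class_region_measurable [measurable]:
  "Measurable.pred (PiM {1..k} (\<lambda>_. borel \<Otimes>\<^sub>M borel :: (real \<times> (real ^ 'd)) measure))
     (\<lambda>y. y \<in> class_region k n \<epsilon> p)"
  unfolding class_region_def scale_interval_def mem_Collect_eq by measurable

lemma class_region_cong:
  assumes "\<And>i. i \<in> {1..k} \<Longrightarrow> y i = z i"
  shows "y \<in> class_region k n \<epsilon> p \<longleftrightarrow> z \<in> class_region k n \<epsilon> p"
  using assms by (simp add: class_region_def)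

lemma pattern_density_cong:
  assumes "E \<subseteq> vertex_pairs k" "\<And>i. i \<in> {1..k} \<Longrightarrow> y i = z i"
  shows "pattern_density m k E \<gamma> \<mu> n \<epsilon> p y = pattern_density m k E \<gamma> \<mu> n \<epsilon> p z"
proof -
  have "pair_prob \<gamma> \<mu> n y e = pair_prob \<gamma> \<mu> n z e" if "e \<in> E \<union> forbidden_pairs m k E" for e
    using that assms(1) forbidden_pairs_subset[of m k E]
    by (intro pair_prob_cong[OF _ assms(2)]) auto
  then have "(\<Prod>e\<in>E. pair_prob \<gamma> \<mu> n y e) = (\<Prod>e\<in>E. pair_prob \<gamma> \<mu> n z e)"
    "(\<Prod>e\<in>forbidden_pairs m k E. 1 - pair_prob \<gamma> \<mu> n y e)
      = (\<Prod>e\<in>forbidden_pairs m k E. 1 - pair_prob \<gamma> \<mu> n z e)"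
    by (auto intro!: prod.cong)
  then show ?thesis
    using class_region_cong[OF assms(2), where n = n and \<epsilon> = \<epsilon> and p = p]
    by (simp add: pattern_density_def indicator_def)
qed

lemma pattern_density_bounds:
  "0 \<le> pattern_density m k E \<gamma> \<mu> n \<epsilon> p y" "pattern_density m k E \<gamma> \<mu> n \<epsilon> p y \<le> 1"
proof -
  have a: "0 \<le> (\<Prod>e\<in>E. pair_prob \<gamma> \<mu> n y e)" "(\<Prod>e\<in>E. pair_prob \<gamma> \<mu> n y e) \<le> 1"
    by (auto intro!: prod_nonneg prod_le_1 simp: pair_prob_bounds)
  have b: "0 \<le> (\<Prod>e\<in>forbidden_pairs m k E. 1 - pair_prob \<gamma> \<mu> n y e)"
    "(\<Prod>e\<in>forbidden_pairs m k E. 1 - pair_prob \<gamma> \<mu> n y e) \<le> 1"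
    by (auto intro!: prod_nonneg prod_le_1 simp: pair_prob_bounds)
  show "0 \<le> pattern_density m k E \<gamma> \<mu> n \<epsilon> p y" "pattern_density m k E \<gamma> \<mu> n \<epsilon> p y \<le> 1"
    using a b mult_mono[OF a(2) b(2)] by (auto simp: pattern_density_def indicator_def)
qed

lemma pattern_density_measurable [measurable]:
  assumes "E \<subseteq> vertex_pairs k"
  shows "pattern_density m k E \<gamma> \<mu> n \<epsilon> p \<in> borel_measurable
    (PiM {1..k} (\<lambda>_. borel \<Otimes>\<^sub>M borel :: (real \<times> (real ^ 'd)) measure))"
proof -
  have "(\<lambda>y. indicator (class_region k n \<epsilon> p) y :: real) \<in> borel_measurable
      (PiM {1..k} (\<lambda>_. borel \<Otimes>\<^sub>M borel :: (real \<times> (real ^ 'd)) measure))"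
    unfolding indicator_def by measurable
  then show ?thesis
    unfolding pattern_density_def
    using assms forbidden_pairs_subset[of m k E]
    by (intro borel_measurable_times borel_measurable_prod borel_measurable_diff
        pair_prob_measurable) auto
qed

lemma vertex_tuplesD:
  assumes "v \<in> vertex_tuples k n"
  shows "v \<in> {1..k} \<rightarrow> {1..n}" "inj_on v {1..k}"
  using assms by (auto simp: vertex_tuples_def PiE_def)

lemma finite_vertex_tuples [simp]: "finite (vertex_tuples k n)"
  unfolding vertex_tuples_def by (auto intro!: finite_PiE)

lemma image_vertex_pairs:
  assumes "v \<in> vertex_tuples k n" "e \<in> vertex_pairs k"
  shows "v ` e \<in> vertex_pairs n"
  using assms vertex_tuplesD[OF assms(1)] card_image[OF inj_on_subset[of v "{1..k}" e]]
  by (auto simp: vertex_pairs_def)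

lemma inj_on_image_vertex_pairs:
  assumes "inj_on v {1..k}"
  shows "inj_on ((`) v) (vertex_pairs k)"
  using assms by (intro inj_onI) (simp add: inj_on_image_eq_iff vertex_pairs_def)

text \<open>Induced and not necessarily induced copies are treated alike: the pattern requires the
  pairs in E and, in the induced case, forbids all others.\<close>

lemma occurs_iff:
  assumes E: "E \<subseteq> vertex_pairs k"
  shows "occurs m k E F v \<longleftrightarrow>
    (`) v ` E \<subseteq> F \<and> (`) v ` forbidden_pairs m k E \<inter> F = {}"
proof -
  have all: "(\<forall>i\<in>{1..k}. \<forall>j\<in>{1..k}. i \<noteq> j \<longrightarrow> Q {i, j}) \<longleftrightarrow> (\<forall>e\<in>vertex_pairs k. Q e)" for Q
  proof (intro iffI ballI impI)
    fix e assume *: "\<forall>i\<in>{1..k}. \<forall>j\<in>{1..k}. i \<noteq> j \<longrightarrow> Q {i, j}" and "e \<in> vertex_pairs k"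
    then obtain i j where "e = {i, j}" "i < j" "1 \<le> i" "j \<le> k" by (elim vertex_pairs_cases)
    with * show "Q e" by auto
  qed (use doubleton_in_vertex_pairs in blast)
  have "occurs m k E F v \<longleftrightarrow> (\<forall>i\<in>{1..k}. \<forall>j\<in>{1..k}. i \<noteq> j \<longrightarrow>
      (case m of Ind \<Rightarrow> v ` {i, j} \<in> F \<longleftrightarrow> {i, j} \<in> E | Sub \<Rightarrow> {i, j} \<in> E \<longrightarrow> v ` {i, j} \<in> F))"
    by (simp only: occurs_def image_insert image_empty)
  also have "\<dots> \<longleftrightarrow> (\<forall>e\<in>vertex_pairs k.
      (case m of Ind \<Rightarrow> v ` e \<in> F \<longleftrightarrow> e \<in> E | Sub \<Rightarrow> e \<in> E \<longrightarrow> v ` e \<in> F))"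
    by (rule all)
  also have "\<dots> \<longleftrightarrow> (`) v ` E \<subseteq> F \<and> (`) v ` forbidden_pairs m k E \<inter> F = {}"
    using E by (cases m) (auto simp: forbidden_pairs_def)
  finally show ?thesis .
qed

lemma tuple_class_iff:
  "v \<in> tuple_class k n \<epsilon> p (\<lambda>i. fst (y i)) (\<lambda>i. snd (y i)) \<longleftrightarrow>
     v \<in> vertex_tuples k n \<and> (\<lambda>i. y (v i)) \<in> class_region k n \<epsilon> p"
  by (simp add: tuple_class_def class_region_def)

context weighted_girg
begin

definition appears ::
    "mode \<Rightarrow> nat \<Rightarrow> nat set set \<Rightarrow> real \<Rightarrow> (nat \<Rightarrow> real) \<times> (nat set \<Rightarrow> real) \<Rightarrow> (nat \<Rightarrow> nat) \<Rightarrow> 'a set" where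
  "appears m k E \<epsilon> p v =
     {\<omega> \<in> space M. (\<lambda>i. coords \<omega> (v i)) \<in> class_region k n \<epsilon> p \<and> occurs m k E (G \<omega>) v}"

lemma class_count_eq_sum:
  assumes "\<omega> \<in> space M"
  shows "class_count m k E n \<epsilon> p w x G \<omega> = (\<Sum>v\<in>vertex_tuples k n. indicator (appears m k E \<epsilon> p v) \<omega>)"
proof -
  have eq: "tuple_class k n \<epsilon> p (\<lambda>i. w i \<omega>) (\<lambda>i. x i \<omega>)
      = {v \<in> vertex_tuples k n. (\<lambda>i. coords \<omega> (v i)) \<in> class_region k n \<epsilon> p}"
    using tuple_class_iff[of _ k n \<epsilon> p "coords \<omega>"] by auto
  have "class_count m k E n \<epsilon> p w x G \<omega> = (\<Sum>v\<in>vertex_tuples k n.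
      if (\<lambda>i. coords \<omega> (v i)) \<in> class_region k n \<epsilon> p then of_bool (occurs m k E (G \<omega>) v) else 0)"
    unfolding class_count_def subgraph_count_def eq by (subst sum.inter_filter) auto
  also have "\<dots> = (\<Sum>v\<in>vertex_tuples k n. indicator (appears m k E \<epsilon> p v) \<omega>)"
    using assms by (intro sum.cong) (auto simp: appears_def indicator_def)
  finally show ?thesis .
qed

lemma tuple_coords_measurable:
  assumes "v \<in> vertex_tuples k n"
  shows "(\<lambda>\<omega>. \<lambda>i\<in>{1..k}. coords \<omega> (v i)) \<in> M \<rightarrow>\<^sub>M config_space {1..k}"
  using vertex_tuplesD[OF assms] by (intro configuration_measurable)

lemma appears_measurable [measurable]:
  assumes "v \<in> vertex_tuples k n"
  shows "appears m k E \<epsilon> p v \<in> events"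
proof -
  have "Measurable.pred M (\<lambda>\<omega>. (\<lambda>i\<in>{1..k}. coords \<omega> (v i)) \<in> class_region k n \<epsilon> p)"
    using measurable_compose[OF tuple_coords_measurable[OF assms] class_region_measurable] .
  also have "(\<lambda>\<omega>. (\<lambda>i\<in>{1..k}. coords \<omega> (v i)) \<in> class_region k n \<epsilon> p)
      = (\<lambda>\<omega>. (\<lambda>i. coords \<omega> (v i)) \<in> class_region k n \<epsilon> p)"
    by (intro ext class_region_cong) auto
  finally have "{\<omega> \<in> space M. (\<lambda>i. coords \<omega> (v i)) \<in> class_region k n \<epsilon> p} \<in> events"
    by (simp add: pred_def)
  then have "{\<omega> \<in> space M. (\<lambda>i. coords \<omega> (v i)) \<in> class_region k n \<epsilon> p} \<inter>
      {\<omega> \<in> space M. G \<omega> \<in> {F. occurs m k E F v}} \<in> events"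
    using edge_event_measurable by blast
  moreover have "{\<omega> \<in> space M. (\<lambda>i. coords \<omega> (v i)) \<in> class_region k n \<epsilon> p} \<inter>
      {\<omega> \<in> space M. G \<omega> \<in> {F. occurs m k E F v}} = appears m k E \<epsilon> p v"
    by (auto simp: appears_def)
  ultimately show ?thesis by simp
qed

lemma class_count_measurable [measurable]:
  "(\<lambda>\<omega>. class_count m k E n \<epsilon> p w x G \<omega>) \<in> borel_measurable M"
proof (subst measurable_cong[OF class_count_eq_sum])
  show "(\<lambda>\<omega>. \<Sum>v\<in>vertex_tuples k n. indicator (appears m k E \<epsilon> p v) \<omega> :: real) \<in> borel_measurable M"
    by (intro borel_measurable_sum borel_measurable_indicator appears_measurable)
qed

text \<open>Tuples with disjoint vertex sets prescribe the states of disjoint sets of pairs, so that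
  conditionally on weights and positions their probabilities multiply. One tuple and two tuples are
  the cases that matter, for the first and the second moment.\<close>

lemma prob_appears_family:
  assumes E: "E \<subseteq> vertex_pairs k" and V: "finite V" "V \<subseteq> vertex_tuples k n"
    and disj: "\<And>u v. u \<in> V \<Longrightarrow> v \<in> V \<Longrightarrow> u \<noteq> v \<Longrightarrow> u ` {1..k} \<inter> v ` {1..k} = {}"
  shows "prob {\<omega> \<in> space M. \<forall>v\<in>V. \<omega> \<in> appears m k E \<epsilon> p v}
    = expectation (\<lambda>\<omega>. \<Prod>v\<in>V. pattern_density m k E \<gamma> \<mu> n \<epsilon> p (\<lambda>i. coords \<omega> (v i)))"
proof -
  let ?D = "forbidden_pairs m k E"
  define S where "S = (\<Union>v\<in>V. (`) v ` E)"
  define T where "T = (\<Union>v\<in>V. (`) v ` ?D)"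
  define h where "h y = (\<Prod>v\<in>V. indicator (class_region k n \<epsilon> p) (\<lambda>i. y (v i)) :: real)"
    for y :: "nat \<Rightarrow> real \<times> (real ^ 'd)"
  have D: "?D \<subseteq> vertex_pairs k" by (rule forbidden_pairs_subset)
  have vt: "v \<in> vertex_tuples k n" if "v \<in> V" for v using V that by auto
  have inj: "inj_on ((`) v) (vertex_pairs k)" if "v \<in> V" for v
    using vertex_tuplesD(2)[OF vt[OF that]] by (rule inj_on_image_vertex_pairs)
  have sub: "S \<subseteq> vertex_pairs n" "T \<subseteq> vertex_pairs n"
    using E D vt image_vertex_pairs by (fastforce simp: S_def T_def)+
  have same: "u = v" if "u \<in> V" "v \<in> V" "u ` e = v ` e'" "e \<in> vertex_pairs k" "e' \<in> vertex_pairs k" for u v e e'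
  proof (rule ccontr)
    assume "u \<noteq> v"
    from that(4) have "e \<noteq> {}" "e \<subseteq> {1..k}" by (auto simp: vertex_pairs_def)
    then obtain i where "i \<in> e" "i \<in> {1..k}" by blast
    then have "u i \<in> u ` {1..k}" "u i \<in> u ` e" by auto
    then have "u i \<in> v ` e'" using that(3) by simp
    moreover have "e' \<subseteq> {1..k}" using that(5) by (auto simp: vertex_pairs_def)
    ultimately have "u i \<in> v ` {1..k}" by auto
    with disj[OF that(1,2) \<open>u \<noteq> v\<close>] \<open>u i \<in> u ` {1..k}\<close> show False by auto
  qed
  have ST: "S \<inter> T = {}"
  proof (rule ccontr)
    assume "S \<inter> T \<noteq> {}"
    then obtain u v e e' where *: "u \<in> V" "v \<in> V" "e \<in> E" "e' \<in> ?D" "u ` e = v ` e'"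
      by (auto simp: S_def T_def)
    then have "u = v" using same[OF *(1,2,5)] E D by blast
    then have "e = e'" using inj_onD[OF inj[OF *(1)], of e e'] * E D by blast
    then show False using * forbidden_pairs_disjoint by blast
  qed
  have prod_union: "(\<Prod>e\<in>(\<Union>v\<in>V. (`) v ` Q). f e) = (\<Prod>v\<in>V. \<Prod>e\<in>Q. f (v ` e))"
    if Q: "Q \<subseteq> vertex_pairs k" for Q and f :: "nat set \<Rightarrow> real"
  proof -
    have "finite Q" using Q finite_subset finite_vertex_pairs by blast
    then have "(\<Prod>e\<in>(\<Union>v\<in>V. (`) v ` Q). f e) = (\<Prod>v\<in>V. \<Prod>e\<in>(`) v ` Q. f e)"
      using V(1) same Q by (intro prod.UNION_disjoint) blast+
    also have "\<dots> = (\<Prod>v\<in>V. \<Prod>e\<in>Q. f (v ` e))"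
    proof (rule prod.cong[OF refl])
      fix v assume "v \<in> V"
      from prod.reindex[OF inj_on_subset[OF inj[OF this] Q], of f]
      show "(\<Prod>e\<in>(`) v ` Q. f e) = (\<Prod>e\<in>Q. f (v ` e))" by (simp add: o_def)
    qed
    finally show ?thesis .
  qed
  have pattern: "h (coords \<omega>) * ((\<Prod>e\<in>S. pair_prob \<gamma> \<mu> n (coords \<omega>) e) *
      (\<Prod>e\<in>T. 1 - pair_prob \<gamma> \<mu> n (coords \<omega>) e))
      = (\<Prod>v\<in>V. pattern_density m k E \<gamma> \<mu> n \<epsilon> p (\<lambda>i. coords \<omega> (v i)))" for \<omega>
  proof -
    have im: "pair_prob \<gamma> \<mu> n (coords \<omega>) (v ` e) = pair_prob \<gamma> \<mu> n (\<lambda>i. coords \<omega> (v i)) e"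
      if "v \<in> V" "e \<in> vertex_pairs k" for v e
      using pair_prob_image[OF that(2) vertex_tuplesD(2)[OF vt[OF that(1)]]] .
    have "(\<Prod>e\<in>S. pair_prob \<gamma> \<mu> n (coords \<omega>) e)
        = (\<Prod>v\<in>V. \<Prod>e\<in>E. pair_prob \<gamma> \<mu> n (\<lambda>i. coords \<omega> (v i)) e)"
      unfolding S_def prod_union[OF E] using E by (intro prod.cong refl im) auto
    moreover have "(\<Prod>e\<in>T. 1 - pair_prob \<gamma> \<mu> n (coords \<omega>) e)
        = (\<Prod>v\<in>V. \<Prod>e\<in>?D. 1 - pair_prob \<gamma> \<mu> n (\<lambda>i. coords \<omega> (v i)) e)"
      unfolding T_def prod_union[OF D] using D
      by (intro prod.cong refl arg_cong[where f = "\<lambda>z. 1 - z"] im) auto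
    ultimately show ?thesis by (simp add: h_def pattern_density_def prod.distrib)
  qed
  have h_restrict: "h (\<lambda>i\<in>{1..n}. coords \<omega> i) = h (coords \<omega>)" for \<omega>
  proof -
    have "indicator (class_region k n \<epsilon> p) (\<lambda>i. (\<lambda>i\<in>{1..n}. coords \<omega> i) (v i))
        = (indicator (class_region k n \<epsilon> p) (\<lambda>i. coords \<omega> (v i)) :: real)" if "v \<in> V" for v
    proof -
      have "(\<lambda>i. (\<lambda>i\<in>{1..n}. coords \<omega> i) (v i)) \<in> class_region k n \<epsilon> p \<longleftrightarrow>
          (\<lambda>i. coords \<omega> (v i)) \<in> class_region k n \<epsilon> p"
        using vertex_tuplesD(1)[OF vt[OF that]] by (intro class_region_cong) (auto simp: Pi_iff)
      then show ?thesis by (simp add: indicator_def)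
    qed
    then show ?thesis by (simp add: h_def)
  qed
  have h_meas: "h \<in> borel_measurable (config_space {1..n})"
    unfolding h_def
  proof (intro borel_measurable_prod)
    fix v assume "v \<in> V"
    then have v: "v \<in> {1..k} \<rightarrow> {1..n}" using vt vertex_tuplesD by auto
    have "(\<lambda>y. \<lambda>i\<in>{1..k}. y (v i)) \<in> config_space {1..n} \<rightarrow>\<^sub>M config_space {1..k}"
      using v by (intro measurable_restrict measurable_component_singleton) auto
    from measurable_compose[OF this class_region_measurable]
    have "Measurable.pred (config_space {1..n}) (\<lambda>y. (\<lambda>i\<in>{1..k}. y (v i)) \<in> class_region k n \<epsilon> p)" .
    also have "(\<lambda>y. (\<lambda>i\<in>{1..k}. y (v i)) \<in> class_region k n \<epsilon> p)
        = (\<lambda>y. (\<lambda>i. y (v i)) \<in> class_region k n \<epsilon> p)"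
      by (intro ext class_region_cong) auto
    finally show "(\<lambda>y. indicator (class_region k n \<epsilon> p) (\<lambda>i. y (v i)) :: real)
        \<in> borel_measurable (config_space {1..n})"
      unfolding indicator_def by measurable
  qed
  have h_le: "\<bar>h y\<bar> \<le> 1" for y
    unfolding h_def abs_prod by (intro prod_le_1) (auto simp: indicator_def)
  have occ: "\<omega> \<in> appears m k E \<epsilon> p v \<longleftrightarrow> \<omega> \<in> space M \<and> (\<lambda>i. coords \<omega> (v i)) \<in> class_region k n \<epsilon> p
      \<and> (`) v ` E \<subseteq> G \<omega> \<and> (`) v ` ?D \<inter> G \<omega> = {}" if "v \<in> V" for v \<omega>
    by (simp add: appears_def occurs_iff[OF E])
  have meas: "{\<omega> \<in> space M. \<forall>v\<in>V. \<omega> \<in> appears m k E \<epsilon> p v} \<in> events"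
    using V(1) vt by (intro sets.sets_Collect_finite_All sets.sets_Collect appears_measurable) auto
  have "prob {\<omega> \<in> space M. \<forall>v\<in>V. \<omega> \<in> appears m k E \<epsilon> p v}
      = expectation (indicator {\<omega> \<in> space M. \<forall>v\<in>V. \<omega> \<in> appears m k E \<epsilon> p v})"
    using meas by simp
  also have "\<dots> = expectation (\<lambda>\<omega>. h (\<lambda>i\<in>{1..n}. coords \<omega> i) * of_bool (S \<subseteq> G \<omega> \<and> T \<inter> G \<omega> = {}))"
  proof (intro Bochner_Integration.integral_cong refl)
    fix \<omega> assume \<omega>: "\<omega> \<in> space M"
    have 1: "S \<subseteq> G \<omega> \<and> T \<inter> G \<omega> = {} \<longleftrightarrow> (\<forall>v\<in>V. (`) v ` E \<subseteq> G \<omega> \<and> (`) v ` ?D \<inter> G \<omega> = {})"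
      unfolding S_def T_def by blast
    have 2: "h (coords \<omega>) = of_bool (\<forall>v\<in>V. (\<lambda>i. coords \<omega> (v i)) \<in> class_region k n \<epsilon> p)"
      unfolding h_def using V(1) by (auto simp: indicator_def)
    have 3: "(\<forall>v\<in>V. \<omega> \<in> appears m k E \<epsilon> p v) \<longleftrightarrow>
        (\<forall>v\<in>V. (\<lambda>i. coords \<omega> (v i)) \<in> class_region k n \<epsilon> p) \<and>
        (\<forall>v\<in>V. (`) v ` E \<subseteq> G \<omega> \<and> (`) v ` ?D \<inter> G \<omega> = {})"
    proof -
      have "(\<forall>v\<in>V. \<omega> \<in> appears m k E \<epsilon> p v) \<longleftrightarrow> (\<forall>v\<in>V. (\<lambda>i. coords \<omega> (v i)) \<in> class_region k n \<epsilon> p \<and>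
          (`) v ` E \<subseteq> G \<omega> \<and> (`) v ` ?D \<inter> G \<omega> = {})"
        by (rule ball_cong[OF refl]) (simp only: occ \<omega> simp_thms)
      then show ?thesis by (simp only: ball_conj_distrib)
    qed
    show "indicator {\<omega> \<in> space M. \<forall>v\<in>V. \<omega> \<in> appears m k E \<epsilon> p v} \<omega>
        = h (\<lambda>i\<in>{1..n}. coords \<omega> i) * of_bool (S \<subseteq> G \<omega> \<and> T \<inter> G \<omega> = {})"
      unfolding h_restrict 1 2 using \<omega> 3 by (simp add: indicator_def)
  qed
  also have "\<dots> = expectation (\<lambda>\<omega>. h (\<lambda>i\<in>{1..n}. coords \<omega> i) *
        ((\<Prod>e\<in>S. pair_prob \<gamma> \<mu> n (coords \<omega>) e) * (\<Prod>e\<in>T. 1 - pair_prob \<gamma> \<mu> n (coords \<omega>) e)))"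
    by (rule expectation_edge_pattern[OF sub ST h_meas h_le])
  also have "\<dots> = expectation (\<lambda>\<omega>. \<Prod>v\<in>V. pattern_density m k E \<gamma> \<mu> n \<epsilon> p (\<lambda>i. coords \<omega> (v i)))"
    unfolding h_restrict pattern ..
  finally show ?thesis .
qed

lemma pattern_density_coords:
  assumes "E \<subseteq> vertex_pairs k" "v \<in> vertex_tuples k n" "v ` {1..k} \<subseteq> A"
  shows "pattern_density m k E \<gamma> \<mu> n \<epsilon> p (\<lambda>i. coords \<omega> (v i))
    = pattern_density m k E \<gamma> \<mu> n \<epsilon> p (\<lambda>i\<in>{1..k}. (\<lambda>j\<in>A. coords \<omega> j) (v i))"
proof (rule pattern_density_cong[OF assms(1)])
  fix i assume i: "i \<in> {1..k}"
  then have "v i \<in> A" using assms(3) by blast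
  with i show "coords \<omega> (v i) = (\<lambda>i\<in>{1..k}. (\<lambda>j\<in>A. coords \<omega> j) (v i)) i" by simp
qed

lemma expectation_pattern_density:
  assumes E: "E \<subseteq> vertex_pairs k" and v: "v \<in> vertex_tuples k n"
  shows "expectation (\<lambda>\<omega>. pattern_density m k E \<gamma> \<mu> n \<epsilon> p (\<lambda>i. coords \<omega> (v i)))
    = tuple_prob TYPE('d) m k E \<gamma> \<nu> n \<epsilon> p"
proof -
  have "expectation (\<lambda>\<omega>. pattern_density m k E \<gamma> \<mu> n \<epsilon> p (\<lambda>i. coords \<omega> (v i)))
      = expectation (\<lambda>\<omega>. pattern_density m k E \<gamma> \<mu> n \<epsilon> p (\<lambda>i\<in>{1..k}. coords \<omega> (v i)))"
    by (intro arg_cong[where f = expectation] ext pattern_density_cong[OF E]) auto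
  also have "\<dots> = (\<integral>y. pattern_density m k E \<gamma> \<mu> n \<epsilon> p y
      \<partial>distr M (config_space {1..k}) (\<lambda>\<omega>. \<lambda>i\<in>{1..k}. coords \<omega> (v i)))"
    by (rule integral_distr[symmetric, OF tuple_coords_measurable[OF v] pattern_density_measurable[OF E]])
  also have "\<dots> = tuple_prob TYPE('d) m k E \<gamma> \<nu> n \<epsilon> p"
    unfolding tuple_prob_def distr_tuple[OF vertex_tuplesD[OF v]] ..
  finally show ?thesis .
qed

lemma prob_appears:
  assumes "E \<subseteq> vertex_pairs k" "v \<in> vertex_tuples k n"
  shows "prob (appears m k E \<epsilon> p v) = tuple_prob TYPE('d) m k E \<gamma> \<nu> n \<epsilon> p"
proof -
  have "{\<omega> \<in> space M. \<forall>u\<in>{v}. \<omega> \<in> appears m k E \<epsilon> p u} = appears m k E \<epsilon> p v"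
    by (auto simp: appears_def)
  then show ?thesis
    using prob_appears_family[OF assms(1), of "{v}" m \<epsilon> p] expectation_pattern_density[OF assms] assms(2)
    by simp
qed

text \<open>Given weights and positions the two copies are independent, and without a common vertex
  their conditional probabilities depend on disjoint sets of independent coordinates.\<close>

lemma prob_appears_disjoint:
  assumes E: "E \<subseteq> vertex_pairs k" and u: "u \<in> vertex_tuples k n" and v: "v \<in> vertex_tuples k n"
    and k: "1 \<le> k" and disj: "u ` {1..k} \<inter> v ` {1..k} = {}"
  shows "prob (appears m k E \<epsilon> p u \<inter> appears m k E \<epsilon> p v)
    = tuple_prob TYPE('d) m k E \<gamma> \<nu> n \<epsilon> p ^ 2"
proof -
  let ?f = "\<lambda>v y. pattern_density m k E \<gamma> \<mu> n \<epsilon> p (\<lambda>i\<in>{1..k}. y (v i))"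
  let ?g = "\<lambda>v \<omega>. pattern_density m k E \<gamma> \<mu> n \<epsilon> p (\<lambda>i. coords \<omega> (v i))"
  let ?A = "u ` {1..k}" and ?B = "v ` {1..k}"
  have uv: "u \<noteq> v" using disj k by auto
  have d: "s ` {1..k} \<inter> t ` {1..k} = {}" if "s \<in> {u, v}" "t \<in> {u, v}" "s \<noteq> t" for s t
    using that disj by blast
  have "{\<omega> \<in> space M. \<forall>t\<in>{u, v}. \<omega> \<in> appears m k E \<epsilon> p t} = appears m k E \<epsilon> p u \<inter> appears m k E \<epsilon> p v"
    by (auto simp: appears_def)
  moreover have "prob {\<omega> \<in> space M. \<forall>t\<in>{u, v}. \<omega> \<in> appears m k E \<epsilon> p t}
      = expectation (\<lambda>\<omega>. \<Prod>t\<in>{u, v}. ?g t \<omega>)"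
    by (rule prob_appears_family[OF E _ _ d]) (use u v in auto)
  ultimately have "prob (appears m k E \<epsilon> p u \<inter> appears m k E \<epsilon> p v) = expectation (\<lambda>\<omega>. ?g u \<omega> * ?g v \<omega>)"
    using uv by simp
  also have "\<dots> = expectation (?g u) * expectation (?g v)"
  proof (rule indep_var_lebesgue_integral)
    have sub: "?A \<subseteq> {1..n}" "?B \<subseteq> {1..n}"
      using vertex_tuplesD[OF u] vertex_tuplesD[OF v] by auto
    have meas: "?f t \<in> borel_measurable (config_space (t ` {1..k}))" for t
      by (rule measurable_compose[OF _ pattern_density_measurable[OF E]])
         (auto intro!: measurable_restrict)
    have "indep_var borel (?f u \<circ> (\<lambda>\<omega>. \<lambda>i\<in>?A. coords \<omega> i)) borel (?f v \<circ> (\<lambda>\<omega>. \<lambda>i\<in>?B. coords \<omega> i))"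
      by (rule indep_var_compose[OF indep_var_restrict[OF indep_vertices disj sub] meas meas])
    moreover have "?f t \<circ> (\<lambda>\<omega>. \<lambda>i\<in>t ` {1..k}. coords \<omega> i) = ?g t" if "t \<in> vertex_tuples k n" for t
      using pattern_density_coords[OF E that order_refl] by (auto simp: fun_eq_iff)
    ultimately show ind: "indep_var borel (?g u) borel (?g v)" using u v by simp
    show "integrable M (?g u)" "integrable M (?g v)"
      using indep_var_rv1[OF ind] indep_var_rv2[OF ind]
      by (auto intro!: integrable_const_bound[of _ 1] simp: pattern_density_bounds)
  qed
  also have "\<dots> = tuple_prob TYPE('d) m k E \<gamma> \<nu> n \<epsilon> p ^ 2"
    by (simp add: expectation_pattern_density[OF E] u v power2_eq_square)
  finally show ?thesis .
qed

lemma AE_in_torus: "AE \<omega> in M. \<forall>i\<in>{1..n}. x i \<omega> \<in> torus"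
proof (intro AE_finite_allI)
  fix i assume i: "i \<in> {1..n}"
  have "AE p in distr M (borel \<Otimes>\<^sub>M borel) (\<lambda>\<omega>. coords \<omega> i). snd p \<in> torus"
    using W.AE_vertex_measure_torus by (simp only: vertex_law[OF i] vertex_measure_def)
  from AE_distrD[OF coords_measurable[OF i] this] show "AE \<omega> in M. x i \<omega> \<in> torus" by simp
qed simp

text \<open>If all vertices of a set T lie within distance R of one of them, the positions of the
  others are confined to a ball; the tree of the bound is a star.\<close>

lemma prob_star_le:
  assumes T: "T \<subseteq> {1..n}" "z \<in> T" and R: "0 \<le> R"
    and A: "A \<in> events"
    and star: "\<And>\<omega> i. \<omega> \<in> A \<Longrightarrow> i \<in> T \<Longrightarrow> a \<le> w i \<omega>"
      "\<And>\<omega> i. \<omega> \<in> A \<Longrightarrow> i \<in> T \<Longrightarrow> i \<noteq> z \<Longrightarrow> torus_dist (x z \<omega>) (x i \<omega>) \<le> R"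
  shows "prob A \<le> measure \<nu> {a..} ^ card T * ((6 * R) ^ CARD('d)) ^ (card T - 1)"
proof -
  let ?t = "card T"
  have finT: "finite T" using T(1) finite_subset by blast
  have "0 < ?t" using T(2) finT by (auto simp: card_gt_0_iff)
  then have t: "1 \<le> ?t" by simp
  obtain g where g: "bij_betw g {1..?t} T" using ex_bij_betw_nat_finite_1[OF finT] by blast
  have "z \<in> g ` {1..?t}" using bij_betw_imp_surj_on[OF g] T(2) by simp
  then obtain j where j: "j \<in> {1..?t}" "g j = z" by (metis imageE)
  \<comment> \<open>The enumeration of T is arranged to start with the centre of the star.\<close>
  define \<eta> where "\<eta> = g \<circ> Transposition.transpose 1 j"
  have "bij_betw (Transposition.transpose 1 j) {1..?t} {1..?t}"
    using j t by (auto intro!: bij_betw_imageI inj_on_subset[OF inj_transpose] transpose_image_eq)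
  from bij_betw_trans[OF this g] have \<eta>: "bij_betw \<eta> {1..?t} T" unfolding \<eta>_def .
  have \<eta>1: "\<eta> 1 = z" using j by (simp add: \<eta>_def)
  have \<eta>T: "\<eta> i \<in> T" if "i \<in> {1..?t}" for i using \<eta> that by (auto simp: bij_betw_def)
  have \<eta>n: "\<eta> \<in> {1..?t} \<rightarrow> {1..n}" and \<eta>inj: "inj_on \<eta> {1..?t}"
    using \<eta> T(1) by (auto simp: bij_betw_def)
  let ?P = "PiM {1..?t} (\<lambda>_. vertex_measure \<nu> :: (real \<times> (real ^ 'd)) measure)"
  define S where "S = {y \<in> space ?P. (\<forall>i\<in>{1..?t}. a \<le> fst (y i) \<and> snd (y i) \<in> torus) \<and>
                    (\<forall>j\<in>{2..?t}. torus_dist (snd (y 1)) (snd (y j)) \<le> R)}"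
  have one: "1 \<in> {1..?t}" using t by simp
  have s: "sets ?P = sets (config_space {1..?t})"
    by (intro sets_PiM_cong refl W.sets_vertex_measure)
  have S_meas: "S \<in> sets (config_space {1..?t})"
    unfolding s[symmetric] S_def using one by measurable
  have Y: "(\<lambda>\<omega>. \<lambda>i\<in>{1..?t}. coords \<omega> (\<eta> i)) \<in> M \<rightarrow>\<^sub>M config_space {1..?t}"
    by (rule configuration_measurable[OF \<eta>n])
  have "AE \<omega> in M. \<omega> \<in> A \<longrightarrow> \<omega> \<in> (\<lambda>\<omega>. \<lambda>i\<in>{1..?t}. coords \<omega> (\<eta> i)) -` S \<inter> space M"
    using AE_in_torus AE_space
  proof eventually_elim
    case (elim \<omega>)
    show ?case
    proof
      assume \<omega>: "\<omega> \<in> A"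
      have "(\<lambda>i\<in>{1..?t}. coords \<omega> (\<eta> i)) \<in> space ?P"
        using measurable_space[OF Y elim(2)] sets_eq_imp_space_eq[OF s] by simp
      moreover have "a \<le> w (\<eta> i) \<omega> \<and> x (\<eta> i) \<omega> \<in> torus" if "i \<in> {1..?t}" for i
        using star(1)[OF \<omega> \<eta>T[OF that]] elim(1) \<eta>n that by auto
      moreover have "torus_dist (x (\<eta> 1) \<omega>) (x (\<eta> j) \<omega>) \<le> R" if "j \<in> {2..?t}" for j
      proof -
        have "j \<in> {1..?t}" "j \<noteq> 1" using that by auto
        then have "\<eta> j \<noteq> \<eta> 1" using inj_onD[OF \<eta>inj, of j 1] one by auto
        then show ?thesis using star(2)[OF \<omega> \<eta>T[OF \<open>j \<in> {1..?t}\<close>]] \<eta>1 by simp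
      qed
      ultimately show "\<omega> \<in> (\<lambda>\<omega>. \<lambda>i\<in>{1..?t}. coords \<omega> (\<eta> i)) -` S \<inter> space M"
        using elim(2) t unfolding S_def by auto
    qed
  qed
  then have "emeasure M A \<le> emeasure M ((\<lambda>\<omega>. \<lambda>i\<in>{1..?t}. coords \<omega> (\<eta> i)) -` S \<inter> space M)"
    by (rule emeasure_mono_AE) (rule measurable_sets[OF Y S_meas])
  also have "\<dots> = emeasure ?P S"
    unfolding distr_tuple[OF \<eta>n \<eta>inj, symmetric] by (rule emeasure_distr[symmetric, OF Y S_meas])
  also have "\<dots> \<le> ennreal ((\<Prod>i\<in>{1..?t}. measure \<nu> {a..}) * (\<Prod>j\<in>{2..?t}. (6 * R) ^ CARD('d)))"
    unfolding S_def using R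
    by (intro W.tree_bound[where a = "\<lambda>_. a" and R = "\<lambda>_. R" and \<sigma> = "\<lambda>_. 1"]) auto
  also have "(\<Prod>i\<in>{1..?t}. measure \<nu> {a..}) * (\<Prod>j\<in>{2..?t}. (6 * R) ^ CARD('d))
      = measure \<nu> {a..} ^ ?t * ((6 * R) ^ CARD('d)) ^ (?t - 1)"
    by (simp add: prod_constant numeral_2_eq_2)
  finally show ?thesis
    using R by (simp add: emeasure_eq_measure)
qed

lemma expectation_class_count:
  assumes "E \<subseteq> vertex_pairs k"
  shows "expectation (class_count m k E n \<epsilon> p w x G)
    = card (vertex_tuples k n) * tuple_prob TYPE('d) m k E \<gamma> \<nu> n \<epsilon> p"
proof -
  have "expectation (class_count m k E n \<epsilon> p w x G)
      = expectation (\<lambda>\<omega>. \<Sum>v\<in>vertex_tuples k n. indicator (appears m k E \<epsilon> p v) \<omega>)"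
    by (intro Bochner_Integration.integral_cong refl class_count_eq_sum)
  also have "\<dots> = (\<Sum>v\<in>vertex_tuples k n. prob (appears m k E \<epsilon> p v))"
    by (subst Bochner_Integration.integral_sum)
       (auto intro!: sum.cong simp: less_top[symmetric] appears_measurable)
  also have "\<dots> = card (vertex_tuples k n) * tuple_prob TYPE('d) m k E \<gamma> \<nu> n \<epsilon> p"
    by (simp add: prob_appears[OF assms])
  finally show ?thesis .
qed

lemma class_count_bounds:
  assumes "\<omega> \<in> space M"
  shows "0 \<le> class_count m k E n \<epsilon> p w x G \<omega>"
    "class_count m k E n \<epsilon> p w x G \<omega> \<le> card (vertex_tuples k n)"
proof -
  show "0 \<le> class_count m k E n \<epsilon> p w x G \<omega>"
    by (simp add: class_count_eq_sum[OF assms] sum_nonneg)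
  have "class_count m k E n \<epsilon> p w x G \<omega> \<le> (\<Sum>v\<in>vertex_tuples k n. 1)"
    unfolding class_count_eq_sum[OF assms] by (intro sum_mono) (auto simp: indicator_def)
  then show "class_count m k E n \<epsilon> p w x G \<omega> \<le> card (vertex_tuples k n)" by simp
qed

lemma integrable_class_count:
  "integrable M (class_count m k E n \<epsilon> p w x G)"
  "integrable M (\<lambda>\<omega>. class_count m k E n \<epsilon> p w x G \<omega> ^ 2)"
proof -
  show "integrable M (class_count m k E n \<epsilon> p w x G)"
    using class_count_bounds
    by (intro integrable_const_bound[of _ "card (vertex_tuples k n)"] AE_I2) auto
  show "integrable M (\<lambda>\<omega>. class_count m k E n \<epsilon> p w x G \<omega> ^ 2)"
    using class_count_bounds
    by (intro integrable_const_bound[of _ "real (card (vertex_tuples k n)) ^ 2"] AE_I2)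
       (auto intro!: power_mono)
qed

text \<open>Only pairs of tuples with a common vertex contribute to the variance. A pair whose
  vertices form a set of size t can be chosen in at most \<open>n^t (2 k)^(2 k)\<close> ways, and if the class has
  constant exponents all vertices of the pair are close to the common vertex.\<close>

lemma variance_class_count_le:
  assumes E: "E \<subseteq> vertex_pairs k" and k: "1 \<le> k" and \<epsilon>: "0 < \<epsilon>"
    and const: "\<And>i. i \<in> {1..k} \<Longrightarrow> fst p i = a" "\<And>e. e \<in> vertex_pairs k \<Longrightarrow> snd p e = b"
  shows "variance (class_count m k E n \<epsilon> p w x G)
    \<le> (\<Sum>t = 1..2 * k - 1. real n ^ t * real ((2 * k) ^ k) ^ 2 *
          (measure \<nu> {\<epsilon> * real n powr a..} ^ t * ((6 * (real n powr b / \<epsilon>)) ^ CARD('d)) ^ (t - 1)))"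
proof -
  let ?V = "vertex_tuples k n"
  let ?A = "appears m k E \<epsilon> p"
  let ?N = "class_count m k E n \<epsilon> p w x G"
  let ?q = "tuple_prob TYPE('d) m k E \<gamma> \<nu> n \<epsilon> p"
  let ?R = "real n powr b / \<epsilon>"
  define B where "B t = measure \<nu> {\<epsilon> * real n powr a..} ^ t * ((6 * ?R) ^ CARD('d)) ^ (t - 1)" for t :: nat
  have B0: "0 \<le> B t" for t using \<epsilon> by (simp add: B_def)
  define vs :: "(nat \<Rightarrow> nat) \<times> (nat \<Rightarrow> nat) \<Rightarrow> nat set" where "vs uv = fst uv ` {1..k} \<union> snd uv ` {1..k}" for uv
  define Ov where "Ov = {uv \<in> ?V \<times> ?V. fst uv ` {1..k} \<inter> snd uv ` {1..k} \<noteq> {}}"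
  have finOv: "finite Ov" unfolding Ov_def by auto
  have overlap: "prob (?A u \<inter> ?A v) \<le> B (card (vs (u, v)))" if "(u, v) \<in> Ov" for u v
  proof -
    have u: "u \<in> ?V" and v: "v \<in> ?V" and ne: "u ` {1..k} \<inter> v ` {1..k} \<noteq> {}"
      using that by (auto simp: Ov_def)
    then obtain z where z: "z \<in> u ` {1..k}" "z \<in> v ` {1..k}" by blast
    have cls: "\<epsilon> * real n powr a \<le> w i \<omega> \<and> (i \<noteq> z \<longrightarrow> torus_dist (x z \<omega>) (x i \<omega>) \<le> ?R)"
      if \<omega>: "\<omega> \<in> ?A t" and i: "i \<in> t ` {1..k}" and zt: "z \<in> t ` {1..k}" for t i \<omega>
    proof -
      from i zt obtain i' z' where *: "i' \<in> {1..k}" "z' \<in> {1..k}" "i = t i'" "z = t z'" by blast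
      have reg: "(\<lambda>i. coords \<omega> (t i)) \<in> class_region k n \<epsilon> p" using \<omega> by (simp add: appears_def)
      have "w i \<omega> \<in> scale_interval \<epsilon> n a" using reg * const(1)[of i'] by (auto simp: class_region_def)
      moreover have "torus_dist (x z \<omega>) (x i \<omega>) \<in> scale_interval \<epsilon> n b" if "i \<noteq> z"
      proof -
        have ne: "z' \<noteq> i'" using that * by auto
        then have "torus_dist (snd (coords \<omega> (t z'))) (snd (coords \<omega> (t i'))) \<in> scale_interval \<epsilon> n (snd p {z', i'})"
          using reg *(1,2) unfolding class_region_def by blast
        then show ?thesis using const(2)[OF doubleton_in_vertex_pairs[OF *(2,1) ne]] * by simp
      qed
      ultimately show ?thesis by (auto simp: scale_interval_def)
    qed
    show ?thesis unfolding B_def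
    proof (rule prob_star_le[of _ z])
      show "vs (u, v) \<subseteq> {1..n}" using vertex_tuplesD(1)[OF u] vertex_tuplesD(1)[OF v]
        by (auto simp: vs_def)
      show "z \<in> vs (u, v)" using z by (simp add: vs_def)
      show "0 \<le> ?R" using \<epsilon> by simp
      show "?A u \<inter> ?A v \<in> events" using u v by (intro sets.Int appears_measurable)
      show "\<epsilon> * real n powr a \<le> w i \<omega>" if "\<omega> \<in> ?A u \<inter> ?A v" "i \<in> vs (u, v)" for \<omega> i
        using that cls[of \<omega> u i] cls[of \<omega> v i] z unfolding vs_def by (metis IntE UnE fst_conv snd_conv)
      show "torus_dist (x z \<omega>) (x i \<omega>) \<le> ?R" if "\<omega> \<in> ?A u \<inter> ?A v" "i \<in> vs (u, v)" "i \<noteq> z" for \<omega> i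
        using that cls[of \<omega> u i] cls[of \<omega> v i] z unfolding vs_def by (metis IntE UnE fst_conv snd_conv)
    qed
  qed
  have EN: "expectation ?N = card ?V * ?q" by (rule expectation_class_count[OF E])
  have "expectation (\<lambda>\<omega>. ?N \<omega> ^ 2) = expectation (\<lambda>\<omega>. \<Sum>uv\<in>?V \<times> ?V. indicator (?A (fst uv) \<inter> ?A (snd uv)) \<omega>)"
  proof (intro Bochner_Integration.integral_cong refl)
    fix \<omega> assume "\<omega> \<in> space M"
    then have "?N \<omega> ^ 2 = (\<Sum>u\<in>?V. \<Sum>v\<in>?V. indicator (?A u) \<omega> * indicator (?A v) \<omega>)"
      by (simp only: class_count_eq_sum power2_eq_square sum_product)
    also have "\<dots> = (\<Sum>uv\<in>?V \<times> ?V. indicator (?A (fst uv) \<inter> ?A (snd uv)) \<omega>)"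
      unfolding sum.cartesian_product by (intro sum.cong refl) (auto simp: indicator_inter_arith)
    finally show "?N \<omega> ^ 2 = (\<Sum>uv\<in>?V \<times> ?V. indicator (?A (fst uv) \<inter> ?A (snd uv)) \<omega>)" .
  qed
  also have "\<dots> = (\<Sum>uv\<in>?V \<times> ?V. prob (?A (fst uv) \<inter> ?A (snd uv)))"
    by (subst Bochner_Integration.integral_sum)
       (auto intro!: sum.cong simp: less_top[symmetric] appears_measurable)
  also have "\<dots> = (\<Sum>uv\<in>?V \<times> ?V - Ov. prob (?A (fst uv) \<inter> ?A (snd uv)))
      + (\<Sum>uv\<in>Ov. prob (?A (fst uv) \<inter> ?A (snd uv)))"
    by (rule sum.subset_diff) (auto simp: Ov_def)
  also have "(\<Sum>uv\<in>?V \<times> ?V - Ov. prob (?A (fst uv) \<inter> ?A (snd uv))) = (\<Sum>uv\<in>?V \<times> ?V - Ov. ?q ^ 2)"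
    by (intro sum.cong refl prob_appears_disjoint[OF E _ _ k]) (auto simp: Ov_def)
  also have "\<dots> \<le> (\<Sum>uv\<in>?V \<times> ?V. ?q ^ 2)"
    by (intro sum_mono2) auto
  also have "\<dots> = (expectation ?N)\<^sup>2"
    by (simp add: EN card_cartesian_product power2_eq_square)
  also have "(\<Sum>uv\<in>Ov. prob (?A (fst uv) \<inter> ?A (snd uv))) \<le> (\<Sum>uv\<in>Ov. B (card (vs uv)))"
    using overlap by (intro sum_mono) auto
  also have "\<dots> \<le> (\<Sum>t = 1..2 * k - 1. real n ^ t * real ((2 * k) ^ k) ^ 2 * B t)"
  proof -
    have card_vs: "card (vs uv) \<in> {1..2 * k - 1} \<and> vs uv \<subseteq> {1..n}" if "uv \<in> Ov" for uv
    proof -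
      let ?a = "fst uv ` {1..k}" and ?b = "snd uv ` {1..k}"
      have "card ?a \<le> k" "card ?b \<le> k" using card_image_le[of "{1..k}"] by auto
      moreover have "?a \<inter> ?b \<noteq> {}" using that by (auto simp: Ov_def)
      then have "1 \<le> card (?a \<inter> ?b)" by (simp add: Suc_leI card_gt_0_iff)
      moreover have "card (?a \<inter> ?b) \<le> card (?a \<union> ?b)" by (intro card_mono) auto
      moreover have "card ?a + card ?b = card (?a \<union> ?b) + card (?a \<inter> ?b)" by (intro card_Un_Int) auto
      moreover have "vs uv \<subseteq> {1..n}"
      proof -
        have "fst uv \<in> ?V" "snd uv \<in> ?V" using that by (auto simp: Ov_def)
        then show ?thesis unfolding vs_def
          by (intro Un_least funcset_image vertex_tuplesD(1))
      qed
      ultimately show ?thesis by (auto simp: vs_def)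
    qed
    have count: "card {uv \<in> Ov. card (vs uv) = t} \<le> n ^ t * ((2 * k) ^ k) ^ 2"
      if t: "t \<in> {1..2 * k - 1}" for t
    proof -
      let ?Ts = "{T. T \<subseteq> {1..n} \<and> card T = t}"
      let ?F = "\<lambda>T. ({1..k} \<rightarrow>\<^sub>E T) \<times> ({1..k} \<rightarrow>\<^sub>E T) :: ((nat \<Rightarrow> nat) \<times> (nat \<Rightarrow> nat)) set"
      have finTs: "finite ?Ts" by (rule finite_subset[of _ "Pow {1..n}"]) auto
      have sub: "{uv \<in> Ov. card (vs uv) = t} \<subseteq> (\<Union>T\<in>?Ts. ?F T)"
      proof
        fix uv assume uv: "uv \<in> {uv \<in> Ov. card (vs uv) = t}"
        then have "vs uv \<in> ?Ts" using card_vs by auto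
        moreover have "uv \<in> ?F (vs uv)"
          using uv by (cases uv) (auto simp: vs_def Ov_def vertex_tuples_def PiE_def)
        ultimately show "uv \<in> (\<Union>T\<in>?Ts. ?F T)" by blast
      qed
      have finT: "finite T" if "T \<in> ?Ts" for T using that finite_subset by blast
      have finF: "finite (?F T)" if "T \<in> ?Ts" for T
        using finT[OF that] by (auto intro!: finite_cartesian_product finite_PiE)
      have "card {uv \<in> Ov. card (vs uv) = t} \<le> card (\<Union>T\<in>?Ts. ?F T)"
        by (intro card_mono[OF _ sub] finite_UN_I finTs finF)
      also have "\<dots> \<le> (\<Sum>T\<in>?Ts. card (?F T))" by (rule card_UN_le[OF finTs])
      also have "\<dots> = (\<Sum>T\<in>?Ts. (t ^ k) ^ 2)"
        by (intro sum.cong refl) (auto simp: card_cartesian_product card_PiE power2_eq_square)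
      also have "\<dots> = (n choose t) * (t ^ k) ^ 2"
        by (simp add: n_subsets)
      also have "\<dots> \<le> n ^ t * ((2 * k) ^ k) ^ 2"
      proof (intro mult_mono power_mono)
        show "n choose t \<le> n ^ t"
          by (cases "t \<le> n") (auto simp: binomial_le_pow binomial_eq_0)
      qed (use t in auto)
      finally show ?thesis .
    qed
    have "(\<Sum>uv\<in>Ov. B (card (vs uv)))
        = (\<Sum>t = 1..2 * k - 1. \<Sum>uv\<in>{uv \<in> Ov. card (vs uv) = t}. B (card (vs uv)))"
      using card_vs finOv by (intro sum.group[symmetric]) auto
    also have "\<dots> = (\<Sum>t = 1..2 * k - 1. real (card {uv \<in> Ov. card (vs uv) = t}) * B t)"
      by (intro sum.cong refl) simp
    also have "\<dots> \<le> (\<Sum>t = 1..2 * k - 1. real (n ^ t * ((2 * k) ^ k) ^ 2) * B t)"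
      using count B0 by (intro sum_mono mult_right_mono of_nat_mono) auto
    finally show ?thesis by simp
  qed
  finally have "expectation (\<lambda>\<omega>. ?N \<omega> ^ 2) \<le> (expectation ?N)\<^sup>2
      + (\<Sum>t = 1..2 * k - 1. real n ^ t * real ((2 * k) ^ k) ^ 2 * B t)" by simp
  then show ?thesis
    by (simp add: variance_eq integrable_class_count B_def)
qed

text \<open>If the variance is small against the square of a lower bound for the mean, Chebyshev's
  inequality confines the count to a constant multiple of its mean.\<close>

lemma prob_class_count_between:
  assumes E: "E \<subseteq> vertex_pairs k" and l: "0 < l"
    and lo: "l \<le> expectation (class_count m k E n \<epsilon> p w x G)"
    and hi: "expectation (class_count m k E n \<epsilon> p w x G) \<le> h"
  shows "prob {\<omega> \<in> space M. l / 2 \<le> class_count m k E n \<epsilon> p w x G \<omega> \<and>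
      class_count m k E n \<epsilon> p w x G \<omega> \<le> 2 * h}
    \<ge> 1 - 4 * variance (class_count m k E n \<epsilon> p w x G) / l\<^sup>2"
proof -
  let ?N = "class_count m k E n \<epsilon> p w x G"
  let ?Bad = "{\<omega> \<in> space M. l / 2 \<le> \<bar>?N \<omega> - expectation ?N\<bar>}"
  let ?Good = "{\<omega> \<in> space M. l / 2 \<le> ?N \<omega> \<and> ?N \<omega> \<le> 2 * h}"
  have "prob ?Bad \<le> variance ?N / (l / 2)\<^sup>2"
    using l by (intro Chebyshev_inequality integrable_class_count) auto
  also have "\<dots> = 4 * variance ?N / l\<^sup>2" by (simp add: power_divide)
  finally have bad: "prob ?Bad \<le> 4 * variance ?N / l\<^sup>2" .
  have "space M - ?Bad \<subseteq> ?Good"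
  proof
    fix \<omega> assume "\<omega> \<in> space M - ?Bad"
    then have "\<omega> \<in> space M" "\<bar>?N \<omega> - expectation ?N\<bar> < l / 2" by auto
    then show "\<omega> \<in> ?Good" using lo hi l unfolding mem_Collect_eq by linarith
  qed
  then have "prob (space M - ?Bad) \<le> prob ?Good"
    by (intro finite_measure_mono) auto
  moreover have "prob (space M - ?Bad) = 1 - prob ?Bad"
    by (intro prob_compl) auto
  ultimately show ?thesis using bad by linarith
qed

end

section \<open>Power-law weights\<close>

locale power_law = real_distribution \<nu> for \<nu> :: "real measure" +
  fixes \<tau> c :: real
  assumes tau: "2 < \<tau>" "\<tau> < 3" and c_pos: "0 < c" and law: "weight_law \<tau> c \<nu>"
begin

lemma weights_ge_1: "AE t in \<nu>. 1 \<le> t"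
  using law by (simp add: weight_law_def)

lemma tail_limit: "((\<lambda>t. measure \<nu> {t<..} / (c * t powr (1 - \<tau>))) \<longlongrightarrow> 1) at_top"
  using law by (simp add: weight_law_def)

lemma mean_ge_1: "1 \<le> (\<integral>t. t \<partial>\<nu>)"
proof -
  have "(\<integral>t. 1 \<partial>\<nu>) \<le> (\<integral>t. t \<partial>\<nu>)"
    using law weights_ge_1 by (intro integral_mono_AE) (auto simp: weight_law_def)
  then show ?thesis using prob_space by simp
qed

text \<open>The asymptotic bound is extended to all positive arguments, where the trivial bound 1 is
  absorbed in the constant.\<close>

lemma tail_upper:
  obtains C where "0 < C" "\<And>t. 0 < t \<Longrightarrow> measure \<nu> {t..} \<le> C * t powr (1 - \<tau>)"
proof -
  have "eventually (\<lambda>t. measure \<nu> {t<..} / (c * t powr (1 - \<tau>)) < 2) at_top"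
    using order_tendstoD(2)[OF tail_limit, of 2] by simp
  then obtain X where X: "\<And>t. X \<le> t \<Longrightarrow> measure \<nu> {t<..} / (c * t powr (1 - \<tau>)) < 2"
    by (auto simp: eventually_at_top_linorder)
  define Y where "Y = max X 1"
  define C where "C = 2 * c * (1 / 2) powr (1 - \<tau>) + 1 / (2 * Y) powr (1 - \<tau>)"
  have Y: "1 \<le> Y" by (simp add: Y_def)
  show thesis
  proof
    show "0 < C" using c_pos Y by (simp add: C_def add_pos_pos)
    fix t :: real assume t: "0 < t"
    show "measure \<nu> {t..} \<le> C * t powr (1 - \<tau>)"
    proof (cases "2 * Y \<le> t")
      case True
      then have t2: "X \<le> t / 2" "0 < t / 2" using Y by (auto simp: Y_def)
      have "measure \<nu> {t..} \<le> measure \<nu> {t / 2<..}"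
        using t by (intro finite_measure_mono) auto
      also have "\<dots> \<le> 2 * (c * (t / 2) powr (1 - \<tau>))"
        using X[OF t2(1)] t2 c_pos by (simp add: divide_less_eq)
      also have "(t / 2) powr (1 - \<tau>) = (1 / 2) powr (1 - \<tau>) * t powr (1 - \<tau>)"
        using t powr_mult[of "1 / 2" t "1 - \<tau>"] by (simp add: mult.commute)
      also have "2 * (c * ((1 / 2) powr (1 - \<tau>) * t powr (1 - \<tau>))) \<le> C * t powr (1 - \<tau>)"
        using Y by (simp add: C_def algebra_simps)
      finally show ?thesis .
    next
      case False
      then have "(2 * Y) powr (1 - \<tau>) \<le> t powr (1 - \<tau>)"
        using t tau Y by (intro powr_mono2') auto
      then have "1 \<le> 1 / (2 * Y) powr (1 - \<tau>) * t powr (1 - \<tau>)"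
        using Y by (simp add: field_simps)
      also have "\<dots> \<le> C * t powr (1 - \<tau>)"
        using c_pos t by (intro mult_right_mono) (auto simp: C_def)
      finally show ?thesis using prob_le_1[of "{t..}"] by linarith
    qed
  qed
qed

text \<open>The interval from \<open>p n^a\<close> to \<open>q n^a\<close> keeps a positive fraction of the tail at \<open>n^a\<close>,
  because the limit \<open>c (p^(1 - \<tau>) - q^(1 - \<tau>))\<close> of the rescaled probabilities is positive.\<close>

lemma tail_lower:
  assumes a: "0 < a" and pq: "0 < p" "p < q"
  obtains c' where "0 < c'"
    "\<forall>\<^sub>F n in sequentially. c' * real n powr ((1 - \<tau>) * a) \<le> measure \<nu> {p * real n powr a<..q * real n powr a}"
proof -
  have lim: "(\<lambda>n. measure \<nu> {s * real n powr a<..} / real n powr ((1 - \<tau>) * a))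
      \<longlonglongrightarrow> c * s powr (1 - \<tau>)" if s: "0 < s" for s
  proof -
    have "filterlim (\<lambda>n. s * real n powr a) at_top sequentially"
      using s a by real_asymp
    from filterlim_compose[OF tail_limit this]
    have "(\<lambda>n. measure \<nu> {s * real n powr a<..} / (c * (s * real n powr a) powr (1 - \<tau>))) \<longlonglongrightarrow> 1" .
    from tendsto_mult_left[OF this, of "c * s powr (1 - \<tau>)"]
    have "(\<lambda>n. c * s powr (1 - \<tau>) * (measure \<nu> {s * real n powr a<..} /
        (c * (s * real n powr a) powr (1 - \<tau>)))) \<longlonglongrightarrow> c * s powr (1 - \<tau>)" by simp
    then show ?thesis
    proof (rule Lim_transform_eventually)
      show "\<forall>\<^sub>F n in sequentially. c * s powr (1 - \<tau>) * (measure \<nu> {s * real n powr a<..} /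
          (c * (s * real n powr a) powr (1 - \<tau>)))
          = measure \<nu> {s * real n powr a<..} / real n powr ((1 - \<tau>) * a)"
        using eventually_gt_at_top[of 0]
        by eventually_elim (use s c_pos in \<open>simp add: powr_mult powr_powr mult.commute[of a]\<close>)
    qed
  qed
  define L where "L = c * p powr (1 - \<tau>) - c * q powr (1 - \<tau>)"
  have L: "0 < L"
    using pq tau c_pos powr_less_mono2_neg[of "1 - \<tau>" p q] by (simp add: L_def)
  have "(\<lambda>n. measure \<nu> {p * real n powr a<..} / real n powr ((1 - \<tau>) * a)
      - measure \<nu> {q * real n powr a<..} / real n powr ((1 - \<tau>) * a)) \<longlonglongrightarrow> L"
    unfolding L_def by (intro tendsto_diff lim) (use pq in auto)
  from order_tendstoD(1)[OF this, of "L / 2"] L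
  have "\<forall>\<^sub>F n in sequentially. L / 2 < measure \<nu> {p * real n powr a<..} / real n powr ((1 - \<tau>) * a)
      - measure \<nu> {q * real n powr a<..} / real n powr ((1 - \<tau>) * a)" by simp
  then have "\<forall>\<^sub>F n in sequentially. L / 2 * real n powr ((1 - \<tau>) * a)
      \<le> measure \<nu> {p * real n powr a<..q * real n powr a}"
    using eventually_gt_at_top[of 0]
  proof eventually_elim
    case (elim n)
    have eq: "{p * real n powr a<..q * real n powr a} = {p * real n powr a<..} - {q * real n powr a<..}"
      by auto
    have "p * real n powr a \<le> q * real n powr a" using pq by (intro mult_right_mono) auto
    then have "measure \<nu> {p * real n powr a<..q * real n powr a}
        = measure \<nu> {p * real n powr a<..} - measure \<nu> {q * real n powr a<..}"
      unfolding eq by (intro finite_measure_Diff) auto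
    with elim show ?case by (simp add: field_simps)
  qed
  with L show thesis by (intro that[of "L / 2"]) auto
qed

end

section \<open>Connection probabilities on a class\<close>

text \<open>As a function of the ratio \<open>w w' / (n \<mu> r^d)\<close>, the connection probability does not depend
  on n.\<close>

definition edge_prob :: "ereal \<Rightarrow> real \<Rightarrow> real" where
  "edge_prob \<gamma> q = (if \<gamma> = \<infinity> then of_bool (1 < q) else min 1 (q powr real_of_ereal \<gamma>))"

definition conn_ratio :: "real \<Rightarrow> nat \<Rightarrow> real \<times> (real ^ 'd) \<Rightarrow> real \<times> (real ^ 'd) \<Rightarrow> real" where
  "conn_ratio \<mu> n a b = fst a * fst b / (real n * \<mu> * torus_dist (snd a) (snd b) ^ CARD('d))"

lemma connection_prob_eq_edge_prob:
  assumes "1 \<le> n" "0 < \<mu>" "0 < torus_dist (snd a) (snd b)"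
  shows "connection_prob \<gamma> \<mu> n a b = edge_prob \<gamma> (conn_ratio \<mu> n a (b :: real \<times> (real ^ 'd)))"
  using assms by (simp add: connection_prob_def edge_prob_def conn_ratio_def Let_def less_divide_eq)

text \<open>On a class the weights and distances are powers of n up to constants, and hence so are the
  ratios.\<close>

lemma conn_ratio_bounds:
  fixes a b :: "real \<times> (real ^ 'd)"
  assumes n: "1 \<le> n" and \<mu>: "0 < \<mu>" and \<epsilon>: "0 < \<epsilon>"
    and w: "fst a \<in> scale_interval \<epsilon> n \<alpha>1" "fst b \<in> scale_interval \<epsilon> n \<alpha>2"
    and r: "torus_dist (snd a) (snd b) \<in> scale_interval \<epsilon> n \<beta>"
  defines "z \<equiv> \<alpha>1 + \<alpha>2 - real CARD('d) * \<beta> - 1"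
  shows "0 < torus_dist (snd a) (snd b)"
    and "\<epsilon> ^ (2 + CARD('d)) / \<mu> * real n powr z \<le> conn_ratio \<mu> n a b"
    and "conn_ratio \<mu> n a b \<le> 1 / (\<epsilon> ^ (2 + CARD('d)) * \<mu>) * real n powr z"
proof -
  let ?r = "torus_dist (snd a) (snd b)" and ?d = "CARD('d)"
  have n0: "0 < real n" using n by simp
  have powd: "(real n powr \<beta>) ^ ?d = real n powr (real ?d * \<beta>)"
    using n0 by (simp add: powr_power)
  have lo: "\<epsilon> * real n powr \<alpha>1 \<le> fst a" "\<epsilon> * real n powr \<alpha>2 \<le> fst b" "\<epsilon> * real n powr \<beta> \<le> ?r"
    and hi: "fst a \<le> real n powr \<alpha>1 / \<epsilon>" "fst b \<le> real n powr \<alpha>2 / \<epsilon>" "?r \<le> real n powr \<beta> / \<epsilon>"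
    using w r by (auto simp: scale_interval_def)
  have pos: "0 < \<epsilon> * real n powr t" for t using \<epsilon> n0 by simp
  show r0: "0 < ?r" using lo(3) pos[of \<beta>] by linarith
  have pa: "0 \<le> fst a" "0 \<le> fst b" using lo(1,2) pos[of \<alpha>1] pos[of \<alpha>2] by linarith+
  have z: "real n powr \<alpha>1 * real n powr \<alpha>2 = real n powr z * (real n * real n powr (real ?d * \<beta>))"
    using n0 by (simp add: z_def powr_add powr_diff powr_minus field_simps)
  have "\<epsilon> ^ (2 + ?d) / \<mu> * real n powr z
      = (\<epsilon> * real n powr \<alpha>1) * (\<epsilon> * real n powr \<alpha>2) / (real n * \<mu> * (real n powr \<beta> / \<epsilon>) ^ ?d)"
  proof -
    have "(\<epsilon> * real n powr \<alpha>1) * (\<epsilon> * real n powr \<alpha>2) / (real n * \<mu> * (real n powr \<beta> / \<epsilon>) ^ ?d)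
        = \<epsilon> ^ 2 * (real n powr \<alpha>1 * real n powr \<alpha>2) * \<epsilon> ^ ?d / (real n * \<mu> * real n powr (real ?d * \<beta>))"
      using n0 \<epsilon> \<mu> by (simp add: power_divide powd power2_eq_square)
    also have "\<dots> = \<epsilon> ^ (2 + ?d) / \<mu> * real n powr z"
      unfolding z using n0 \<mu> by (simp add: power_add power2_eq_square field_simps)
    finally show ?thesis by simp
  qed
  also have "\<dots> \<le> fst a * fst b / (real n * \<mu> * ?r ^ ?d)"
    using lo hi pa n0 \<mu> r0 \<epsilon>
    by (intro frac_le mult_mono power_mono mult_pos_pos zero_less_power) (auto intro!: mult_nonneg_nonneg)
  finally show "\<epsilon> ^ (2 + ?d) / \<mu> * real n powr z \<le> conn_ratio \<mu> n a b" by (simp add: conn_ratio_def)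
  have "fst a * fst b / (real n * \<mu> * ?r ^ ?d)
      \<le> (real n powr \<alpha>1 / \<epsilon>) * (real n powr \<alpha>2 / \<epsilon>) / (real n * \<mu> * (\<epsilon> * real n powr \<beta>) ^ ?d)"
    using lo hi pa n0 \<mu> r0 \<epsilon>
    by (intro frac_le mult_mono power_mono mult_pos_pos zero_less_power) (auto intro!: mult_nonneg_nonneg)
  also have "\<dots> = (real n powr \<alpha>1 * real n powr \<alpha>2) / (\<epsilon> ^ 2 * \<epsilon> ^ ?d * (real n * \<mu> * real n powr (real ?d * \<beta>)))"
    using n0 \<epsilon> \<mu> by (simp add: power_mult_distrib powd power2_eq_square field_simps)
  also have "\<dots> = 1 / (\<epsilon> ^ (2 + ?d) * \<mu>) * real n powr z"
    unfolding z using n0 \<mu> \<epsilon> by (simp add: power_add power2_eq_square field_simps)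
  finally show "conn_ratio \<mu> n a b \<le> 1 / (\<epsilon> ^ (2 + ?d) * \<mu>) * real n powr z" by (simp add: conn_ratio_def)
qed

text \<open>This is the exponent of n in the ratio of the pair e. It appears in the objective function
  and in the constraints of the induced problem.\<close>

definition ratio_exponent :: "nat \<Rightarrow> (nat \<Rightarrow> real) \<times> (nat set \<Rightarrow> real) \<Rightarrow> nat set \<Rightarrow> real" where
  "ratio_exponent d p e = (\<Sum>i\<in>e. fst p i) - real d * snd p e - 1"

lemma pair_prob_on_class:
  fixes y :: "nat \<Rightarrow> real \<times> (real ^ 'd)"
  assumes n: "1 \<le> n" and \<mu>: "0 < \<mu>" and \<epsilon>: "0 < \<epsilon>" and y: "y \<in> class_region k n \<epsilon> p"
    and e: "e \<in> vertex_pairs k"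
  obtains q where "pair_prob \<gamma> \<mu> n y e = edge_prob \<gamma> q"
    "\<epsilon> ^ (2 + CARD('d)) / \<mu> * real n powr ratio_exponent CARD('d) p e \<le> q"
    "q \<le> 1 / (\<epsilon> ^ (2 + CARD('d)) * \<mu>) * real n powr ratio_exponent CARD('d) p e"
proof -
  obtain i j where ij: "e = {i, j}" "i < j" "1 \<le> i" "j \<le> k" using e by (rule vertex_pairs_cases)
  then have i: "i \<in> {1..k}" and j: "j \<in> {1..k}" and ne: "i \<noteq> j" by auto
  have w: "fst (y i) \<in> scale_interval \<epsilon> n (fst p i)" "fst (y j) \<in> scale_interval \<epsilon> n (fst p j)"
    and r: "torus_dist (snd (y i)) (snd (y j)) \<in> scale_interval \<epsilon> n (snd p e)"
    using y i j ne ij(1) unfolding class_region_def by blast+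
  have ex: "fst p i + fst p j - real CARD('d) * snd p e - 1 = ratio_exponent CARD('d) p e"
    using ij by (simp add: ratio_exponent_def)
  note b = conn_ratio_bounds[OF n \<mu> \<epsilon> w r, unfolded ex]
  have "pair_prob \<gamma> \<mu> n y e = edge_prob \<gamma> (conn_ratio \<mu> n (y i) (y j))"
    unfolding ij(1) pair_prob_doubleton[OF ne] by (rule connection_prob_eq_edge_prob[OF n \<mu> b(1)])
  with b(2,3) show thesis by (intro that)
qed

section \<open>Upper bounds for the probability of a pattern\<close>

lemma eventually_const_powr_less:
  assumes "z < 0" "0 < B"
  shows "\<forall>\<^sub>F n in sequentially. K * real n powr z < B"
proof -
  have "(\<lambda>n. K * real n powr z) \<longlonglongrightarrow> K * 0"
    using assms by (intro tendsto_mult_left tendsto_neg_powr filterlim_real_sequentially)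
  then show ?thesis using order_tendstoD(2)[of _ "K * 0" sequentially B] assms by simp
qed

text \<open>A forbidden pair whose ratio diverges is connected with probability one, and for
  \<open>\<gamma> = \<infinity>\<close> a required pair whose ratio vanishes is not connected; no copy survives for large n.
  Such a pair violates a constraint of the induced problem, or makes the objective \<open>-\<infinity>\<close>.\<close>

lemma eventually_tuple_prob_eq_0:
  assumes E: "E \<subseteq> vertex_pairs k" and \<mu>: "0 < (\<integral>t. t \<partial>\<nu>)" and \<epsilon>: "0 < \<epsilon>" and \<gamma>: "1 < \<gamma>"
    and bad: "(\<exists>e\<in>forbidden_pairs m k E. 0 < ratio_exponent CARD('d) p e) \<or>
      (\<gamma> = \<infinity> \<and> (\<exists>e\<in>E. ratio_exponent CARD('d) p e < 0))"
  shows "\<forall>\<^sub>F n in sequentially. tuple_prob TYPE('d::finite) m k E \<gamma> \<nu> n \<epsilon> p = 0"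
proof -
  let ?\<mu> = "\<integral>t. t \<partial>\<nu>" and ?c = "\<epsilon> ^ (2 + CARD('d))"
  have c: "0 < ?c" using \<epsilon> by simp
  have finE: "finite E" using E finite_subset finite_vertex_pairs by blast
  have finF: "finite (forbidden_pairs m k E)"
    by (rule finite_subset[OF forbidden_pairs_subset finite_vertex_pairs])
  have "\<forall>\<^sub>F n in sequentially. \<forall>y :: nat \<Rightarrow> real \<times> (real ^ 'd).
      pattern_density m k E \<gamma> ?\<mu> n \<epsilon> p y = 0"
    using bad
  proof
    assume "\<exists>e\<in>forbidden_pairs m k E. 0 < ratio_exponent CARD('d) p e"
    then obtain e where e: "e \<in> forbidden_pairs m k E" "0 < ratio_exponent CARD('d) p e" by blast
    let ?z = "ratio_exponent CARD('d) p e"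
    have ev: "e \<in> vertex_pairs k" using e forbidden_pairs_subset by blast
    have "\<forall>\<^sub>F n in sequentially. 1 * real n powr (- ?z) < ?c / ?\<mu>"
      by (rule eventually_const_powr_less) (use e c \<mu> in auto)
    then show ?thesis using eventually_ge_at_top[of 1]
    proof eventually_elim
      case (elim n)
      then have big: "1 < ?c / ?\<mu> * real n powr ?z" by (simp add: powr_minus field_simps)
      show ?case
      proof
        fix y :: "nat \<Rightarrow> real \<times> (real ^ 'd)"
        show "pattern_density m k E \<gamma> ?\<mu> n \<epsilon> p y = 0"
        proof (cases "y \<in> class_region k n \<epsilon> p")
          case True
          obtain q where q: "pair_prob \<gamma> ?\<mu> n y e = edge_prob \<gamma> q" "?c / ?\<mu> * real n powr ?z \<le> q"
            using pair_prob_on_class[OF elim(2) \<mu> \<epsilon> True ev] by metis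
          have "1 < q" using big q(2) by linarith
          moreover have "1 \<le> q powr real_of_ereal \<gamma>"
            using \<open>1 < q\<close> \<gamma> by (intro ge_one_powr_ge_zero) (cases \<gamma>; auto)+
          ultimately have "edge_prob \<gamma> q = 1" by (simp add: edge_prob_def)
          then have "(\<Prod>e\<in>forbidden_pairs m k E. 1 - pair_prob \<gamma> ?\<mu> n y e) = 0"
            using e(1) q(1) by (intro prod_zero finF) auto
          then show ?thesis by (simp add: pattern_density_def)
        qed (simp add: pattern_density_def)
      qed
    qed
  next
    assume "\<gamma> = \<infinity> \<and> (\<exists>e\<in>E. ratio_exponent CARD('d) p e < 0)"
    then obtain e where e: "\<gamma> = \<infinity>" "e \<in> E" "ratio_exponent CARD('d) p e < 0" by blast
    let ?z = "ratio_exponent CARD('d) p e"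
    have ev: "e \<in> vertex_pairs k" using e E by blast
    have "\<forall>\<^sub>F n in sequentially. 1 / (?c * ?\<mu>) * real n powr ?z < 1"
      by (rule eventually_const_powr_less) (use e in auto)
    then show ?thesis using eventually_ge_at_top[of 1]
    proof eventually_elim
      case (elim n)
      show ?case
      proof
        fix y :: "nat \<Rightarrow> real \<times> (real ^ 'd)"
        show "pattern_density m k E \<gamma> ?\<mu> n \<epsilon> p y = 0"
        proof (cases "y \<in> class_region k n \<epsilon> p")
          case True
          obtain q where q: "pair_prob \<gamma> ?\<mu> n y e = edge_prob \<gamma> q"
              "q \<le> 1 / (?c * ?\<mu>) * real n powr ?z"
            using pair_prob_on_class[OF elim(2) \<mu> \<epsilon> True ev] by metis
          have "q < 1" using elim(1) q(2) by linarith
          then have "edge_prob \<gamma> q = 0" using e by (simp add: edge_prob_def)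
          then have "(\<Prod>e\<in>E. pair_prob \<gamma> ?\<mu> n y e) = 0"
            using e(2) q(1) by (intro prod_zero finE) auto
          then show ?thesis by (simp add: pattern_density_def)
        qed (simp add: pattern_density_def)
      qed
    qed
  qed
  then show ?thesis
    by eventually_elim (simp add: tuple_prob_def)
qed

context power_law
begin

text \<open>The tree of the position bound joins each vertex to its nearest earlier vertex on the
  scale of the class, which gives the minima in the objective function.\<close>

lemma tuple_prob_le:
  assumes E: "E \<subseteq> vertex_pairs k" and n: "1 \<le> n" and \<epsilon>: "0 < \<epsilon>"
    and Q: "\<And>y :: nat \<Rightarrow> real \<times> (real ^ 'd). y \<in> class_region k n \<epsilon> p \<Longrightarrow>
      (\<Prod>e\<in>E. pair_prob \<gamma> (\<integral>t. t \<partial>\<nu>) n y e) \<le> Q" and Q0: "0 \<le> Q"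
  shows "tuple_prob TYPE('d::finite) m k E \<gamma> \<nu> n \<epsilon> p
    \<le> Q * ((\<Prod>i\<in>{1..k}. prob {\<epsilon> * real n powr fst p i..}) *
         (\<Prod>j\<in>{2..k}. (6 * (real n powr Min ((\<lambda>i. snd p {i, j}) ` {1..<j}) / \<epsilon>)) ^ CARD('d)))"
proof -
  let ?L = "vertex_measure \<nu> :: (real \<times> (real ^ 'd)) measure"
  let ?P = "PiM {1..k} (\<lambda>_. ?L)"
  let ?\<mu> = "\<integral>t. t \<partial>\<nu>"
  interpret P: prob_space ?P by (intro prob_space_PiM prob_space_vertex_measure)
  let ?m = "\<lambda>j. Min ((\<lambda>i. snd p {i, j}) ` {1..<j})"
  have "\<exists>i\<in>{1..<j}. snd p {i, j} = ?m j" if "j \<in> {2..k}" for j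
    using that Min_in[of "(\<lambda>i. snd p {i, j}) ` {1..<j}"] by (auto simp: image_iff)
  then obtain \<sigma> where \<sigma>: "\<And>j. j \<in> {2..k} \<Longrightarrow> \<sigma> j \<in> {1..<j}"
      "\<And>j. j \<in> {2..k} \<Longrightarrow> snd p {\<sigma> j, j} = ?m j" by metis
  define S where "S = {y \<in> space ?P. (\<forall>i\<in>{1..k}. \<epsilon> * real n powr fst p i \<le> fst (y i) \<and> snd (y i) \<in> torus) \<and>
                    (\<forall>j\<in>{2..k}. torus_dist (snd (y (\<sigma> j))) (snd (y j)) \<le> real n powr ?m j / \<epsilon>)}"
  have s: "sets ?P = sets (PiM {1..k} (\<lambda>_. borel \<Otimes>\<^sub>M borel :: (real \<times> (real ^ 'd)) measure))"
    by (intro sets_PiM_cong refl sets_vertex_measure)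
  have S_meas: "S \<in> sets ?P"
  proof -
    have [measurable]: "(\<lambda>y. torus_dist (snd (y (\<sigma> j))) (snd (y j))) \<in> borel_measurable ?P"
      if "j \<in> {2..k}" for j
    proof -
      have "\<sigma> j \<in> {1..k}" "j \<in> {1..k}" using \<sigma>(1)[OF that] that by auto
      then show ?thesis by measurable
    qed
    show ?thesis unfolding S_def by measurable
  qed
  have meas: "pattern_density m k E \<gamma> ?\<mu> n \<epsilon> p \<in> borel_measurable ?P"
    using pattern_density_measurable[OF E] s by (simp cong: measurable_cong_sets)
  have "AE y in ?P. \<forall>i\<in>{1..k}. snd (y i) \<in> torus"
    by (intro AE_finite_allI AE_PiM_component prob_space_vertex_measure AE_vertex_measure_torus) auto
  then have dom: "AE y in ?P. pattern_density m k E \<gamma> ?\<mu> n \<epsilon> p y \<le> Q * indicator S y"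
    using AE_space
  proof eventually_elim
    case (elim y)
    show ?case
    proof (cases "y \<in> class_region k n \<epsilon> p")
      case True
      have "torus_dist (snd (y (\<sigma> j))) (snd (y j)) \<le> real n powr ?m j / \<epsilon>" if j: "j \<in> {2..k}" for j
      proof -
        have "\<sigma> j \<in> {1..k}" "j \<in> {1..k}" "\<sigma> j \<noteq> j" using \<sigma>(1)[OF j] j by auto
        with True have "torus_dist (snd (y (\<sigma> j))) (snd (y j)) \<in> scale_interval \<epsilon> n (snd p {\<sigma> j, j})"
          unfolding class_region_def by blast
        then show ?thesis using \<sigma>(2)[OF j] by (simp add: scale_interval_def)
      qed
      moreover have "\<epsilon> * real n powr fst p i \<le> fst (y i)" if "i \<in> {1..k}" for i
        using True that by (auto simp: class_region_def scale_interval_def)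
      ultimately have "y \<in> S" using elim by (auto simp: S_def)
      moreover have "pattern_density m k E \<gamma> ?\<mu> n \<epsilon> p y
          \<le> (\<Prod>e\<in>E. pair_prob \<gamma> ?\<mu> n y e) * 1"
        using True by (auto simp: pattern_density_def pair_prob_bounds
            intro!: mult_left_le prod_nonneg prod_le_1)
      ultimately show ?thesis using Q[OF True] by simp
    next
      case False
      then show ?thesis using Q0 by (simp add: pattern_density_def)
    qed
  qed
  have "tuple_prob TYPE('d) m k E \<gamma> \<nu> n \<epsilon> p \<le> (\<integral>y. Q * indicator S y \<partial>?P)"
    unfolding tuple_prob_def
  proof (rule integral_mono_AE[OF _ _ dom])
    show "integrable ?P (pattern_density m k E \<gamma> ?\<mu> n \<epsilon> p)"
      using meas by (intro P.integrable_const_bound[of _ 1]) (auto simp: pattern_density_bounds)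
    show "integrable ?P (\<lambda>y. Q * indicator S y)"
      using S_meas P.emeasure_finite[of S]
      by (intro integrable_mult_right integrable_real_indicator) (simp_all add: less_top)
  qed
  also have "\<dots> = Q * measure ?P S" using S_meas by simp
  also have "\<dots> \<le> Q * ((\<Prod>i\<in>{1..k}. prob {\<epsilon> * real n powr fst p i..}) *
         (\<Prod>j\<in>{2..k}. (6 * (real n powr ?m j / \<epsilon>)) ^ CARD('d)))"
  proof (intro mult_left_mono Q0)
    have "emeasure ?P S \<le> ennreal ((\<Prod>i\<in>{1..k}. prob {\<epsilon> * real n powr fst p i..}) *
         (\<Prod>j\<in>{2..k}. (6 * (real n powr ?m j / \<epsilon>)) ^ CARD('d)))"
      unfolding S_def using \<sigma>(1) \<epsilon> by (intro tree_bound) auto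
    then show "measure ?P S \<le> (\<Prod>i\<in>{1..k}. prob {\<epsilon> * real n powr fst p i..}) *
         (\<Prod>j\<in>{2..k}. (6 * (real n powr ?m j / \<epsilon>)) ^ CARD('d))"
      using \<epsilon> by (subst (asm) P.emeasure_eq_measure) (auto simp: ennreal_le_iff prod_nonneg)
  qed
  finally show ?thesis .
qed

text \<open>The exponent of the bound is the objective function: the weights give \<open>(1 - \<tau>) \<alpha>\<close>, the
  positions \<open>d min \<beta>\<close>, the required edges \<open>\<gamma> min(_, 0)\<close>, and the missing k counts the choices of the
  tuple.\<close>

lemma tuple_prob_upper:
  assumes E: "E \<subseteq> vertex_pairs k" and \<epsilon>: "0 < \<epsilon>" and \<gamma>: "1 < \<gamma>"
    and inf: "\<gamma> = \<infinity> \<Longrightarrow> \<forall>e\<in>E. 0 \<le> ratio_exponent CARD('d) p e"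
  obtains C where "0 < C"
    "\<And>n. 1 \<le> n \<Longrightarrow> tuple_prob TYPE('d::finite) m k E \<gamma> \<nu> n \<epsilon> p
      \<le> C * real n powr (real_of_ereal (objective CARD('d) k E \<tau> \<gamma> p) - real k)"
    "\<bar>objective CARD('d) k E \<tau> \<gamma> p\<bar> \<noteq> \<infinity>"
proof -
  let ?\<mu> = "\<integral>t. t \<partial>\<nu>" and ?c = "\<epsilon> ^ (2 + CARD('d))" and ?g = "real_of_ereal \<gamma>"
  let ?z = "\<lambda>e. ratio_exponent CARD('d) p e"
  let ?m = "\<lambda>j. Min ((\<lambda>i. snd p {i, j}) ` {1..<j})"
  have \<mu>: "0 < ?\<mu>" using mean_ge_1 by linarith
  have c: "0 < ?c" using \<epsilon> by simp
  have g: "0 < ?g \<or> \<gamma> = \<infinity>" using \<gamma> by (cases \<gamma>) auto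
  obtain C where C: "0 < C" "\<And>t. 0 < t \<Longrightarrow> prob {t..} \<le> C * t powr (1 - \<tau>)" using tail_upper by blast
  \<comment> \<open>The maximum with 1 covers the pairs with nonnegative exponent, whose probability is only
    bounded by 1.\<close>
  define K where "K = max 1 ((1 / (?c * ?\<mu>)) powr ?g)"
  define s where "s = (if \<gamma> = \<infinity> then 0 else ?g * (\<Sum>e\<in>E. min (?z e) 0))"
  have obj: "objective CARD('d) k E \<tau> \<gamma> p
      = ereal (real k + (1 - \<tau>) * (\<Sum>i = 1..k. fst p i) + real CARD('d) * (\<Sum>j = 2..k. ?m j) + s)"
  proof -
    have "objective CARD('d) k E \<tau> \<gamma> p
      = ereal (real k + (1 - \<tau>) * (\<Sum>i = 1..k. fst p i) + real CARD('d) * (\<Sum>j = 2..k. ?m j))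
        + \<gamma> * ereal (\<Sum>e\<in>E. min (?z e) 0)"
      by (simp add: objective_def case_prod_beta ratio_exponent_def)
    also have "\<gamma> * ereal (\<Sum>e\<in>E. min (?z e) 0) = ereal s"
    proof (cases "\<gamma> = \<infinity>")
      case True
      then have "(\<Sum>e\<in>E. min (?z e) 0) = 0" using inf by (intro sum.neutral) auto
      then show ?thesis using True by (simp add: s_def)
    next
      case False
      then show ?thesis using \<gamma> by (cases \<gamma>) (auto simp: s_def)
    qed
    finally show ?thesis by simp
  qed
  have pair: "pair_prob \<gamma> ?\<mu> n y e \<le> K * real n powr (if \<gamma> = \<infinity> then 0 else ?g * min (?z e) 0)"
    if n: "1 \<le> n" and y: "y \<in> class_region k n \<epsilon> p" and e: "e \<in> E" for n e and y :: "nat \<Rightarrow> real \<times> (real ^ 'd)"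
  proof (cases "\<gamma> = \<infinity> \<or> 0 \<le> ?z e")
    case True
    then have "(if \<gamma> = \<infinity> then 0 else ?g * min (?z e) 0) = 0" by auto
    then show ?thesis using pair_prob_bounds(2)[of \<gamma> ?\<mu> n y e] n by (simp add: K_def)
  next
    case False
    have "e \<in> vertex_pairs k" using e E by blast
    then obtain q where q: "pair_prob \<gamma> ?\<mu> n y e = edge_prob \<gamma> q"
        "?c / ?\<mu> * real n powr ?z e \<le> q" "q \<le> 1 / (?c * ?\<mu>) * real n powr ?z e"
      using pair_prob_on_class[OF n \<mu> \<epsilon> y] by metis
    have "0 \<le> ?c / ?\<mu> * real n powr ?z e" using c \<mu> by (intro mult_nonneg_nonneg) auto
    then have q0: "0 \<le> q" using q(2) by linarith
    have "edge_prob \<gamma> q \<le> q powr ?g" using False by (simp add: edge_prob_def)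
    also have "\<dots> \<le> (1 / (?c * ?\<mu>) * real n powr ?z e) powr ?g"
      using q(3) q0 g False by (intro powr_mono2) auto
    also have "\<dots> = (1 / (?c * ?\<mu>)) powr ?g * real n powr (?g * ?z e)"
      using c \<mu> by (subst powr_mult) (auto simp: powr_powr mult.commute)
    also have "\<dots> \<le> K * real n powr (?g * ?z e)"
      by (intro mult_right_mono) (auto simp: K_def)
    finally show ?thesis using False q(1) by (simp add: min_def)
  qed
  have finE: "finite E" using E finite_subset finite_vertex_pairs by blast
  have prodE: "(\<Prod>e\<in>E. pair_prob \<gamma> ?\<mu> n y e) \<le> K ^ card E * real n powr s"
    if n: "1 \<le> n" and y: "y \<in> class_region k n \<epsilon> p" for n and y :: "nat \<Rightarrow> real \<times> (real ^ 'd)"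
  proof -
    have "(\<Prod>e\<in>E. pair_prob \<gamma> ?\<mu> n y e)
        \<le> (\<Prod>e\<in>E. K * real n powr (if \<gamma> = \<infinity> then 0 else ?g * min (?z e) 0))"
      using pair[OF n y] by (intro prod_mono) (auto simp: pair_prob_bounds)
    also have "\<dots> = K ^ card E * real n powr (\<Sum>e\<in>E. if \<gamma> = \<infinity> then 0 else ?g * min (?z e) 0)"
      using n by (subst powr_sum) (auto simp: prod.distrib)
    also have "(\<Sum>e\<in>E. if \<gamma> = \<infinity> then 0 else ?g * min (?z e) 0) = s"
      by (simp add: s_def sum_distrib_left)
    finally show ?thesis .
  qed
  have K: "1 \<le> K" by (simp add: K_def)
  define C' where "C' = K ^ card E * ((C * \<epsilon> powr (1 - \<tau>)) ^ k * ((6 / \<epsilon>) ^ CARD('d)) ^ card {2..k})"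
  show thesis
  proof
    show "0 < C'" using K C \<epsilon> by (simp add: C'_def)
    show "\<bar>objective CARD('d) k E \<tau> \<gamma> p\<bar> \<noteq> \<infinity>" by (simp add: obj)
    fix n :: nat assume n: "1 \<le> n"
    then have n0: "0 < real n" by simp
    have "tuple_prob TYPE('d) m k E \<gamma> \<nu> n \<epsilon> p
        \<le> (K ^ card E * real n powr s) * ((\<Prod>i\<in>{1..k}. prob {\<epsilon> * real n powr fst p i..}) *
         (\<Prod>j\<in>{2..k}. (6 * (real n powr ?m j / \<epsilon>)) ^ CARD('d)))"
      using prodE[OF n] K by (intro tuple_prob_le[OF E n \<epsilon>]) auto
    also have "\<dots> \<le> (K ^ card E * real n powr s) *
        ((\<Prod>i\<in>{1..k}. (C * \<epsilon> powr (1 - \<tau>)) * real n powr ((1 - \<tau>) * fst p i)) *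
         (\<Prod>j\<in>{2..k}. (6 / \<epsilon>) ^ CARD('d) * real n powr (real CARD('d) * ?m j)))"
    proof (intro mult_mono prod_mono mult_nonneg_nonneg prod_nonneg conjI ballI)
      fix i assume "i \<in> {1..k}"
      have "prob {\<epsilon> * real n powr fst p i..} \<le> C * (\<epsilon> * real n powr fst p i) powr (1 - \<tau>)"
        using \<epsilon> n0 by (intro C) simp
      also have "\<dots> = (C * \<epsilon> powr (1 - \<tau>)) * real n powr ((1 - \<tau>) * fst p i)"
        using \<epsilon> n0 by (simp add: powr_mult powr_powr mult.commute[of "fst p i"])
      finally show "prob {\<epsilon> * real n powr fst p i..} \<le> (C * \<epsilon> powr (1 - \<tau>)) * real n powr ((1 - \<tau>) * fst p i)" .
    next
      fix j assume "j \<in> {2..k}"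
      have "6 * (real n powr ?m j / \<epsilon>) = 6 / \<epsilon> * real n powr ?m j" by simp
      then have "(6 * (real n powr ?m j / \<epsilon>)) ^ CARD('d) = (6 / \<epsilon>) ^ CARD('d) * real n powr (real CARD('d) * ?m j)"
        using n0 by (simp only: power_mult_distrib) (simp add: powr_power)
      then show "(6 * (real n powr ?m j / \<epsilon>)) ^ CARD('d) \<le> (6 / \<epsilon>) ^ CARD('d) * real n powr (real CARD('d) * ?m j)"
        by simp
    qed (use K C \<epsilon> in auto)
    also have "\<dots> = C' * (real n powr s * (real n powr (\<Sum>i\<in>{1..k}. (1 - \<tau>) * fst p i) *
        real n powr (\<Sum>j\<in>{2..k}. real CARD('d) * ?m j)))"
      using n0 by (simp add: prod.distrib powr_sum C'_def mult_ac power_mult_distrib)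
    also have "real n powr s * (real n powr (\<Sum>i\<in>{1..k}. (1 - \<tau>) * fst p i) *
        real n powr (\<Sum>j\<in>{2..k}. real CARD('d) * ?m j))
        = real n powr (real_of_ereal (objective CARD('d) k E \<tau> \<gamma> p) - real k)"
      by (simp add: obj powr_add[symmetric] sum_distrib_left algebra_simps)
    finally show "tuple_prob TYPE('d) m k E \<gamma> \<nu> n \<epsilon> p
      \<le> C' * real n powr (real_of_ereal (objective CARD('d) k E \<tau> \<gamma> p) - real k)" .
  qed
qed

end

section \<open>Lower bounds for the probability of a pattern\<close>

text \<open>The open condition under which a pair can be in the state that the pattern prescribes.
  For finite \<open>\<gamma>\<close> every positive ratio allows an edge; for \<open>\<gamma> = \<infinity>\<close> the ratio decides, and the boundary
  value 1 is excluded.\<close>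

definition ratio_allows :: "mode \<Rightarrow> ereal \<Rightarrow> bool \<Rightarrow> real \<Rightarrow> bool" where
  "ratio_allows m \<gamma> required q \<longleftrightarrow>
     0 < q \<and> (required \<longrightarrow> \<gamma> = \<infinity> \<longrightarrow> 1 < q) \<and> (\<not> required \<longrightarrow> m = Ind \<longrightarrow> q < 1)"

definition pair_factor :: "mode \<Rightarrow> ereal \<Rightarrow> bool \<Rightarrow> real \<Rightarrow> real" where
  "pair_factor m \<gamma> required q =
     (if required then edge_prob \<gamma> q else if m = Ind then 1 - edge_prob \<gamma> q else 1)"

text \<open>In the threshold case the factor is locally constant away from ratio 1; for finite \<open>\<gamma>\<close> it
  depends continuously on the ratio.\<close>

lemma eventually_pair_factor_ge:
  assumes \<gamma>: "1 < \<gamma>" and q: "ratio_allows m \<gamma> required q"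
  obtains \<kappa> where "0 < \<kappa>" "\<forall>\<^sub>F q' in nhds q. \<kappa> \<le> pair_factor m \<gamma> required q'"
proof -
  let ?g = "real_of_ereal \<gamma>"
  have q0: "0 < q" using q by (simp add: ratio_allows_def)
  have g: "0 < ?g" if "\<gamma> \<noteq> \<infinity>" using \<gamma> that by (cases \<gamma>) auto
  have low: "\<forall>\<^sub>F q' in nhds q. l < q'" if "l < q" for l
    using order_tendstoD(1)[OF filterlim_ident that] .
  have high: "\<forall>\<^sub>F q' in nhds q. q' < l" if "q < l" for l
    using order_tendstoD(2)[OF filterlim_ident that] .
  show thesis
  proof (cases required)
    case True
    show thesis
    proof (cases "\<gamma> = \<infinity>")
      case inf: True
      have "\<forall>\<^sub>F q' in nhds q. 1 \<le> pair_factor m \<gamma> required q'"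
        using low[of 1] q True inf
        by (auto simp: ratio_allows_def pair_factor_def edge_prob_def elim!: eventually_mono)
      then show thesis by (intro that[of 1]) auto
    next
      case fin: False
      have "q / 2 < q" using q0 by simp
      from low[OF this] have "\<forall>\<^sub>F q' in nhds q. min 1 ((q / 2) powr ?g) \<le> pair_factor m \<gamma> required q'"
      proof eventually_elim
        case (elim q')
        then have "(q / 2) powr ?g \<le> q' powr ?g" using g[OF fin] q0 by (intro powr_mono2) auto
        then show ?case using True fin by (auto simp: pair_factor_def edge_prob_def)
      qed
      then show thesis using q0 by (intro that[of "min 1 ((q / 2) powr ?g)"]) auto
    qed
  next
    case opt: False
    show thesis
    proof (cases "m = Ind")
      case False
      then show thesis using opt by (intro that[of 1]) (auto simp: pair_factor_def)
    next
      case True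
      with q opt have q1: "q < 1" by (simp add: ratio_allows_def)
      \<comment> \<open>The midpoint leaves room on both sides: ratios near q stay below it, and it is below 1.\<close>
      define r where "r = (q + 1) / 2"
      have r: "q < r" "r < 1" "0 < r" using q0 q1 by (auto simp: r_def)
      define \<kappa> where "\<kappa> = (if \<gamma> = \<infinity> then 1 else 1 - r powr ?g)"
      have "0 < \<kappa>"
      proof (cases "\<gamma> = \<infinity>")
        case False
        then have "r powr ?g < 1 powr ?g" using r g by (intro powr_less_mono2) auto
        then show ?thesis using False by (simp add: \<kappa>_def)
      qed (simp add: \<kappa>_def)
      moreover have "\<forall>\<^sub>F q' in nhds q. \<kappa> \<le> pair_factor m \<gamma> required q'"
        using high[OF r(1)] low[OF q0]
      proof eventually_elim
        case (elim q')
        then have "q' powr ?g \<le> r powr ?g" if "\<gamma> \<noteq> \<infinity>" using g[OF that] by (intro powr_mono2) auto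
        then show ?case using True opt elim r
          by (auto simp: pair_factor_def edge_prob_def \<kappa>_def min_le_iff_disj)
      qed
      ultimately show thesis by (rule that)
    qed
  qed
qed

definition near :: "real \<Rightarrow> real \<times> (real ^ 'd) \<Rightarrow> real \<times> (real ^ 'd) \<Rightarrow> bool" where
  "near \<delta> a b \<longleftrightarrow> \<bar>fst a - fst b\<bar> < \<delta> \<and> (\<forall>j. \<bar>snd a $ j - snd b $ j\<bar> < \<delta>)"

lemma near_mono: "near \<delta> a b \<Longrightarrow> \<delta> \<le> \<delta>' \<Longrightarrow> near \<delta>' a b"
  unfolding near_def by (meson less_le_trans)

lemma dist_less_of_near:
  fixes a b :: "real \<times> (real ^ 'd)"
  assumes "near \<delta> a b"
  shows "dist a b \<le> (1 + real CARD('d)) * \<delta>"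
proof -
  have "dist (snd a) (snd b) \<le> (\<Sum>j\<in>UNIV. \<bar>(snd a - snd b) $ j\<bar>)"
    unfolding dist_norm by (rule norm_le_l1_cart)
  also have "\<dots> \<le> (\<Sum>j\<in>(UNIV :: 'd set). \<delta>)"
    using assms by (intro sum_mono) (auto simp: near_def less_imp_le)
  finally have "dist (snd a) (snd b) \<le> real CARD('d) * \<delta>" by simp
  moreover have "dist (fst a) (fst b) \<le> \<delta>" using assms by (simp add: near_def dist_real_def)
  moreover have "dist a b \<le> dist (fst a) (fst b) + dist (snd a) (snd b)"
    by (simp add: dist_prod_def sqrt_sum_squares_le_sum)
  ultimately show ?thesis by (simp add: algebra_simps)
qed

text \<open>A scaled configuration assigns to each vertex of the pattern a weight and a position, in
  units in which the ratio of a pair is \<open>t t' / (\<mu> D^d)\<close> for a distance function D: the torus metric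
  when the positions are of order one, the maximum distance on \<open>\<real>^d\<close> when they are of order \<open>n^(-1/d)\<close>.
  The conditions are strict, hence open, and do not involve n.\<close>

definition pair_ratio ::
    "(real ^ 'd \<Rightarrow> real ^ 'd \<Rightarrow> real) \<Rightarrow> real \<Rightarrow> real \<times> (real ^ 'd) \<Rightarrow> real \<times> (real ^ 'd) \<Rightarrow> real" where
  "pair_ratio D \<mu> a b = fst a * fst b / (\<mu> * D (snd a) (snd b) ^ CARD('d))"

definition strict_configuration ::
    "(real ^ 'd \<Rightarrow> real ^ 'd \<Rightarrow> real) \<Rightarrow> mode \<Rightarrow> nat \<Rightarrow> nat set set \<Rightarrow> ereal \<Rightarrow> real \<Rightarrow> real
      \<Rightarrow> (nat \<Rightarrow> real \<times> (real ^ 'd)) \<Rightarrow> bool" where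
  "strict_configuration D m k E \<gamma> \<mu> \<epsilon> y \<longleftrightarrow> (\<forall>i\<in>{1..k}. \<forall>j\<in>{1..k}. i \<noteq> j \<longrightarrow>
     \<epsilon> < D (snd (y i)) (snd (y j)) \<and> D (snd (y i)) (snd (y j)) < 1 / \<epsilon> \<and>
     ratio_allows m \<gamma> ({i, j} \<in> E) (pair_ratio D \<mu> (y i) (y j)))"

lemma strict_pair_robust:
  fixes D :: "real ^ 'd \<Rightarrow> real ^ 'd \<Rightarrow> real"
  assumes D: "continuous_on UNIV (\<lambda>p. D (fst p) (snd p))"
    and \<gamma>: "1 < \<gamma>" and \<epsilon>: "0 < \<epsilon>" and \<mu>: "0 < \<mu>"
    and y: "\<epsilon> < D (snd a) (snd b)" "D (snd a) (snd b) < 1 / \<epsilon>"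
      "ratio_allows m \<gamma> required (pair_ratio D \<mu> a b)"
  shows "\<exists>\<delta>>0. \<exists>\<kappa>>0. \<forall>a' b'. near \<delta> a' a \<longrightarrow> near \<delta> b' b \<longrightarrow>
      \<epsilon> < D (snd a') (snd b') \<and> D (snd a') (snd b') < 1 / \<epsilon> \<and>
      \<kappa> \<le> pair_factor m \<gamma> required (pair_ratio D \<mu> a' b')"
proof -
  let ?F = "nhds (a, b)"
  have f: "(fst \<longlongrightarrow> a) ?F" "(snd \<longlongrightarrow> b) ?F"
    using tendsto_fst[OF filterlim_ident[of ?F]] tendsto_snd[OF filterlim_ident[of ?F]] by simp_all
  have lim_pair: "((\<lambda>z. (snd (fst z), snd (snd z))) \<longlongrightarrow> (snd a, snd b)) ?F"
    by (intro tendsto_intros f)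
  have limD: "((\<lambda>z. D (snd (fst z)) (snd (snd z))) \<longlongrightarrow> D (snd a) (snd b)) ?F"
    using continuous_on_tendsto_compose[OF D lim_pair] by simp
  have D0: "D (snd a) (snd b) \<noteq> 0" using y \<epsilon> by auto
  have "((\<lambda>z. pair_ratio D \<mu> (fst z) (snd z)) \<longlongrightarrow> pair_ratio D \<mu> a b) ?F"
    unfolding pair_ratio_def using D0 \<mu> by (intro tendsto_intros f limD) auto
  moreover obtain \<kappa> where \<kappa>: "0 < \<kappa>"
      "\<forall>\<^sub>F q in nhds (pair_ratio D \<mu> a b). \<kappa> \<le> pair_factor m \<gamma> required q"
    using eventually_pair_factor_ge[OF \<gamma> y(3)] .
  ultimately have "\<forall>\<^sub>F z in ?F. \<kappa> \<le> pair_factor m \<gamma> required (pair_ratio D \<mu> (fst z) (snd z))"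
    using filterlim_iff by fast
  moreover have "\<forall>\<^sub>F z in ?F. \<epsilon> < D (snd (fst z)) (snd (snd z))"
    "\<forall>\<^sub>F z in ?F. D (snd (fst z)) (snd (snd z)) < 1 / \<epsilon>"
    using order_tendstoD[OF limD] y by auto
  ultimately have "\<forall>\<^sub>F z in ?F. \<epsilon> < D (snd (fst z)) (snd (snd z)) \<and> D (snd (fst z)) (snd (snd z)) < 1 / \<epsilon> \<and>
      \<kappa> \<le> pair_factor m \<gamma> required (pair_ratio D \<mu> (fst z) (snd z))"
    by eventually_elim auto
  then obtain r where r: "0 < r" "\<And>z. dist z (a, b) < r \<Longrightarrow>
      \<epsilon> < D (snd (fst z)) (snd (snd z)) \<and> D (snd (fst z)) (snd (snd z)) < 1 / \<epsilon> \<and>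
      \<kappa> \<le> pair_factor m \<gamma> required (pair_ratio D \<mu> (fst z) (snd z))"
    by (auto simp: eventually_nhds_metric)
  \<comment> \<open>Moving both points by less than this changes the pair by less than r.\<close>
  define \<delta> where "\<delta> = r / (4 * (1 + real CARD('d)))"
  have \<delta>: "0 < \<delta>" "(1 + real CARD('d)) * \<delta> = r / 4"
    using r(1) by (simp_all add: \<delta>_def field_simps)
  have "dist (a', b') (a, b) < r" if "near \<delta> a' a" "near \<delta> b' b" for a' b'
  proof -
    have "dist (a', b') (a, b) \<le> dist a' a + dist b' b"
      by (simp add: dist_Pair_Pair sqrt_sum_squares_le_sum)
    also have "\<dots> \<le> r / 4 + r / 4"
      using dist_less_of_near[OF that(1)] dist_less_of_near[OF that(2)] \<delta>(2) by linarith
    finally show ?thesis using r(1) by linarith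
  qed
  with r(2)[of "(_, _)"] \<delta>(1) \<kappa>(1) show ?thesis by (intro exI[of _ \<delta>] conjI exI[of _ \<kappa>]) auto
qed

definition robust_configuration ::
    "(real ^ 'd \<Rightarrow> real ^ 'd \<Rightarrow> real) \<Rightarrow> mode \<Rightarrow> nat \<Rightarrow> nat set set \<Rightarrow> ereal \<Rightarrow> real \<Rightarrow> real
      \<Rightarrow> real \<Rightarrow> real \<Rightarrow> (nat \<Rightarrow> real \<times> (real ^ 'd)) \<Rightarrow> bool" where
  "robust_configuration D m k E \<gamma> \<mu> \<epsilon> \<delta> \<kappa> y \<longleftrightarrow> (\<forall>y'. (\<forall>i\<in>{1..k}. near \<delta> (y' i) (y i)) \<longrightarrow>
     (\<forall>i\<in>{1..k}. \<forall>j\<in>{1..k}. i \<noteq> j \<longrightarrow>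
        \<epsilon> < D (snd (y' i)) (snd (y' j)) \<and> D (snd (y' i)) (snd (y' j)) < 1 / \<epsilon> \<and>
        \<kappa> \<le> pair_factor m \<gamma> ({i, j} \<in> E) (pair_ratio D \<mu> (y' i) (y' j))))"

lemma strict_configuration_robust:
  fixes D :: "real ^ 'd \<Rightarrow> real ^ 'd \<Rightarrow> real"
  assumes D: "continuous_on UNIV (\<lambda>p. D (fst p) (snd p))"
    and \<gamma>: "1 < \<gamma>" and \<epsilon>: "0 < \<epsilon>" and \<mu>: "0 < \<mu>"
    and y: "strict_configuration D m k E \<gamma> \<mu> \<epsilon> y"
  obtains \<delta> \<kappa> where "0 < \<delta>" "0 < \<kappa>"
    "robust_configuration D m k E \<gamma> \<mu> \<epsilon> \<delta> \<kappa> y"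
proof -
  let ?P = "{(i, j). i \<in> {1..k} \<and> j \<in> {1..k} \<and> i \<noteq> j}"
  have finP: "finite ?P" by (rule finite_subset[of _ "{1..k} \<times> {1..k}"]) auto
  define good where "good ij \<delta>\<kappa> \<longleftrightarrow> 0 < fst \<delta>\<kappa> \<and> 0 < snd \<delta>\<kappa> \<and>
      (\<forall>a' b'. near (fst \<delta>\<kappa>) a' (y (fst ij)) \<longrightarrow> near (fst \<delta>\<kappa>) b' (y (snd ij)) \<longrightarrow>
        \<epsilon> < D (snd a') (snd b') \<and> D (snd a') (snd b') < 1 / \<epsilon> \<and>
        snd \<delta>\<kappa> \<le> pair_factor m \<gamma> ({fst ij, snd ij} \<in> E) (pair_ratio D \<mu> a' b'))"
    for ij :: "nat \<times> nat" and \<delta>\<kappa> :: "real \<times> real"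
  have "\<exists>\<delta>\<kappa>. good ij \<delta>\<kappa>" if "ij \<in> ?P" for ij
  proof -
    obtain i j where "ij = (i, j)" by (cases ij)
    with that y have "\<epsilon> < D (snd (y i)) (snd (y j))" "D (snd (y i)) (snd (y j)) < 1 / \<epsilon>"
      "ratio_allows m \<gamma> ({i, j} \<in> E) (pair_ratio D \<mu> (y i) (y j))"
      by (auto simp: strict_configuration_def)
    from strict_pair_robust[OF D \<gamma> \<epsilon> \<mu> this]
    obtain \<delta> \<kappa> where "\<delta> > 0" "\<kappa> > 0" "\<forall>a' b'. near \<delta> a' (y i) \<longrightarrow> near \<delta> b' (y j) \<longrightarrow>
      \<epsilon> < D (snd a') (snd b') \<and> D (snd a') (snd b') < 1 / \<epsilon> \<and>
      \<kappa> \<le> pair_factor m \<gamma> ({i, j} \<in> E) (pair_ratio D \<mu> a' b')" by blast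
    then have "good ij (\<delta>, \<kappa>)" using \<open>ij = (i, j)\<close> by (simp add: good_def)
    then show ?thesis by blast
  qed
  then have "\<forall>ij\<in>?P. \<exists>\<delta>\<kappa>. good ij \<delta>\<kappa>" by (rule ballI)
  from bchoice[OF this] obtain f where f: "\<forall>ij\<in>?P. good ij (f ij)" ..
  have f0: "0 < fst (f ij)" "0 < snd (f ij)" if "ij \<in> ?P" for ij
    using bspec[OF f that] by (simp_all add: good_def)
  define \<delta> where "\<delta> = Min (insert 1 ((\<lambda>ij. fst (f ij)) ` ?P))"
  define \<kappa> where "\<kappa> = Min (insert 1 ((\<lambda>ij. snd (f ij)) ` ?P))"
  show thesis
  proof
    show "0 < \<delta>" unfolding \<delta>_def using finP f0 by (subst Min_gr_iff) auto
    show "0 < \<kappa>" unfolding \<kappa>_def using finP f0 by (subst Min_gr_iff) auto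
    show "robust_configuration D m k E \<gamma> \<mu> \<epsilon> \<delta> \<kappa> y"
      unfolding robust_configuration_def
    proof (intro allI impI ballI)
      fix y' i j
      assume "\<forall>i\<in>{1..k}. near \<delta> (y' i) (y i)"
      then have near: "\<And>i. i \<in> {1..k} \<Longrightarrow> near \<delta> (y' i) (y i)" by blast
      assume ij: "i \<in> {1..k}" "j \<in> {1..k}" "i \<noteq> j"
      then have P: "(i, j) \<in> ?P" by simp
      have "\<delta> \<le> fst (f (i, j))" unfolding \<delta>_def using finP P by (intro Min_le) auto
      then have "near (fst (f (i, j))) (y' i) (y i)" "near (fst (f (i, j))) (y' j) (y j)"
        using near_mono[OF near[OF ij(1)]] near_mono[OF near[OF ij(2)]] by simp_all
      then have "\<epsilon> < D (snd (y' i)) (snd (y' j)) \<and> D (snd (y' i)) (snd (y' j)) < 1 / \<epsilon> \<and>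
        snd (f (i, j)) \<le> pair_factor m \<gamma> ({i, j} \<in> E) (pair_ratio D \<mu> (y' i) (y' j))"
        using bspec[OF f P] unfolding good_def fst_conv snd_conv by blast
      moreover have "\<kappa> \<le> snd (f (i, j))" unfolding \<kappa>_def using finP P by (intro Min_le) auto
      ultimately show "\<epsilon> < D (snd (y' i)) (snd (y' j)) \<and> D (snd (y' i)) (snd (y' j)) < 1 / \<epsilon> \<and>
        \<kappa> \<le> pair_factor m \<gamma> ({i, j} \<in> E) (pair_ratio D \<mu> (y' i) (y' j))"
        by linarith
    qed
  qed
qed

lemma robust_configurationD:
  assumes "robust_configuration D m k E \<gamma> \<mu> \<epsilon> \<delta> \<kappa> y" "\<delta>' \<le> \<delta>"
    and "\<And>i. i \<in> {1..k} \<Longrightarrow> near \<delta>' (y' i) (y i)" "i \<in> {1..k}" "j \<in> {1..k}" "i \<noteq> j"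
  shows "\<epsilon> < D (snd (y' i)) (snd (y' j)) \<and> D (snd (y' i)) (snd (y' j)) < 1 / \<epsilon> \<and>
    \<kappa> \<le> pair_factor m \<gamma> ({i, j} \<in> E) (pair_ratio D \<mu> (y' i) (y' j))"
proof -
  have "\<forall>i\<in>{1..k}. near \<delta> (y' i) (y i)" using near_mono[OF assms(3,2)] by blast
  with assms(1,4-6) show ?thesis unfolding robust_configuration_def by blast
qed

text \<open>The vertices of a scaled configuration move in small cubes, and the configuration is placed
  at scale s at each of the points of a finite set Z. Half-open cubes rather than balls make the
  probability of a placement a product.\<close>

definition placed_cube :: "real \<Rightarrow> real \<Rightarrow> (real ^ 'd) \<Rightarrow> real ^ 'd \<Rightarrow> (real ^ 'd) set" where
  "placed_cube s \<delta> y z = half_open_cube (\<chi> j. z $ j + s * y $ j) (s * \<delta>)"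

definition unscale :: "real \<Rightarrow> real ^ 'd \<Rightarrow> real ^ 'd \<Rightarrow> real ^ 'd" where
  "unscale s z x = (\<chi> j. (x $ j - z $ j) / s)"

lemma unscale_placed_cube:
  assumes "0 < s" "x \<in> placed_cube s \<delta> y z"
  shows "y $ j \<le> unscale s z x $ j" "unscale s z x $ j < y $ j + \<delta>"
proof -
  have "z $ j + s * y $ j \<le> x $ j" "x $ j < z $ j + s * y $ j + s * \<delta>"
    using assms(2) by (auto simp: placed_cube_def half_open_cube_def)
  then show "y $ j \<le> unscale s z x $ j" "unscale s z x $ j < y $ j + \<delta>"
    using assms(1) by (simp_all add: unscale_def field_simps)
qed

text \<open>The cubes of the first vertex are disjoint for different placements, which makes the
  corresponding events disjoint; the last condition says that the torus looks like the scaled model.\<close>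

definition placement ::
    "(real ^ 'd \<Rightarrow> real ^ 'd \<Rightarrow> real) \<Rightarrow> nat \<Rightarrow> real \<Rightarrow> real \<Rightarrow> (nat \<Rightarrow> real ^ 'd) \<Rightarrow> (real ^ 'd) set \<Rightarrow> bool" where
  "placement D k s \<delta> y Z \<longleftrightarrow> finite Z \<and>
     (\<forall>z\<in>Z. \<forall>i\<in>{1..k}. placed_cube s \<delta> (y i) z \<subseteq> torus) \<and>
     disjoint_family_on (\<lambda>z. placed_cube s \<delta> (y 1) z) Z \<and>
     (\<forall>z\<in>Z. \<forall>i\<in>{1..k}. \<forall>j\<in>{1..k}. \<forall>x\<in>placed_cube s \<delta> (y i) z. \<forall>x'\<in>placed_cube s \<delta> (y j) z.
        torus_dist x x' = s * D (unscale s z x) (unscale s z x'))"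

context power_law
begin

text \<open>When all vertices are in the cubes of one placement, the tuple is in the class and each
  pair contributes at least \<open>\<kappa>\<close>: at the threshold \<open>2 a = 1 + d b\<close> the powers of n cancel in the
  ratios.\<close>

lemma tuple_prob_ge_boxes:
  fixes y :: "nat \<Rightarrow> real \<times> (real ^ 'd)" and D :: "real ^ 'd \<Rightarrow> real ^ 'd \<Rightarrow> real"
  assumes E: "E \<subseteq> vertex_pairs k" and k: "1 \<le> k" and n: "1 \<le> n" and \<epsilon>: "0 < \<epsilon>"
    and const: "\<And>i. i \<in> {1..k} \<Longrightarrow> fst p i = a" "\<And>e. e \<in> vertex_pairs k \<Longrightarrow> snd p e = b"
    and ab: "2 * a = 1 + real CARD('d) * b"
    and \<kappa>: "0 < \<kappa>" and \<delta>: "0 < \<delta>"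
    and robust: "robust_configuration D m k E \<gamma> (\<integral>t. t \<partial>\<nu>) \<epsilon> \<delta>0 \<kappa> y" "\<delta> \<le> \<delta>0"
    and Z: "placement D k (real n powr b) \<delta> (\<lambda>i. snd (y i)) Z"
  shows "\<kappa> ^ card E * \<kappa> ^ card (forbidden_pairs m k E) * (card Z *
      (\<Prod>i\<in>{1..k}. prob {t \<in> scale_interval \<epsilon> n a. \<bar>t / real n powr a - fst (y i)\<bar> < \<delta>} *
        (real n powr b * \<delta>) ^ CARD('d)))
    \<le> tuple_prob TYPE('d::finite) m k E \<gamma> \<nu> n \<epsilon> p"
proof -
  let ?L = "vertex_measure \<nu> :: (real \<times> (real ^ 'd)) measure"
  let ?P = "PiM {1..k} (\<lambda>_. ?L)"
  let ?\<mu> = "\<integral>t. t \<partial>\<nu>" and ?s = "real n powr b"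
  let ?F = "forbidden_pairs m k E"
  interpret PP: product_prob_space "\<lambda>_. ?L" by (rule product_prob_space_vertex_measure)
  interpret P: prob_space ?P by (intro prob_space_PiM prob_space_vertex_measure)
  have n0: "0 < real n" and s0: "0 < ?s" using n by auto
  have \<mu>: "0 < ?\<mu>" using mean_ge_1 by linarith
  define Wt where "Wt i = {t \<in> scale_interval \<epsilon> n a. \<bar>t / real n powr a - fst (y i)\<bar> < \<delta>}" for i
  define B where "B z i = placed_cube ?s \<delta> (snd (y i)) z" for z i
  have Wt_meas: "Wt i \<in> sets borel" for i
    unfolding Wt_def scale_interval_def by measurable
  have B_meas: "B z i \<in> sets borel" for z i
    unfolding B_def placed_cube_def by simp
  define R where "R z = PiE {1..k} (\<lambda>i. Wt i \<times> B z i)" for z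
  have finZ: "finite Z" using Z by (simp add: placement_def)
  have R_meas: "R z \<in> sets ?P" for z
    unfolding R_def using Wt_meas B_meas
    by (intro sets_PiM_I_finite) (auto simp: sets_vertex_measure intro!: pair_measureI)
  have L_box: "emeasure ?L (Wt i \<times> B z i) = ennreal (prob (Wt i) * (?s * \<delta>) ^ CARD('d))"
    if "z \<in> Z" "i \<in> {1..k}" for z i
  proof -
    have "B z i \<subseteq> torus" using Z that by (simp add: placement_def B_def)
    then have "emeasure uniform_torus (B z i) = emeasure lborel (B z i)"
      using emeasure_uniform_torus[OF B_meas[of z i]] by (simp only: Int_absorb1)
    also have "\<dots> = ennreal ((?s * \<delta>) ^ CARD('d))"
      unfolding B_def placed_cube_def using s0 \<delta> by (intro emeasure_half_open_cube) simp
    finally show ?thesis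
      using Wt_meas B_meas s0 \<delta>
      by (simp add: emeasure_vertex_measure_Times emeasure_eq_measure ennreal_mult)
  qed
  have P_R: "measure ?P (R z) = (\<Prod>i\<in>{1..k}. prob (Wt i) * (?s * \<delta>) ^ CARD('d))" if z: "z \<in> Z" for z
  proof -
    have "emeasure ?P (R z) = (\<Prod>i\<in>{1..k}. emeasure ?L (Wt i \<times> B z i))"
      unfolding R_def using Wt_meas B_meas
      by (intro PP.emeasure_PiM) (auto simp: sets_vertex_measure intro!: pair_measureI)
    also have "\<dots> = (\<Prod>i\<in>{1..k}. ennreal (prob (Wt i) * (?s * \<delta>) ^ CARD('d)))"
      using L_box[OF z] by (intro prod.cong) auto
    also have "\<dots> = ennreal (\<Prod>i\<in>{1..k}. prob (Wt i) * (?s * \<delta>) ^ CARD('d))"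
      using s0 \<delta> by (intro prod_ennreal) (auto intro!: mult_nonneg_nonneg)
    finally show ?thesis
      using s0 \<delta> by (simp add: measure_eq_emeasure_eq_ennreal prod_nonneg)
  qed
  have disj: "disjoint_family_on R Z"
  proof (unfold disjoint_family_on_def, intro ballI impI)
    fix z z' assume zz: "z \<in> Z" "z' \<in> Z" "z \<noteq> z'"
    have B1: "B z 1 \<inter> B z' 1 = {}" using Z zz by (auto simp: placement_def disjoint_family_on_def B_def)
    have R1: "snd (x 1) \<in> B t 1" if "x \<in> R t" for x t
    proof -
      have "x 1 \<in> Wt 1 \<times> B t 1"
        by (rule PiE_mem[OF that[unfolded R_def]]) (use k in simp)
      then show ?thesis by (simp add: mem_Times_iff)
    qed
    show "R z \<inter> R z' = {}"
    proof (rule equals0I)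
      fix x assume "x \<in> R z \<inter> R z'"
      then have "snd (x 1) \<in> B z 1 \<inter> B z' 1" using R1 by blast
      with B1 show False by simp
    qed
  qed
  define U where "U = (\<Union>z\<in>Z. R z)"
  have U_meas: "U \<in> sets ?P" unfolding U_def using finZ R_meas by (intro sets.finite_UN) auto
  have P_U: "measure ?P U = card Z * (\<Prod>i\<in>{1..k}. prob (Wt i) * (?s * \<delta>) ^ CARD('d))"
  proof -
    have "measure ?P U = (\<Sum>z\<in>Z. measure ?P (R z))"
      unfolding U_def using finZ R_meas disj by (intro P.finite_measure_finite_Union) auto
    also have "\<dots> = (\<Sum>z\<in>Z. \<Prod>i\<in>{1..k}. prob (Wt i) * (?s * \<delta>) ^ CARD('d))"
      by (rule sum.cong[OF refl P_R])
    finally show ?thesis by (simp only: sum_constant)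
  qed
  define K where "K = \<kappa> ^ card E * \<kappa> ^ card ?F"
  have K0: "0 \<le> K" using \<kappa> by (simp add: K_def)
  have density: "K \<le> pattern_density m k E \<gamma> ?\<mu> n \<epsilon> p x" if xU: "x \<in> U" for x
  proof -
    from xU obtain z where z: "z \<in> Z" "x \<in> R z" by (auto simp: U_def)
    have xW: "fst (x i) \<in> Wt i" and xB: "snd (x i) \<in> B z i" if "i \<in> {1..k}" for i
      using z(2) that by (auto simp: R_def PiE_iff mem_Times_iff)
    define y' where "y' i = (fst (x i) / real n powr a, unscale ?s z (snd (x i)))" for i
    have near: "near \<delta> (y' i) (y i)" if i: "i \<in> {1..k}" for i
    proof -
      have "\<bar>fst (y' i) - fst (y i)\<bar> < \<delta>" using xW[OF i] by (simp add: Wt_def y'_def)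
      moreover have "\<bar>snd (y' i) $ j - snd (y i) $ j\<bar> < \<delta>" for j
        using unscale_placed_cube[OF s0, of "snd (x i)" \<delta> "snd (y i)" z j] xB[OF i] \<delta>
        by (simp add: B_def y'_def abs_less_iff)
      ultimately show ?thesis by (simp add: near_def)
    qed
    have dist: "torus_dist (snd (x i)) (snd (x j)) = ?s * D (snd (y' i)) (snd (y' j))"
      if "i \<in> {1..k}" "j \<in> {1..k}" for i j
      using Z z(1) that xB unfolding placement_def B_def y'_def snd_conv by blast
    have pair: "\<epsilon> < D (snd (y' i)) (snd (y' j)) \<and> D (snd (y' i)) (snd (y' j)) < 1 / \<epsilon> \<and>
        \<kappa> \<le> pair_factor m \<gamma> ({i, j} \<in> E) (pair_ratio D ?\<mu> (y' i) (y' j))"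
      if "i \<in> {1..k}" "j \<in> {1..k}" "i \<noteq> j" for i j
      using robust_configurationD[OF robust near that] .
    have region: "x \<in> class_region k n \<epsilon> p"
      unfolding class_region_def
    proof (intro CollectI conjI ballI impI)
      fix i assume i: "i \<in> {1..k}"
      show "fst (x i) \<in> scale_interval \<epsilon> n (fst p i)" using xW[OF i] const(1)[OF i] by (simp add: Wt_def)
      fix j assume j: "j \<in> {1..k}" "i \<noteq> j"
      have "\<epsilon> * ?s \<le> ?s * D (snd (y' i)) (snd (y' j))" "?s * D (snd (y' i)) (snd (y' j)) \<le> ?s / \<epsilon>"
        using pair[OF i j] s0 mult_left_mono[of "D (snd (y' i)) (snd (y' j))" "1 / \<epsilon>" ?s] by auto
      then show "torus_dist (snd (x i)) (snd (x j)) \<in> scale_interval \<epsilon> n (snd p {i, j})"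
        using const(2)[OF doubleton_in_vertex_pairs[OF i j]] dist[OF i j(1)]
        by (simp add: scale_interval_def)
    qed
    have conn: "\<kappa> \<le> pair_factor m \<gamma> (e \<in> E) (edge_prob_arg) \<and> pair_prob \<gamma> ?\<mu> n x e = edge_prob \<gamma> edge_prob_arg"
      if e: "e \<in> vertex_pairs k" and arg: "edge_prob_arg = pair_ratio D ?\<mu> (y' (Min e)) (y' (Max e))"
      for e edge_prob_arg
    proof -
      obtain i j where ij: "e = {i, j}" "i < j" "1 \<le> i" "j \<le> k" "Min e = i" "Max e = j"
        using e by (rule vertex_pairs_cases)
      then have i: "i \<in> {1..k}" and j: "j \<in> {1..k}" and ne: "i \<noteq> j" by auto
      have D0: "0 < D (snd (y' i)) (snd (y' j))" using pair[OF i j ne] \<epsilon> by linarith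
      have sd: "?s ^ CARD('d) = real n powr (real CARD('d) * b)" using n0 by (simp add: powr_power)
      have nn: "real n * real n powr (real CARD('d) * b) = real n powr a * real n powr a"
      proof -
        have "real n * real n powr (real CARD('d) * b) = real n powr (1 + real CARD('d) * b)"
          using n0 by (simp add: powr_add)
        also have "\<dots> = real n powr a * real n powr a" unfolding ab[symmetric] mult_2 by (rule powr_add)
        finally show ?thesis .
      qed
      have "conn_ratio ?\<mu> n (x i) (x j) = fst (x i) * fst (x j) /
          ((real n * real n powr (real CARD('d) * b)) * (?\<mu> * D (snd (y' i)) (snd (y' j)) ^ CARD('d)))"
        unfolding conn_ratio_def dist[OF i j] power_mult_distrib sd by (simp add: mult_ac)
      also have "\<dots> = pair_ratio D ?\<mu> (y' i) (y' j)"
        unfolding nn pair_ratio_def by (simp add: y'_def)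
      finally have "conn_ratio ?\<mu> n (x i) (x j) = edge_prob_arg" using arg ij by simp
      moreover have "connection_prob \<gamma> ?\<mu> n (x i) (x j) = edge_prob \<gamma> (conn_ratio ?\<mu> n (x i) (x j))"
        using dist[OF i j] D0 s0 by (intro connection_prob_eq_edge_prob[OF n \<mu>]) simp
      ultimately show ?thesis
        using pair[OF i j ne] arg ij(5,6) unfolding ij(1) pair_prob_doubleton[OF ne]
        by (simp del: Min_insert Max_insert)
    qed
    have "\<kappa> ^ card E = (\<Prod>e\<in>E. \<kappa>)" by simp
    also have "\<dots> \<le> (\<Prod>e\<in>E. pair_prob \<gamma> ?\<mu> n x e)"
    proof (intro prod_mono conjI)
      fix e assume e: "e \<in> E"
      with conn[OF _ refl, of e] E show "\<kappa> \<le> pair_prob \<gamma> ?\<mu> n x e" by (auto simp: pair_factor_def)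
    qed (use \<kappa> in auto)
    finally have 1: "\<kappa> ^ card E \<le> (\<Prod>e\<in>E. pair_prob \<gamma> ?\<mu> n x e)" .
    have "\<kappa> ^ card ?F = (\<Prod>e\<in>?F. \<kappa>)" by simp
    also have "\<dots> \<le> (\<Prod>e\<in>?F. 1 - pair_prob \<gamma> ?\<mu> n x e)"
    proof (intro prod_mono conjI)
      fix e assume e: "e \<in> ?F"
      then have "e \<in> vertex_pairs k" "e \<notin> E" "m = Ind"
        by (auto simp: forbidden_pairs_def split: mode.splits)
      with conn[OF _ refl, of e] show "\<kappa> \<le> 1 - pair_prob \<gamma> ?\<mu> n x e" by (auto simp: pair_factor_def)
    qed (use \<kappa> in auto)
    finally have 2: "\<kappa> ^ card ?F \<le> (\<Prod>e\<in>?F. 1 - pair_prob \<gamma> ?\<mu> n x e)" .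
    show ?thesis
      unfolding pattern_density_def K_def using region mult_mono[OF 1 2] \<kappa>
      by (simp add: prod_nonneg pair_prob_bounds)
  qed
  have s: "sets ?P = sets (PiM {1..k} (\<lambda>_. borel \<Otimes>\<^sub>M borel :: (real \<times> (real ^ 'd)) measure))"
    by (intro sets_PiM_cong refl sets_vertex_measure)
  have meas: "pattern_density m k E \<gamma> ?\<mu> n \<epsilon> p \<in> borel_measurable ?P"
    using pattern_density_measurable[OF E] s by (simp cong: measurable_cong_sets)
  have "K * measure ?P U = (\<integral>x. K * indicator U x \<partial>?P)" using U_meas by simp
  also have "\<dots> \<le> tuple_prob TYPE('d) m k E \<gamma> \<nu> n \<epsilon> p"
    unfolding tuple_prob_def
  proof (rule integral_mono)
    show "integrable ?P (\<lambda>x. K * indicator U x)"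
      using U_meas P.emeasure_finite[of U]
      by (intro integrable_mult_right integrable_real_indicator) (simp_all add: less_top)
    show "integrable ?P (pattern_density m k E \<gamma> ?\<mu> n \<epsilon> p)"
      using meas by (intro P.integrable_const_bound[of _ 1]) (auto simp: pattern_density_bounds)
    show "K * indicator U x \<le> pattern_density m k E \<gamma> ?\<mu> n \<epsilon> p x" for x
      using density[of x] by (auto simp: indicator_def pattern_density_bounds)
  qed
  finally show ?thesis unfolding P_U K_def Wt_def .
qed

text \<open>On the scale \<open>n^a\<close>, the weight law has mass of the order of its tail in every neighbourhood
  of such a weight. For \<open>a = 0\<close> this is the support of the law restricted to the window.\<close>

definition weight_cluster :: "real \<Rightarrow> real \<Rightarrow> real set" where
  "weight_cluster a \<epsilon> = {t. \<forall>\<delta>>0. \<exists>c'>0. \<forall>\<^sub>F n in sequentially.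
     c' * real n powr ((1 - \<tau>) * a) \<le> prob {s \<in> scale_interval \<epsilon> n a. \<bar>s / real n powr a - t\<bar> < \<delta>}}"

text \<open>A placement has probability of order \<open>n^(k (1 - \<tau>) a)\<close> for the weights and \<open>n^(k d b)\<close> for
  the positions, and of the order of \<open>n^(-d b)\<close> of them are disjoint: together this is the exponent of the upper bound.\<close>

lemma tuple_prob_lower:
  fixes y :: "nat \<Rightarrow> real \<times> (real ^ 'd)" and D :: "real ^ 'd \<Rightarrow> real ^ 'd \<Rightarrow> real"
  assumes E: "E \<subseteq> vertex_pairs k" and k: "1 \<le> k" and \<epsilon>: "0 < \<epsilon>" and \<gamma>: "1 < \<gamma>"
    and const: "\<And>i. i \<in> {1..k} \<Longrightarrow> fst p i = a" "\<And>e. e \<in> vertex_pairs k \<Longrightarrow> snd p e = b"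
    and ab: "2 * a = 1 + real CARD('d) * b"
    and D: "continuous_on UNIV (\<lambda>p. D (fst p) (snd p))"
    and strict: "strict_configuration D m k E \<gamma> (\<integral>t. t \<partial>\<nu>) \<epsilon> y"
    and cluster: "\<And>i. i \<in> {1..k} \<Longrightarrow> fst (y i) \<in> weight_cluster a \<epsilon>"
    and place: "\<And>\<delta>0. 0 < \<delta>0 \<Longrightarrow> \<exists>\<delta>>0. \<delta> \<le> \<delta>0 \<and> (\<exists>\<zeta>>0. \<forall>\<^sub>F n in sequentially.
      \<exists>Z. placement D k (real n powr b) \<delta> (\<lambda>i. snd (y i)) Z \<and>
          \<zeta> * real n powr (- (real CARD('d) * b)) \<le> card Z)"
  obtains C where "0 < C" "\<forall>\<^sub>F n in sequentially.
      C * real n powr ((1 - \<tau>) * a * k + real CARD('d) * b * (real k - 1))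
        \<le> tuple_prob TYPE('d::finite) m k E \<gamma> \<nu> n \<epsilon> p"
proof -
  let ?d = "real CARD('d)"
  have \<mu>: "0 < (\<integral>t. t \<partial>\<nu>)" using mean_ge_1 by linarith
  obtain \<delta>0 \<kappa> where \<delta>0: "0 < \<delta>0" and \<kappa>: "0 < \<kappa>" and
    robust: "robust_configuration D m k E \<gamma> (\<integral>t. t \<partial>\<nu>) \<epsilon> \<delta>0 \<kappa> y"
    using strict_configuration_robust[OF D \<gamma> \<epsilon> \<mu> strict] by blast
  obtain \<delta> \<zeta> where \<delta>: "0 < \<delta>" "\<delta> \<le> \<delta>0" and \<zeta>: "0 < \<zeta>" and Z: "\<forall>\<^sub>F n in sequentially.
      \<exists>Z. placement D k (real n powr b) \<delta> (\<lambda>i. snd (y i)) Z \<and>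
          \<zeta> * real n powr (- (?d * b)) \<le> card Z"
    using place[OF \<delta>0] by blast
  have "\<exists>c'>0. \<forall>\<^sub>F n in sequentially. c' * real n powr ((1 - \<tau>) * a)
      \<le> prob {t \<in> scale_interval \<epsilon> n a. \<bar>t / real n powr a - fst (y i)\<bar> < \<delta>}" if "i \<in> {1..k}" for i
    using cluster[OF that] \<delta>(1) by (simp add: weight_cluster_def)
  then have "\<forall>i\<in>{1..k}. \<exists>c'. 0 < c' \<and> (\<forall>\<^sub>F n in sequentially. c' * real n powr ((1 - \<tau>) * a)
      \<le> prob {t \<in> scale_interval \<epsilon> n a. \<bar>t / real n powr a - fst (y i)\<bar> < \<delta>})" by blast
  from bchoice[OF this] obtain c' where c': "\<forall>i\<in>{1..k}. 0 < c' i \<and> (\<forall>\<^sub>F n in sequentially. c' i * real n powr ((1 - \<tau>) * a)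
      \<le> prob {t \<in> scale_interval \<epsilon> n a. \<bar>t / real n powr a - fst (y i)\<bar> < \<delta>})" ..
  have ev: "\<forall>\<^sub>F n in sequentially. \<forall>i\<in>{1..k}. c' i * real n powr ((1 - \<tau>) * a)
      \<le> prob {t \<in> scale_interval \<epsilon> n a. \<bar>t / real n powr a - fst (y i)\<bar> < \<delta>}"
    using c' by (intro eventually_ball_finite) auto
  define K where "K = \<kappa> ^ card E * \<kappa> ^ card (forbidden_pairs m k E)"
  have K: "0 < K" using \<kappa> by (simp add: K_def)
  define C where "C = K * (\<zeta> * ((\<Prod>i\<in>{1..k}. c' i) * (\<delta> ^ CARD('d)) ^ k))"
  show thesis
  proof
    show "0 < C" unfolding C_def using K \<zeta> c' \<delta> by (intro mult_pos_pos prod_pos zero_less_power) auto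
    show "\<forall>\<^sub>F n in sequentially.
      C * real n powr ((1 - \<tau>) * a * k + ?d * b * (real k - 1))
        \<le> tuple_prob TYPE('d) m k E \<gamma> \<nu> n \<epsilon> p"
      using ev Z eventually_ge_at_top[of 1]
    proof eventually_elim
      case (elim n)
      from elim(3) have n0: "0 < real n" by simp
      from elim(2) obtain Z where Z: "placement D k (real n powr b) \<delta> (\<lambda>i. snd (y i)) Z"
        "\<zeta> * real n powr (- (?d * b)) \<le> card Z" by blast
      have "K * (card Z * (\<Prod>i\<in>{1..k}. prob {t \<in> scale_interval \<epsilon> n a. \<bar>t / real n powr a - fst (y i)\<bar> < \<delta>} *
        (real n powr b * \<delta>) ^ CARD('d))) \<le> tuple_prob TYPE('d) m k E \<gamma> \<nu> n \<epsilon> p"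
        unfolding K_def
        by (rule tuple_prob_ge_boxes[OF E k elim(3) \<epsilon> const ab \<kappa> \<delta>(1) robust \<delta>(2) Z(1)])
      moreover have "C * real n powr ((1 - \<tau>) * a * k + ?d * b * (real k - 1))
        = K * ((\<zeta> * real n powr (- (?d * b))) *
            (\<Prod>i\<in>{1..k}. (c' i * real n powr ((1 - \<tau>) * a)) * (real n powr b * \<delta>) ^ CARD('d)))"
      proof -
        have "(real n powr b * \<delta>) ^ CARD('d) = real n powr (?d * b) * \<delta> ^ CARD('d)"
          using n0 by (simp add: power_mult_distrib powr_power)
        from this have "(\<Prod>i\<in>{1..k}. (c' i * real n powr ((1 - \<tau>) * a)) * (real n powr b * \<delta>) ^ CARD('d))
            = (\<Prod>i\<in>{1..k}. c' i) * (real n powr ((1 - \<tau>) * a)) ^ k *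
              ((real n powr (?d * b)) ^ k * (\<delta> ^ CARD('d)) ^ k)"
          by (simp only: prod.distrib prod_constant card_atLeastAtMost power_mult_distrib) simp
        moreover have "(real n powr ((1 - \<tau>) * a)) ^ k = real n powr ((1 - \<tau>) * a * k)"
          "(real n powr (?d * b)) ^ k = real n powr (?d * b * k)"
          using n0 by (simp_all add: powr_power mult.commute)
        moreover have "real n powr ((1 - \<tau>) * a * k + ?d * b * (real k - 1))
            = real n powr (- (?d * b)) * (real n powr ((1 - \<tau>) * a * k) * real n powr (?d * b * k))"
          by (simp add: powr_add[symmetric] algebra_simps)
        ultimately show ?thesis by (simp add: C_def mult_ac)
      qed
      moreover have "K * ((\<zeta> * real n powr (- (?d * b))) *
            (\<Prod>i\<in>{1..k}. (c' i * real n powr ((1 - \<tau>) * a)) * (real n powr b * \<delta>) ^ CARD('d)))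
          \<le> K * (card Z * (\<Prod>i\<in>{1..k}. prob {t \<in> scale_interval \<epsilon> n a. \<bar>t / real n powr a - fst (y i)\<bar> < \<delta>} *
        (real n powr b * \<delta>) ^ CARD('d)))"
        using K Z(2) \<zeta> elim(1) c' \<delta>
        by (intro mult_left_mono mult_mono prod_mono mult_nonneg_nonneg prod_nonneg conjI ballI mult_right_mono)
           (auto simp: less_imp_le)
      ultimately show ?case by linarith
    qed
  qed
qed

end

section \<open>Placing scaled configurations on the torus\<close>

lemma sup_dist_scaled:
  fixes x y x' y' :: "real ^ 'd"
  assumes "0 \<le> c" "\<And>j. \<bar>x' $ j - y' $ j\<bar> = c * \<bar>x $ j - y $ j\<bar>"
  shows "sup_dist x' y' = c * sup_dist x y"
proof -
  have "mono (\<lambda>t :: real. c * t)" using assms(1) by (auto intro!: monoI mult_left_mono)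
  from mono_Max_commute[OF this, of "range (\<lambda>j. \<bar>x $ j - y $ j\<bar>)"]
  show ?thesis by (simp add: sup_dist_def assms(2) image_image)
qed

text \<open>Locally the torus is isometric to \<open>\<real>^d\<close>: representatives modulo 1 that differ by less than
  one half realize the distance.\<close>

lemma torus_dist_eq_sup_dist_of_congruent:
  fixes x y u v :: "real ^ 'd"
  assumes "x \<in> torus" "y \<in> torus"
    and "\<And>j. (x $ j - y $ j) - (u $ j - v $ j) \<in> \<int>" "\<And>j. \<bar>u $ j - v $ j\<bar> < 1 / 2"
  shows "torus_dist x y = sup_dist u v"
proof -
  have "min \<bar>x $ j - y $ j\<bar> (1 - \<bar>x $ j - y $ j\<bar>) = \<bar>u $ j - v $ j\<bar>" for j
  proof -
    obtain m :: int where m: "(x $ j - y $ j) - (u $ j - v $ j) = of_int m"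
      using assms(3)[of j] by (elim Ints_cases)
    have xy: "\<bar>x $ j - y $ j\<bar> < 1"
      using assms(1,2) by (auto simp: torus_def abs_less_iff intro: le_less_trans)
        (smt (verit, best))+
    then have "\<bar>real_of_int m\<bar> < 2" using m assms(4)[of j] by linarith
    then have "\<bar>m\<bar> < 2" by linarith
    then consider "m = -1" | "m = 0" | "m = 1" by linarith
    then show ?thesis
      using m xy assms(4)[of j] by cases (auto simp: min_def abs_if split: if_splits)
  qed
  then show ?thesis by (simp add: torus_dist_def sup_dist_def)
qed

text \<open>At scale one the configuration itself is the only placement, and half-open cubes at points
  of the half-open unit cube fit into it.\<close>

lemma placement_torus:
  fixes y :: "nat \<Rightarrow> real ^ 'd"
  assumes "\<And>i. i \<in> {1..k} \<Longrightarrow> y i \<in> torus" and \<delta>0: "0 < \<delta>0"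
  shows "\<exists>\<delta>>0. \<delta> \<le> \<delta>0 \<and> placement torus_dist k 1 \<delta> y {0}"
proof -
  let ?I = "{1..k} \<times> (UNIV :: 'd set)"
  define \<delta> where "\<delta> = Min (insert \<delta>0 ((\<lambda>ij. 1 - y (fst ij) $ snd ij) ` ?I))"
  have "0 < \<delta>" unfolding \<delta>_def using assms by (subst Min_gr_iff) (auto simp: torus_def)
  moreover have "\<delta> \<le> \<delta>0" unfolding \<delta>_def by (intro Min_le) auto
  moreover have \<delta>: "\<delta> \<le> 1 - y i $ j" if "i \<in> {1..k}" for i j
  proof -
    have "1 - y i $ j \<in> (\<lambda>ij. 1 - y (fst ij) $ snd ij) ` ?I"
      using that by (intro image_eqI[of _ _ "(i, j)"]) auto
    then show ?thesis unfolding \<delta>_def by (intro Min_le) auto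
  qed
  have "placed_cube 1 \<delta> (y i) 0 \<subseteq> torus" if "i \<in> {1..k}" for i
  proof
    fix x assume "x \<in> placed_cube 1 \<delta> (y i) 0"
    then have "y i $ j \<le> x $ j" "x $ j < y i $ j + \<delta>" for j
      by (auto simp: placed_cube_def half_open_cube_def)
    then show "x \<in> torus" using \<delta>[OF that] assms(1)[OF that]
      unfolding torus_def mem_Collect_eq by (smt (verit, best))
  qed
  moreover have "unscale 1 0 x = x" for x :: "real ^ 'd" by (simp add: unscale_def)
  ultimately show ?thesis
    by (intro exI[of _ \<delta>]) (auto simp: placement_def disjoint_family_on_def)
qed

text \<open>At scale \<open>n^(-1/d)\<close> the torus has room for a number of disjoint cells proportional to n, each
  of which contains a copy of the configuration. Staying inside a cell avoids wrapping around.\<close>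

lemma placement_cells:
  fixes y :: "nat \<Rightarrow> real ^ 'd"
  assumes k: "1 \<le> k" and \<delta>: "0 < \<delta>" "\<delta> \<le> 1"
  obtains \<zeta> where "0 < \<zeta>" "\<forall>\<^sub>F n in sequentially.
    \<exists>Z. placement sup_dist k (real n powr (- 1 / real CARD('d))) \<delta> y Z \<and> \<zeta> * real n \<le> card Z"
proof -
  let ?d = "CARD('d)"
  define H where "H = Max (insert 0 ((\<lambda>ij. \<bar>y (fst ij) $ snd ij\<bar>) ` ({1..k} \<times> (UNIV :: 'd set))))"
  have H0: "0 \<le> H" unfolding H_def by (intro Max_ge) auto
  have H: "\<bar>y i $ j\<bar> \<le> H" if "i \<in> {1..k}" for i j
  proof -
    have "\<bar>y i $ j\<bar> \<in> (\<lambda>ij. \<bar>y (fst ij) $ snd ij\<bar>) ` ({1..k} \<times> UNIV)"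
      using that by (intro image_eqI[of _ _ "(i, j)"]) auto
    then show ?thesis unfolding H_def by (intro Max_ge) auto
  qed
  \<comment> \<open>In units of s, a cell of side h holds the coordinates of the configuration, which range
    over an interval of length 2H, and the width of the cubes.\<close>
  define h where "h = 2 * H + 2"
  have h: "2 \<le> h" using H0 by (simp add: h_def)
  define \<zeta> where "\<zeta> = (1 / (2 * h)) ^ ?d"
  show thesis
  proof
    show "0 < \<zeta>" using h by (simp add: \<zeta>_def)
    have "filterlim (\<lambda>n. real n powr (1 / real ?d)) at_top sequentially"
      by real_asymp
    then have "\<forall>\<^sub>F n in sequentially. 2 * h \<le> real n powr (1 / real ?d)"
      by (simp add: filterlim_at_top)
    then show "\<forall>\<^sub>F n in sequentially.
      \<exists>Z. placement sup_dist k (real n powr (- 1 / real ?d)) \<delta> y Z \<and> \<zeta> * real n \<le> card Z"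
      using eventually_ge_at_top[of 1]
    proof eventually_elim
      case (elim n)
      let ?s = "real n powr (- 1 / real ?d)" and ?L = "real n powr (1 / real ?d)"
      have n0: "0 < real n" using elim(2) by simp
      then have s0: "0 < ?s" by simp
      have sL: "?s * ?L = 1" using n0 by (simp add: powr_add[symmetric])
      have sh: "?s * h \<le> 1 / 2"
      proof -
        have "?s * (2 * h) \<le> ?s * ?L" using elim(1) s0 by (intro mult_left_mono) auto
        then show ?thesis using sL by simp
      qed
      define N where "N = nat \<lfloor>?L / h\<rfloor>"
      have N: "real N \<le> ?L / h" "?L / (2 * h) \<le> real N"
      proof -
        define q where "q = ?L / h"
        have "2 \<le> q" unfolding q_def using elim(1) h by (simp add: le_divide_eq)
        then have "real N = of_int \<lfloor>q\<rfloor>" by (simp add: N_def q_def[symmetric])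
        moreover have "?L / (2 * h) = q / 2" by (simp add: q_def)
        ultimately show "real N \<le> ?L / h" "?L / (2 * h) \<le> real N"
          using \<open>2 \<le> q\<close> unfolding q_def[symmetric] by linarith+
      qed
      have shN: "?s * (h * real N) \<le> 1"
      proof -
        have "?s * (h * real N) \<le> ?s * ?L"
          using N(1) h s0 by (intro mult_left_mono) (auto simp: field_simps)
        then show ?thesis using sL by simp
      qed
      define I where "I = PiE (UNIV :: 'd set) (\<lambda>_. {..<N})"
      \<comment> \<open>The summand H makes the coordinates of the placed points nonnegative.\<close>
      define pt where "pt g = (\<chi> j. ?s * (h * real (g j) + H))" for g :: "'d \<Rightarrow> nat"
      have cell: "?s * (h * real (g j)) \<le> x $ j \<and> x $ j < ?s * (h * (real (g j) + 1))"
        if "x \<in> placed_cube ?s \<delta> (y i) (pt g)" "i \<in> {1..k}" for x i g j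
      proof -
        have "?s * (h * real (g j) + H) + ?s * y i $ j \<le> x $ j"
          "x $ j < ?s * (h * real (g j) + H) + ?s * y i $ j + ?s * \<delta>"
          using that(1) by (auto simp: placed_cube_def half_open_cube_def pt_def)
        moreover have "?s * (h * real (g j)) \<le> ?s * (h * real (g j) + H + y i $ j)"
          using H[OF that(2), of j] s0 by (intro mult_left_mono) auto
        moreover have "?s * (h * real (g j) + H + y i $ j + \<delta>) \<le> ?s * (h * (real (g j) + 1))"
        proof (intro mult_left_mono)
          have "h * (real (g j) + 1) = h * real (g j) + h" by (simp only: distrib_left mult_1_right)
          then show "h * real (g j) + H + y i $ j + \<delta> \<le> h * (real (g j) + 1)"
            using H[OF that(2), of j] \<delta>(2) h_def by linarith
        qed (use s0 in simp)
        ultimately show ?thesis unfolding distrib_left[of ?s] by linarith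
      qed
      have eq_of_cell: "g = g'" if "\<And>j. \<exists>t. ?s * (h * real (g j)) \<le> t \<and> t < ?s * (h * (real (g j) + 1)) \<and>
        ?s * (h * real (g' j)) \<le> t \<and> t < ?s * (h * (real (g' j) + 1))" for g g' :: "'d \<Rightarrow> nat"
      proof
        fix j
        obtain t where t: "?s * (h * real (g j)) \<le> t" "t < ?s * (h * (real (g j) + 1))"
          "?s * (h * real (g' j)) \<le> t" "t < ?s * (h * (real (g' j) + 1))" using \<open>\<And>j. \<exists>t. _ j t\<close>[of j] by blast
        have sh0: "0 < ?s * h" using s0 h by simp
        have "?s * h * real (g j) < ?s * h * (real (g' j) + 1)" "?s * h * real (g' j) < ?s * h * (real (g j) + 1)"
          using t by (simp_all add: mult.assoc)
        then have "real (g j) < real (g' j) + 1" "real (g' j) < real (g j) + 1"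
          using sh0 by (simp_all only: mult_less_cancel_left_pos)
        then show "g j = g' j" by linarith
      qed
      have inj: "inj_on pt I"
      proof (rule inj_onI)
        fix g g' assume eq: "pt g = pt g'"
        show "g = g'"
        proof
          fix j
          have "?s * (h * real (g j) + H) = ?s * (h * real (g' j) + H)"
            using arg_cong[OF eq, of "\<lambda>v. v $ j"] by (simp only: pt_def vec_lambda_beta)
          then have "h * real (g j) + H = h * real (g' j) + H" using s0 by simp
          then show "g j = g' j" using h by simp
        qed
      qed
      have "placement sup_dist k ?s \<delta> y (pt ` I)"
        unfolding placement_def
      proof (intro conjI ballI)
        show "finite (pt ` I)" unfolding I_def by (intro finite_imageI finite_PiE) auto
        show "placed_cube ?s \<delta> (y i) z \<subseteq> torus" if "z \<in> pt ` I" "i \<in> {1..k}" for z i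
        proof
          fix x assume x: "x \<in> placed_cube ?s \<delta> (y i) z"
          from that(1) obtain g where g: "g \<in> I" "z = pt g" by blast
          have "0 \<le> x $ j \<and> x $ j < 1" for j
          proof -
            have "g j < N" using g(1) by (auto simp: I_def)
            then have "real (g j) + 1 \<le> real N" by linarith
            then have "?s * (h * (real (g j) + 1)) \<le> ?s * (h * real N)"
              using s0 h by (intro mult_left_mono) auto
            moreover have "0 \<le> ?s * (h * real (g j))" using s0 h by simp
            ultimately show ?thesis using cell[OF x[unfolded g(2)] that(2), of j] shN by linarith
          qed
          then show "x \<in> torus" by (simp add: torus_def)
        qed
        show "disjoint_family_on (\<lambda>z. placed_cube ?s \<delta> (y 1) z) (pt ` I)"
          unfolding disjoint_family_on_def
        proof (intro ballI impI)
          fix z z' assume "z \<in> pt ` I" "z' \<in> pt ` I" "z \<noteq> z'"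
          then obtain g g' where g: "z = pt g" "z' = pt g'" "g \<noteq> g'" by blast
          show "placed_cube ?s \<delta> (y 1) z \<inter> placed_cube ?s \<delta> (y 1) z' = {}"
          proof (rule ccontr)
            assume "\<not> ?thesis"
            then obtain x where x: "x \<in> placed_cube ?s \<delta> (y 1) (pt g)" "x \<in> placed_cube ?s \<delta> (y 1) (pt g')"
              using g by blast
            have one: "1 \<in> {1..k}" using k by simp
            have "g = g'"
              by (rule eq_of_cell) (use cell[OF x(1) one] cell[OF x(2) one] in blast)
            then show False using g(3) by simp
          qed
        qed
        fix z i j x x'
        assume z: "z \<in> pt ` I" and ij: "i \<in> {1..k}" "j \<in> {1..k}"
          and x: "x \<in> placed_cube ?s \<delta> (y i) z" "x' \<in> placed_cube ?s \<delta> (y j) z"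
        from z obtain g where g: "z = pt g" by blast
        have half: "\<bar>x $ l - x' $ l\<bar> < 1 / 2" for l
        proof -
          have "?s * (h * (real (g l) + 1)) = ?s * (h * real (g l)) + ?s * h"
            by (simp only: distrib_left mult_1_right)
          then show ?thesis
            using cell[OF x(1)[unfolded g] ij(1), of l] cell[OF x(2)[unfolded g] ij(2), of l] sh
            unfolding abs_less_iff by linarith
        qed
        have "min \<bar>x $ l - x' $ l\<bar> (1 - \<bar>x $ l - x' $ l\<bar>) = \<bar>x $ l - x' $ l\<bar>" for l
          using half[of l] by linarith
        then have "torus_dist x x' = sup_dist x x'"
          by (simp add: torus_dist_def sup_dist_def)
        also have "\<dots> = ?s * sup_dist (unscale ?s z x) (unscale ?s z x')"
          using s0 by (intro sup_dist_scaled) (auto simp: unscale_def diff_divide_distrib[symmetric] abs_divide)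
        finally show "torus_dist x x' = ?s * sup_dist (unscale ?s z x) (unscale ?s z x')" .
      qed
      moreover have "\<zeta> * real n \<le> card (pt ` I)"
      proof -
        have "real (card (pt ` I)) = real N ^ ?d"
          by (simp add: card_image[OF inj]) (simp add: I_def card_PiE)
        moreover have "(?L / (2 * h)) ^ ?d \<le> real N ^ ?d"
          using N(2) h by (intro power_mono) auto
        moreover have "(?L / (2 * h)) ^ ?d = \<zeta> * real n"
          using n0 by (simp add: power_divide \<zeta>_def powr_power)
        ultimately show ?thesis by linarith
      qed
      ultimately show ?case by blast
    qed
  qed
qed

context power_law
begin

text \<open>On a growing scale the power law spreads over the whole window, whatever atoms or gaps
  the weight law may have.\<close>

lemma weight_cluster_interval:
  assumes a: "0 < a" and \<epsilon>: "0 < \<epsilon>" "\<epsilon> < 1" and t: "t \<in> {\<epsilon>..1 / \<epsilon>}"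
  shows "t \<in> weight_cluster a \<epsilon>"
  unfolding weight_cluster_def
proof (intro CollectI allI impI)
  fix \<delta> :: real assume \<delta>: "0 < \<delta>"
  have "1 < 1 / \<epsilon>" using \<epsilon> by (simp add: less_divide_eq)
  then have e: "\<epsilon> < 1 / \<epsilon>" using \<epsilon> by linarith
  obtain p q where pq: "\<epsilon> \<le> p" "p < q" "q \<le> 1 / \<epsilon>" "t - \<delta> < p" "q < t + \<delta>"
  proof (cases "t < 1 / \<epsilon>")
    case True
    then show thesis using t \<delta> by (intro that[of t "min (1 / \<epsilon>) (t + \<delta> / 2)"]) auto
  next
    case False
    then show thesis using t \<delta> e by (intro that[of "max \<epsilon> (t - \<delta> / 2)" t]) auto
  qed
  have "0 < p" using pq(1) \<epsilon>(1) by linarith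
  then obtain c' where c': "0 < c'" "\<forall>\<^sub>F n in sequentially. c' * real n powr ((1 - \<tau>) * a)
      \<le> prob {p * real n powr a<..q * real n powr a}"
    using tail_lower[OF a _ pq(2)] by blast
  have "\<forall>\<^sub>F n in sequentially. c' * real n powr ((1 - \<tau>) * a)
      \<le> prob {s \<in> scale_interval \<epsilon> n a. \<bar>s / real n powr a - t\<bar> < \<delta>}"
    using c'(2) eventually_ge_at_top[of 1]
  proof eventually_elim
    case (elim n)
    have P: "0 < real n powr a" using elim(2) by simp
    have "{p * real n powr a<..q * real n powr a} \<subseteq> {s \<in> scale_interval \<epsilon> n a. \<bar>s / real n powr a - t\<bar> < \<delta>}"
    proof
      fix s assume "s \<in> {p * real n powr a<..q * real n powr a}"
      then have s: "p < s / real n powr a" "s / real n powr a \<le> q"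
        using P by (auto simp: less_divide_eq divide_le_eq)
      then have "\<epsilon> < s / real n powr a" "s / real n powr a \<le> 1 / \<epsilon>" using pq by linarith+
      then have "s \<in> scale_interval \<epsilon> n a"
        using P \<epsilon> by (simp add: scale_interval_def field_simps)
      moreover have "\<bar>s / real n powr a - t\<bar> < \<delta>" using s pq by linarith
      ultimately show "s \<in> {s \<in> scale_interval \<epsilon> n a. \<bar>s / real n powr a - t\<bar> < \<delta>}" by simp
    qed
    moreover have "{s \<in> scale_interval \<epsilon> n a. \<bar>s / real n powr a - t\<bar> < \<delta>} \<in> sets borel"
      unfolding scale_interval_def by measurable
    ultimately have "prob {p * real n powr a<..q * real n powr a}
        \<le> prob {s \<in> scale_interval \<epsilon> n a. \<bar>s / real n powr a - t\<bar> < \<delta>}"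
      by (intro finite_measure_mono) (simp_all only: events_eq_borel)
    with elim(1) show ?case by linarith
  qed
  with c'(1) show "\<exists>c'>0. \<forall>\<^sub>F n in sequentially. c' * real n powr ((1 - \<tau>) * a)
      \<le> prob {s \<in> scale_interval \<epsilon> n a. \<bar>s / real n powr a - t\<bar> < \<delta>}"
    by (intro exI[of _ c'] conjI)
qed

lemma weight_cluster_0I:
  assumes "\<And>\<delta>. 0 < \<delta> \<Longrightarrow> 0 < prob {s \<in> {\<epsilon>..1 / \<epsilon>}. \<bar>s - t\<bar> < \<delta>}"
  shows "t \<in> weight_cluster 0 \<epsilon>"
  unfolding weight_cluster_def
proof (intro CollectI allI impI)
  fix \<delta> :: real assume "0 < \<delta>"
  let ?c = "prob {s \<in> {\<epsilon>..1 / \<epsilon>}. \<bar>s - t\<bar> < \<delta>}"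
  have "\<forall>\<^sub>F n in sequentially. ?c * real n powr ((1 - \<tau>) * 0)
      \<le> prob {s \<in> scale_interval \<epsilon> n 0. \<bar>s / real n powr 0 - t\<bar> < \<delta>}"
    using eventually_ge_at_top[of 1] by eventually_elim (simp add: scale_interval_def)
  with assms[OF \<open>0 < \<delta>\<close>] show "\<exists>c'>0. \<forall>\<^sub>F n in sequentially. c' * real n powr ((1 - \<tau>) * 0)
      \<le> prob {s \<in> scale_interval \<epsilon> n 0. \<bar>s / real n powr 0 - t\<bar> < \<delta>}"
    by (intro exI[of _ ?c] conjI)
qed

text \<open>The intervals with rational endpoints that carry no mass form a countable family, so their
  union is null, and every other point of the window is in the support of the restricted law.\<close>

lemma AE_support:
  "AE t in \<nu>. t \<in> {\<epsilon>..1 / \<epsilon>} \<longrightarrow> (\<forall>\<delta>>0. 0 < prob {s \<in> {\<epsilon>..1 / \<epsilon>}. \<bar>s - t\<bar> < \<delta>})"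
proof -
  let ?J = "\<lambda>pq :: rat \<times> rat. {\<epsilon>..1 / \<epsilon>} \<inter> {of_rat (fst pq)<..<of_rat (snd pq)} :: real set"
  let ?Q = "{pq. prob (?J pq) = 0}"
  have "(\<Union>pq\<in>?Q. ?J pq) \<in> null_sets \<nu>"
    by (intro null_sets_UN') (auto simp: null_sets_def emeasure_eq_measure)
  then have "AE t in \<nu>. t \<notin> (\<Union>pq\<in>?Q. ?J pq)" by (rule AE_not_in)
  then show ?thesis
  proof eventually_elim
    case (elim t)
    show ?case
    proof (intro impI allI)
      fix \<delta> :: real assume t: "t \<in> {\<epsilon>..1 / \<epsilon>}" and \<delta>: "0 < \<delta>"
      obtain p q :: rat where pq: "t - \<delta> < of_rat p" "of_rat p < t" "t < of_rat q" "of_rat q < t + \<delta>"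
        using of_rat_dense[of "t - \<delta>" t] of_rat_dense[of t "t + \<delta>"] \<delta> by auto
      then have "t \<in> ?J (p, q)" using t by simp
      with elim have "0 < prob (?J (p, q))"
        by (simp add: zero_less_measure_iff) (metis (mono_tags, lifting) UN_I mem_Collect_eq measure_nonneg)
      also have "\<dots> \<le> prob {s \<in> {\<epsilon>..1 / \<epsilon>}. \<bar>s - t\<bar> < \<delta>}"
        using pq by (intro finite_measure_mono) auto
      finally show "0 < prob {s \<in> {\<epsilon>..1 / \<epsilon>}. \<bar>s - t\<bar> < \<delta>}" .
    qed
  qed
qed

end

section \<open>Attainable classes contain strict configurations\<close>

context weighted_girg
begin

lemma AE_vertex_dist_neq:
  assumes uv: "u \<in> {1..n}" "v \<in> {1..n}" "u \<noteq> v"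
    and h: "case_prod h \<in> borel_measurable (borel \<Otimes>\<^sub>M borel)"
  shows "AE \<omega> in M. torus_dist (x u \<omega>) (x v \<omega>) \<noteq> h (w u \<omega>) (w v \<omega>)"
proof -
  let ?B = "borel \<Otimes>\<^sub>M borel :: (real \<times> (real ^ 'd)) measure"
  have sub: "{u} \<inter> {v} = {}" "{u} \<subseteq> {1..n}" "{v} \<subseteq> {1..n}" using uv by auto
  have "indep_var ?B ((\<lambda>f. f u) \<circ> (\<lambda>\<omega>. \<lambda>i\<in>{u}. coords \<omega> i)) ?B ((\<lambda>f. f v) \<circ> (\<lambda>\<omega>. \<lambda>i\<in>{v}. coords \<omega> i))"
    by (rule indep_var_compose[OF indep_var_restrict[OF indep_vertices sub]]) simp_all
  then have "indep_var ?B (\<lambda>\<omega>. coords \<omega> u) ?B (\<lambda>\<omega>. coords \<omega> v)" by (simp add: comp_def)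
  then have joint: "distr M ?B (\<lambda>\<omega>. coords \<omega> u) \<Otimes>\<^sub>M distr M ?B (\<lambda>\<omega>. coords \<omega> v)
      = distr M (?B \<Otimes>\<^sub>M ?B) (\<lambda>\<omega>. (coords \<omega> u, coords \<omega> v))"
    by (simp only: indep_var_distribution_eq)
  have "AE p in distr M (?B \<Otimes>\<^sub>M ?B) (\<lambda>\<omega>. (coords \<omega> u, coords \<omega> v)).
      torus_dist (snd (fst p)) (snd (snd p)) \<noteq> h (fst (fst p)) (fst (snd p))"
    using W.AE_torus_dist_neq_weights[OF h]
    by (simp only: joint[symmetric] vertex_law[OF uv(1)] vertex_law[OF uv(2)] vertex_measure_def)
  from AE_distrD[OF measurable_Pair[OF coords_measurable[OF uv(1)] coords_measurable[OF uv(2)]] this]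
  show ?thesis by (simp only: fst_conv snd_conv)
qed

text \<open>The event that a pair is connected although its probability is 0 has conditional
  probability 0, and similarly for probability 1.\<close>

lemma AE_edge_possible:
  assumes e: "e \<in> vertex_pairs n"
  shows "AE \<omega> in M. (e \<in> G \<omega> \<longrightarrow> pair_prob \<gamma> \<mu> n (coords \<omega>) e \<noteq> 0) \<and>
    (e \<notin> G \<omega> \<longrightarrow> pair_prob \<gamma> \<mu> n (coords \<omega>) e \<noteq> 1)"
proof -
  let ?p = "\<lambda>\<omega>. pair_prob \<gamma> \<mu> n (coords \<omega>) e"
  have cong: "pair_prob \<gamma> \<mu> n (\<lambda>i\<in>{1..n}. coords \<omega> i) e = ?p \<omega>" for \<omega>
    by (rule pair_prob_cong[OF e]) simp
  have X: "(\<lambda>\<omega>. \<lambda>i\<in>{1..n}. coords \<omega> i) \<in> M \<rightarrow>\<^sub>M config_space {1..n}"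
    using configuration_measurable[of "\<lambda>i. i"] by auto
  have p_meas: "?p \<in> borel_measurable M"
    using measurable_compose[OF X pair_prob_measurable[OF e, of \<gamma> \<mu> n]] by (simp only: cong)
  have null: "AE \<omega> in M. \<not> (?p \<omega> = c \<and> S \<subseteq> G \<omega> \<and> T \<inter> G \<omega> = {})"
    if ST: "S \<subseteq> vertex_pairs n" "T \<subseteq> vertex_pairs n" "S \<inter> T = {}"
      and zero: "\<And>\<omega>. ?p \<omega> = c \<Longrightarrow> (\<Prod>e\<in>S. pair_prob \<gamma> \<mu> n (coords \<omega>) e) * (\<Prod>e\<in>T. 1 - pair_prob \<gamma> \<mu> n (coords \<omega>) e) = 0"
    for S T c
  proof -
    define h where "h y = (of_bool (pair_prob \<gamma> \<mu> n y e = c) :: real)" for y :: "nat \<Rightarrow> real \<times> (real ^ 'd)"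
    have h_meas: "h \<in> borel_measurable (config_space {1..n})"
      unfolding h_def using pair_prob_measurable[OF e, of \<gamma> \<mu> n] by measurable
    have h_le: "\<bar>h y\<bar> \<le> 1" for y by (simp add: h_def)
    have h_eq: "h (\<lambda>i\<in>{1..n}. coords \<omega> i) = of_bool (?p \<omega> = c)" for \<omega>
      by (simp only: h_def cong)
    let ?f = "\<lambda>\<omega>. h (\<lambda>i\<in>{1..n}. coords \<omega> i) * of_bool (S \<subseteq> G \<omega> \<and> T \<inter> G \<omega> = {})"
    have "expectation ?f = expectation (\<lambda>\<omega>. h (\<lambda>i\<in>{1..n}. coords \<omega> i) *
        ((\<Prod>e\<in>S. pair_prob \<gamma> \<mu> n (coords \<omega>) e) * (\<Prod>e\<in>T. 1 - pair_prob \<gamma> \<mu> n (coords \<omega>) e)))"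
      by (rule expectation_edge_pattern[OF ST h_meas h_le])
    also have "\<dots> = expectation (\<lambda>_. 0)"
      unfolding h_eq using zero by (intro arg_cong[where f = expectation] ext) auto
    finally have "expectation ?f = 0" by simp
    moreover have "integrable M ?f"
    proof (rule integrable_const_bound[of _ 1])
      have "(\<lambda>\<omega>. of_bool (G \<omega> \<in> {F. S \<subseteq> F \<and> T \<inter> F = {}}) :: real) \<in> borel_measurable M"
        using edge_event_measurable by measurable
      then show "?f \<in> borel_measurable M"
        using measurable_compose[OF X h_meas] by (intro borel_measurable_times) simp_all
    qed (use h_le in \<open>auto simp: abs_mult\<close>)
    ultimately have "AE \<omega> in M. ?f \<omega> = 0"
      using integral_nonneg_eq_0_iff_AE[of M ?f] by (simp add: h_def)
    then show ?thesis unfolding h_eq by eventually_elim auto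
  qed
  have "AE \<omega> in M. \<not> (?p \<omega> = 0 \<and> {e} \<subseteq> G \<omega> \<and> {} \<inter> G \<omega> = {})"
    by (rule null) (use e in auto)
  moreover have "AE \<omega> in M. \<not> (?p \<omega> = 1 \<and> {} \<subseteq> G \<omega> \<and> {e} \<inter> G \<omega> = {})"
    by (rule null) (use e in auto)
  ultimately show ?thesis by eventually_elim auto
qed

text \<open>An event of positive probability contains a realization outside all null sets. Outside the
  null sets no distance is at an end of its window or produces the ratio 1, and no pair is in an
  impossible state, so that the copy which exists there satisfies the conditions on distances and ratios strictly.\<close>

lemma strict_tuple_of_positive_count:
  assumes E: "E \<subseteq> vertex_pairs k" and \<epsilon>: "0 < \<epsilon>" and \<gamma>: "1 < \<gamma>" and \<mu>: "0 < \<mu>"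
    and const: "\<And>i. i \<in> {1..k} \<Longrightarrow> fst p i = a" "\<And>e. e \<in> vertex_pairs k \<Longrightarrow> snd p e = b"
    and Pw: "AE t in \<nu>. Pw t"
    and pos: "0 < prob {\<omega> \<in> space M. 0 < class_count m k E n \<epsilon> p w x G \<omega>}"
  obtains y :: "nat \<Rightarrow> real \<times> (real ^ 'd)" where
    "\<And>i. i \<in> {1..k} \<Longrightarrow> fst (y i) \<in> scale_interval \<epsilon> n a \<and> Pw (fst (y i)) \<and> snd (y i) \<in> torus"
    "\<And>i j. i \<in> {1..k} \<Longrightarrow> j \<in> {1..k} \<Longrightarrow> i \<noteq> j \<Longrightarrow>
      \<epsilon> * real n powr b < torus_dist (snd (y i)) (snd (y j)) \<and>
      torus_dist (snd (y i)) (snd (y j)) < real n powr b / \<epsilon> \<and>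
      ratio_allows m \<gamma> ({i, j} \<in> E) (conn_ratio \<mu> n (y i) (y j))"
proof -
  let ?d = "CARD('d)"
  have AE_Pw: "AE \<omega> in M. \<forall>i\<in>{1..n}. Pw (w i \<omega>)"
  proof (intro AE_finite_allI)
    fix i assume i: "i \<in> {1..n}"
    obtain N where N2: "\<And>t. t \<in> space \<nu> - N \<Longrightarrow> Pw t" and N1: "N \<in> null_sets \<nu>"
      by (rule AE_E3[OF Pw]) (rule that; assumption)
    note N = N1 N2
    have Nb: "N \<in> sets borel" using N(1) by (auto dest: null_setsD2)
    have "emeasure (vertex_measure \<nu> :: (real \<times> (real ^ 'd)) measure) (N \<times> UNIV) = 0"
      using N(1) Nb by (subst W.emeasure_vertex_measure_Times) auto
    then have "N \<times> UNIV \<in> null_sets (vertex_measure \<nu> :: (real \<times> (real ^ 'd)) measure)"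
      using Nb by (auto simp: null_sets_def W.sets_vertex_measure)
    then have "AE p in vertex_measure \<nu> :: (real \<times> (real ^ 'd)) measure. Pw (fst p)"
    proof (rule AE_I')
      show "{p \<in> space (vertex_measure \<nu>). \<not> Pw (fst p)} \<subseteq> N \<times> (UNIV :: (real ^ 'd) set)"
        using N(2) by (fastforce simp: mem_Times_iff)
    qed
    then have "AE p in distr M (borel \<Otimes>\<^sub>M borel) (\<lambda>\<omega>. coords \<omega> i). Pw (fst p)"
      by (simp only: vertex_law[OF i] vertex_measure_def)
    from AE_distrD[OF coords_measurable[OF i] this] show "AE \<omega> in M. Pw (w i \<omega>)" by simp
  qed simp
  \<comment> \<open>The distance at which the ratio of two vertices equals 1.\<close>
  define hr where "hr t t' = (t * t' / (real n * \<mu>)) powr (1 / real ?d)" for t t' :: real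
  have "case_prod hr \<in> borel_measurable (borel \<Otimes>\<^sub>M borel)" unfolding hr_def by measurable
  then have AE_neq: "AE \<omega> in M. \<forall>uv\<in>{1..n} \<times> {1..n}. fst uv \<noteq> snd uv \<longrightarrow>
      torus_dist (x (fst uv) \<omega>) (x (snd uv) \<omega>) \<noteq> hr (w (fst uv) \<omega>) (w (snd uv) \<omega>) \<and>
      torus_dist (x (fst uv) \<omega>) (x (snd uv) \<omega>) \<noteq> \<epsilon> * real n powr b \<and>
      torus_dist (x (fst uv) \<omega>) (x (snd uv) \<omega>) \<noteq> real n powr b / \<epsilon>"
  proof (intro AE_finite_allI)
    fix uv assume uv: "uv \<in> {1..n} \<times> {1..n}"
    show "AE \<omega> in M. fst uv \<noteq> snd uv \<longrightarrow>
      torus_dist (x (fst uv) \<omega>) (x (snd uv) \<omega>) \<noteq> hr (w (fst uv) \<omega>) (w (snd uv) \<omega>) \<and>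
      torus_dist (x (fst uv) \<omega>) (x (snd uv) \<omega>) \<noteq> \<epsilon> * real n powr b \<and>
      torus_dist (x (fst uv) \<omega>) (x (snd uv) \<omega>) \<noteq> real n powr b / \<epsilon>"
    proof (cases "fst uv = snd uv")
      case False
      have "fst uv \<in> {1..n}" "snd uv \<in> {1..n}" using uv by auto
      note neq = AE_vertex_dist_neq[OF this False]
      have "AE \<omega> in M. torus_dist (x (fst uv) \<omega>) (x (snd uv) \<omega>) \<noteq> hr (w (fst uv) \<omega>) (w (snd uv) \<omega>)"
        by (rule neq) fact
      moreover have "AE \<omega> in M. torus_dist (x (fst uv) \<omega>) (x (snd uv) \<omega>) \<noteq> \<epsilon> * real n powr b"
        by (rule neq) simp
      moreover have "AE \<omega> in M. torus_dist (x (fst uv) \<omega>) (x (snd uv) \<omega>) \<noteq> real n powr b / \<epsilon>"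
        by (rule neq) simp
      ultimately show ?thesis by eventually_elim simp
    qed simp
  qed simp
  have AE_edges: "AE \<omega> in M. \<forall>e\<in>vertex_pairs n. (e \<in> G \<omega> \<longrightarrow> pair_prob \<gamma> \<mu> n (coords \<omega>) e \<noteq> 0) \<and>
      (e \<notin> G \<omega> \<longrightarrow> pair_prob \<gamma> \<mu> n (coords \<omega>) e \<noteq> 1)"
    by (intro AE_finite_allI AE_edge_possible) auto
  define good where "good \<omega> \<longleftrightarrow> (\<forall>i\<in>{1..n}. Pw (w i \<omega>)) \<and> (\<forall>i\<in>{1..n}. x i \<omega> \<in> torus) \<and>
    (\<forall>uv\<in>{1..n} \<times> {1..n}. fst uv \<noteq> snd uv \<longrightarrow>
      torus_dist (x (fst uv) \<omega>) (x (snd uv) \<omega>) \<noteq> hr (w (fst uv) \<omega>) (w (snd uv) \<omega>) \<and>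
      torus_dist (x (fst uv) \<omega>) (x (snd uv) \<omega>) \<noteq> \<epsilon> * real n powr b \<and>
      torus_dist (x (fst uv) \<omega>) (x (snd uv) \<omega>) \<noteq> real n powr b / \<epsilon>) \<and>
    (\<forall>e\<in>vertex_pairs n. (e \<in> G \<omega> \<longrightarrow> pair_prob \<gamma> \<mu> n (coords \<omega>) e \<noteq> 0) \<and>
      (e \<notin> G \<omega> \<longrightarrow> pair_prob \<gamma> \<mu> n (coords \<omega>) e \<noteq> 1))" for \<omega>
  have "AE \<omega> in M. good \<omega>"
    using AE_Pw AE_in_torus AE_neq AE_edges unfolding good_def by eventually_elim blast
  moreover have "\<not> (AE \<omega> in M. \<not> 0 < class_count m k E n \<epsilon> p w x G \<omega>)"
  proof
    assume "AE \<omega> in M. \<not> 0 < class_count m k E n \<epsilon> p w x G \<omega>"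
    then have "prob {\<omega> \<in> space M. 0 < class_count m k E n \<epsilon> p w x G \<omega>} = 0"
      by (subst prob_eq_0) auto
    with pos show False by simp
  qed
  ultimately obtain \<omega> where \<omega>: "\<omega> \<in> space M" "good \<omega>" "0 < class_count m k E n \<epsilon> p w x G \<omega>"
    by (metis (mono_tags, lifting) AE_I2 AE_mp)
  then obtain v where v: "v \<in> vertex_tuples k n" "\<omega> \<in> appears m k E \<epsilon> p v"
    unfolding class_count_eq_sum[OF \<omega>(1)]
    by (metis (mono_tags, lifting) indicator_simps(2) less_irrefl sum.neutral)
  have vn: "v i \<in> {1..n}" if "i \<in> {1..k}" for i using vertex_tuplesD(1)[OF v(1)] that by auto
  have vne: "v i \<noteq> v j" if "i \<in> {1..k}" "j \<in> {1..k}" "i \<noteq> j" for i j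
    using inj_onD[OF vertex_tuplesD(2)[OF v(1)], of i j] that by auto
  have reg: "(\<lambda>i. coords \<omega> (v i)) \<in> class_region k n \<epsilon> p" and occ: "occurs m k E (G \<omega>) v"
    using v(2) by (auto simp: appears_def)
  define y where "y i = coords \<omega> (v i)" for i
  show thesis
  proof
    fix i assume i: "i \<in> {1..k}"
    show "fst (y i) \<in> scale_interval \<epsilon> n a \<and> Pw (fst (y i)) \<and> snd (y i) \<in> torus"
      using reg const(1)[OF i] i \<omega>(2) vn[OF i] by (auto simp: y_def class_region_def good_def)
    fix j assume j: "j \<in> {1..k}" and ij: "i \<noteq> j"
    let ?r = "torus_dist (snd (y i)) (snd (y j))"
    have r_in: "?r \<in> scale_interval \<epsilon> n b"
      using reg i j ij const(2)[OF doubleton_in_vertex_pairs[OF i j ij]]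
      unfolding class_region_def y_def by auto
    have w_in: "fst (y i) \<in> scale_interval \<epsilon> n a" "fst (y j) \<in> scale_interval \<epsilon> n a"
      using reg const(1) i j by (auto simp: y_def class_region_def)
    have "(v i, v j) \<in> {1..n} \<times> {1..n}" using vn i j by simp
    then have neq: "?r \<noteq> hr (fst (y i)) (fst (y j))" "?r \<noteq> \<epsilon> * real n powr b" "?r \<noteq> real n powr b / \<epsilon>"
      using \<omega>(2) vne[OF i j ij] unfolding good_def y_def by auto
    have n0: "1 \<le> n" "0 < real n" using n_pos by auto
    note bounds = conn_ratio_bounds[OF n0(1) \<mu> \<epsilon> w_in r_in]
    let ?q = "conn_ratio \<mu> n (y i) (y j)"
    have "0 < \<epsilon> ^ (2 + ?d) / \<mu> * real n powr (a + a - real ?d * b - 1)"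
      using \<epsilon> \<mu> n0 by simp
    then have q0: "0 < ?q" using bounds(2) by linarith
    have q1: "?q \<noteq> 1"
    proof
      assume "?q = 1"
      then have "?r ^ ?d = fst (y i) * fst (y j) / (real n * \<mu>)"
        using bounds(1) n0 \<mu> by (simp add: conn_ratio_def field_simps)
      then have "hr (fst (y i)) (fst (y j)) = (?r ^ ?d) powr (1 / real ?d)" by (simp add: hr_def)
      also have "\<dots> = ?r" using bounds(1) by (simp add: powr_realpow[symmetric] powr_powr)
      finally show False using neq(1) by simp
    qed
    have pp: "pair_prob \<gamma> \<mu> n (coords \<omega>) {v i, v j} = edge_prob \<gamma> ?q"
      unfolding pair_prob_doubleton[OF vne[OF i j ij]] y_def
      using bounds(1) by (intro connection_prob_eq_edge_prob[OF n0(1) \<mu>]) (simp add: y_def)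
    have vp: "{v i, v j} \<in> vertex_pairs n" using vn vne i j ij by (intro doubleton_in_vertex_pairs) auto
    have poss: "{v i, v j} \<in> G \<omega> \<Longrightarrow> edge_prob \<gamma> ?q \<noteq> 0" "{v i, v j} \<notin> G \<omega> \<Longrightarrow> edge_prob \<gamma> ?q \<noteq> 1"
      using \<omega>(2) vp pp unfolding good_def by auto
    have occ_ij: "case m of Ind \<Rightarrow> {v i, v j} \<in> G \<omega> \<longleftrightarrow> {i, j} \<in> E
        | Sub \<Rightarrow> {i, j} \<in> E \<longrightarrow> {v i, v j} \<in> G \<omega>"
      using occ i j ij unfolding occurs_def by blast
    have "ratio_allows m \<gamma> ({i, j} \<in> E) ?q"
      unfolding ratio_allows_def
    proof (intro conjI impI q0)
      assume "{i, j} \<in> E" "\<gamma> = \<infinity>"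
      then have "{v i, v j} \<in> G \<omega>" using occ_ij by (cases m) simp_all
      from poss(1)[OF this] \<open>\<gamma> = \<infinity>\<close> show "1 < ?q" by (simp add: edge_prob_def split: if_splits)
    next
      assume "{i, j} \<notin> E" "m = Ind"
      then have "{v i, v j} \<notin> G \<omega>" using occ_ij by simp
      from poss(2)[OF this] have "\<not> 1 < ?q"
      proof (rule contrapos_nn)
        assume "1 < ?q"
        then have "1 \<le> ?q powr real_of_ereal \<gamma>"
          using \<gamma> by (intro ge_one_powr_ge_zero) (cases \<gamma>; auto)+
        with \<open>1 < ?q\<close> show "edge_prob \<gamma> ?q = 1" by (simp add: edge_prob_def)
      qed
      with q1 show "?q < 1" by linarith
    qed
    with r_in neq(2,3) show "\<epsilon> * real n powr b < ?r \<and> ?r < real n powr b / \<epsilon> \<and>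
        ratio_allows m \<gamma> ({i, j} \<in> E) ?q"
      by (auto simp: scale_interval_def)
  qed
qed

lemma strict_configuration_torus:
  assumes E: "E \<subseteq> vertex_pairs k" and \<epsilon>: "0 < \<epsilon>" and \<gamma>: "1 < \<gamma>" and \<mu>: "0 < \<mu>"
    and const: "\<And>i. i \<in> {1..k} \<Longrightarrow> fst p i = 1 / 2" "\<And>e. e \<in> vertex_pairs k \<Longrightarrow> snd p e = 0"
    and pos: "0 < prob {\<omega> \<in> space M. 0 < class_count m k E n \<epsilon> p w x G \<omega>}"
  obtains y :: "nat \<Rightarrow> real \<times> (real ^ 'd)" where
    "strict_configuration torus_dist m k E \<gamma> \<mu> \<epsilon> y"
    "\<And>i. i \<in> {1..k} \<Longrightarrow> fst (y i) \<in> {\<epsilon>..1 / \<epsilon>} \<and> snd (y i) \<in> torus"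
proof -
  obtain y :: "nat \<Rightarrow> real \<times> (real ^ 'd)" where y:
    "\<And>i. i \<in> {1..k} \<Longrightarrow> fst (y i) \<in> scale_interval \<epsilon> n (1 / 2) \<and> True \<and> snd (y i) \<in> torus"
    "\<And>i j. i \<in> {1..k} \<Longrightarrow> j \<in> {1..k} \<Longrightarrow> i \<noteq> j \<Longrightarrow>
      \<epsilon> * real n powr 0 < torus_dist (snd (y i)) (snd (y j)) \<and>
      torus_dist (snd (y i)) (snd (y j)) < real n powr 0 / \<epsilon> \<and>
      ratio_allows m \<gamma> ({i, j} \<in> E) (conn_ratio \<mu> n (y i) (y j))"
    using strict_tuple_of_positive_count[OF E \<epsilon> \<gamma> \<mu> const _ pos, of "\<lambda>_. True"] by auto
  have n0: "0 < real n" using n_pos by simp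
  define z where "z i = (fst (y i) / real n powr (1 / 2), snd (y i))" for i
  have "pair_ratio torus_dist \<mu> (z i) (z j) = conn_ratio \<mu> n (y i) (y j)" for i j
    using n0 by (simp add: pair_ratio_def conn_ratio_def z_def powr_half_sqrt mult_ac)
  then have "strict_configuration torus_dist m k E \<gamma> \<mu> \<epsilon> z"
    using y(2) n0 by (simp add: strict_configuration_def z_def)
  moreover have "fst (z i) \<in> {\<epsilon>..1 / \<epsilon>} \<and> snd (z i) \<in> torus" if "i \<in> {1..k}" for i
    using y(1)[OF that] n0 by (auto simp: z_def scale_interval_def field_simps)
  ultimately show thesis by (rule that)
qed

text \<open>As soon as \<open>n^(-1/d)\<close> is small against \<open>\<epsilon>\<close>, the tuple lies in a small part of the torus and can
  be unrolled to \<open>\<real>^d\<close> around its first vertex. Configurations that wrap around the torus can exist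
  for small n only.\<close>

lemma strict_configuration_space:
  assumes E: "E \<subseteq> vertex_pairs k" and k: "1 \<le> k" and \<epsilon>: "0 < \<epsilon>" and \<gamma>: "1 < \<gamma>" and \<mu>: "0 < \<mu>"
    and const: "\<And>i. i \<in> {1..k} \<Longrightarrow> fst p i = 0" "\<And>e. e \<in> vertex_pairs k \<Longrightarrow> snd p e = - 1 / real CARD('d)"
    and Pw: "AE t in \<nu>. t \<in> {\<epsilon>..1 / \<epsilon>} \<longrightarrow> Pw t"
    and large: "real n powr (- 1 / real CARD('d)) / \<epsilon> < 1 / 4"
    and pos: "0 < prob {\<omega> \<in> space M. 0 < class_count m k E n \<epsilon> p w x G \<omega>}"
  obtains y :: "nat \<Rightarrow> real \<times> (real ^ 'd)" where
    "strict_configuration sup_dist m k E \<gamma> \<mu> \<epsilon> y"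
    "\<And>i. i \<in> {1..k} \<Longrightarrow> Pw (fst (y i))"
proof -
  let ?d = "CARD('d)"
  let ?s = "real n powr (- 1 / real ?d)"
  have n0: "0 < real n" and s0: "0 < ?s" using n_pos by auto
  obtain y :: "nat \<Rightarrow> real \<times> (real ^ 'd)" where y:
    "\<And>i. i \<in> {1..k} \<Longrightarrow> fst (y i) \<in> scale_interval \<epsilon> n 0 \<and> (fst (y i) \<in> {\<epsilon>..1 / \<epsilon>} \<longrightarrow> Pw (fst (y i))) \<and> snd (y i) \<in> torus"
    "\<And>i j. i \<in> {1..k} \<Longrightarrow> j \<in> {1..k} \<Longrightarrow> i \<noteq> j \<Longrightarrow>
      \<epsilon> * ?s < torus_dist (snd (y i)) (snd (y j)) \<and>
      torus_dist (snd (y i)) (snd (y j)) < ?s / \<epsilon> \<and>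
      ratio_allows m \<gamma> ({i, j} \<in> E) (conn_ratio \<mu> n (y i) (y j))"
    using strict_tuple_of_positive_count[OF E \<epsilon> \<gamma> \<mu> const Pw pos] by blast
  have one: "1 \<in> {1..k}" using k by simp
  have "\<forall>i\<in>{1..k}. \<exists>u :: real ^ 'd. (\<forall>l. (snd (y i) $ l - snd (y 1) $ l) - u $ l \<in> \<int>) \<and> (\<forall>l. \<bar>u $ l\<bar> < 1 / 4)"
  proof
    fix i assume i: "i \<in> {1..k}"
    show "\<exists>u :: real ^ 'd. (\<forall>l. (snd (y i) $ l - snd (y 1) $ l) - u $ l \<in> \<int>) \<and> (\<forall>l. \<bar>u $ l\<bar> < 1 / 4)"
    proof (cases "i = 1")
      case True
      then show ?thesis by (intro exI[of _ 0]) simp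
    next
      case False
      let ?t = "\<lambda>l. snd (y i) $ l - snd (y 1) $ l"
      have small: "min \<bar>?t l\<bar> (1 - \<bar>?t l\<bar>) < 1 / 4" for l
      proof -
        have "min \<bar>?t l\<bar> (1 - \<bar>?t l\<bar>) \<le> torus_dist (snd (y i)) (snd (y 1))"
          unfolding torus_dist_def by (intro Max_ge) auto
        then show ?thesis using y(2)[OF i one False] large by linarith
      qed
      have "\<exists>c\<in>\<int>. \<bar>?t l - c\<bar> < 1 / 4" for l
      proof -
        have t1: "\<bar>?t l\<bar> < 1"
        proof -
          have "0 \<le> snd (y i) $ l" "snd (y i) $ l < 1" "0 \<le> snd (y 1) $ l" "snd (y 1) $ l < 1"
            using y(1)[OF i] y(1)[OF one] by (auto simp: torus_def)
          then show ?thesis by linarith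
        qed
        have "\<bar>?t l - 0\<bar> < 1 / 4 \<or> \<bar>?t l - 1\<bar> < 1 / 4 \<or> \<bar>?t l - (-1)\<bar> < 1 / 4"
          using small[of l] t1 by linarith
        moreover have "(0 :: real) \<in> \<int>" "(1 :: real) \<in> \<int>" "(-1 :: real) \<in> \<int>" by auto
        ultimately show ?thesis by blast
      qed
      then obtain c where c: "\<And>l. c l \<in> \<int>" "\<And>l. \<bar>?t l - c l\<bar> < 1 / 4" by metis
      then show ?thesis by (intro exI[of _ "\<chi> l. ?t l - c l"]) simp
    qed
  qed
  from bchoice[OF this] obtain u :: "nat \<Rightarrow> real ^ 'd" where
    u: "\<forall>i\<in>{1..k}. (\<forall>l. (snd (y i) $ l - snd (y 1) $ l) - u i $ l \<in> \<int>) \<and> (\<forall>l. \<bar>u i $ l\<bar> < 1 / 4)" ..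
  define z where "z i = (fst (y i), (\<chi> l. u i $ l / ?s))" for i
  have dist: "torus_dist (snd (y i)) (snd (y j)) = ?s * sup_dist (snd (z i)) (snd (z j))"
    if ij: "i \<in> {1..k}" "j \<in> {1..k}" for i j
  proof -
    have "torus_dist (snd (y i)) (snd (y j)) = sup_dist (u i) (u j)"
    proof (rule torus_dist_eq_sup_dist_of_congruent)
      show "snd (y i) \<in> torus" "snd (y j) \<in> torus" using y(1) ij by auto
      fix l
      have "((snd (y i) $ l - snd (y 1) $ l) - u i $ l) - ((snd (y j) $ l - snd (y 1) $ l) - u j $ l) \<in> \<int>"
        by (rule Ints_diff) (use u ij in blast)+
      then show "(snd (y i) $ l - snd (y j) $ l) - (u i $ l - u j $ l) \<in> \<int>" by (simp add: algebra_simps)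
      have "\<bar>u i $ l\<bar> < 1 / 4" "\<bar>u j $ l\<bar> < 1 / 4" using u ij by auto
      then show "\<bar>u i $ l - u j $ l\<bar> < 1 / 2" by linarith
    qed
    also have "\<dots> = ?s * sup_dist (snd (z i)) (snd (z j))"
      using s0 by (intro sup_dist_scaled) (auto simp: z_def diff_divide_distrib[symmetric] abs_divide)
    finally show ?thesis .
  qed
  have sd: "real n * ?s ^ ?d = 1"
  proof -
    have "?s ^ ?d = real n powr (-1)" using n0 by (simp add: powr_power)
    then show ?thesis using n0 by (simp add: powr_minus)
  qed
  have ratio: "pair_ratio sup_dist \<mu> (z i) (z j) = conn_ratio \<mu> n (y i) (y j)"
    if ij: "i \<in> {1..k}" "j \<in> {1..k}" for i j
  proof -
    have "conn_ratio \<mu> n (y i) (y j) = fst (y i) * fst (y j) /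
        ((real n * ?s ^ ?d) * (\<mu> * sup_dist (snd (z i)) (snd (z j)) ^ ?d))"
      unfolding conn_ratio_def dist[OF ij] power_mult_distrib by (simp only: mult_ac)
    then show ?thesis unfolding sd by (simp add: pair_ratio_def z_def)
  qed
  have "strict_configuration sup_dist m k E \<gamma> \<mu> \<epsilon> z"
    unfolding strict_configuration_def
  proof (intro ballI impI)
    fix i j assume ij: "i \<in> {1..k}" "j \<in> {1..k}" "i \<noteq> j"
    let ?D = "sup_dist (snd (z i)) (snd (z j))"
    have "\<epsilon> * ?s < ?s * ?D" "?s * ?D < ?s / \<epsilon>" "ratio_allows m \<gamma> ({i, j} \<in> E) (pair_ratio sup_dist \<mu> (z i) (z j))"
      using y(2)[OF ij] unfolding dist[OF ij(1,2)] ratio[OF ij(1,2)] by auto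
    moreover from this have "?s * \<epsilon> < ?s * ?D" "?s * ?D < ?s * (1 / \<epsilon>)" by (simp_all add: mult.commute)
    ultimately show "\<epsilon> < ?D \<and> ?D < 1 / \<epsilon> \<and> ratio_allows m \<gamma> ({i, j} \<in> E) (pair_ratio sup_dist \<mu> (z i) (z j))"
      using s0 by (simp only: mult_less_cancel_left_pos)
  qed
  moreover have "Pw (fst (z i))" if "i \<in> {1..k}" for i
    using y(1)[OF that] n0 by (auto simp: z_def scale_interval_def)
  ultimately show thesis by (rule that)
qed

end

section \<open>Existence of strict configurations\<close>


lemma torus_dist_diagonal:
  "torus_dist ((\<chi> _. s) :: real ^ 'd) (\<chi> _. t) = min \<bar>s - t\<bar> (1 - \<bar>s - t\<bar>)"
  by (simp add: torus_dist_def)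

lemma sup_dist_diagonal: "sup_dist ((\<chi> _. s) :: real ^ 'd) (\<chi> _. t) = \<bar>s - t\<bar>"
  by (simp add: sup_dist_def)

text \<open>Subgraph counts are served by making every ratio exceed 1, induced counts with finite \<open>\<gamma>\<close> by
  making every ratio smaller than 1. Weights that are equal and positions on a diagonal allow both.\<close>

lemma ratio_allows_of_gt_1: "m = Sub \<Longrightarrow> 1 < q \<Longrightarrow> ratio_allows m \<gamma> required q"
  by (simp add: ratio_allows_def)

lemma ratio_allows_of_lt_1: "\<gamma> < \<infinity> \<Longrightarrow> 0 < q \<Longrightarrow> q < 1 \<Longrightarrow> ratio_allows m \<gamma> required q"
  by (auto simp: ratio_allows_def)

lemma exists_strict_configuration_torus:
  assumes \<mu>: "1 \<le> \<mu>" and easy: "m = Sub \<or> \<gamma> < \<infinity>"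
  obtains \<epsilon>0 and y :: "nat \<Rightarrow> real \<times> (real ^ 'd)" where "0 < \<epsilon>0" "\<epsilon>0 < 1"
    "\<And>\<epsilon>. 0 < \<epsilon> \<Longrightarrow> \<epsilon> < \<epsilon>0 \<Longrightarrow> strict_configuration torus_dist m k E \<gamma> \<mu> \<epsilon> y \<and>
      (\<forall>i\<in>{1..k}. fst (y i) \<in> {\<epsilon>..1 / \<epsilon>} \<and> snd (y i) \<in> torus)"
proof -
  let ?d = "CARD('d)"
  \<comment> \<open>The points \<open>i \<rho>\<close> with \<open>1 \<le> i \<le> k\<close> are at distance at least \<open>\<rho>\<close>, also across the
    boundary of the unit cube.\<close>
  define \<rho> where "\<rho> = 1 / (real k + 2)"
  have \<rho>: "0 < \<rho>" "\<rho> \<le> 1 / 2" by (simp_all add: \<rho>_def field_simps)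
  \<comment> \<open>Distances are between \<open>\<rho>\<close> and 1/2: the first choice makes all ratios larger than 1, the
    second makes them smaller than 1.\<close>
  define t where "t = (if m = Sub then \<mu> + 1 else \<rho> ^ ?d)"
  have t0: "0 < t" using \<mu> \<rho> by (simp add: t_def)
  define y :: "nat \<Rightarrow> real \<times> (real ^ 'd)" where "y i = (t, \<chi> _. real i * \<rho>)" for i
  define \<epsilon>0 where "\<epsilon>0 = Min {\<rho>, t, 1 / t}"
  have \<epsilon>0: "0 < \<epsilon>0" "\<epsilon>0 \<le> \<rho>" "\<epsilon>0 \<le> t" "\<epsilon>0 \<le> 1 / t" using \<rho> t0 by (auto simp: \<epsilon>0_def)
  show thesis
  proof
    show "0 < \<epsilon>0" by fact
    show "\<epsilon>0 < 1" using \<epsilon>0(2) \<rho>(2) by linarith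
    fix \<epsilon> :: real assume \<epsilon>: "0 < \<epsilon>" "\<epsilon> < \<epsilon>0"
    have in_torus: "snd (y i) \<in> torus" if "i \<in> {1..k}" for i
    proof -
      have "real i < real k + 2" using that by simp
      then have "real i * \<rho> < 1" by (simp add: \<rho>_def)
      then show ?thesis using \<rho>(1) by (simp add: torus_def y_def)
    qed
    have "strict_configuration torus_dist m k E \<gamma> \<mu> \<epsilon> y"
      unfolding strict_configuration_def
    proof (intro ballI impI)
      fix i j assume ij: "i \<in> {1..k}" "j \<in> {1..k}" "i \<noteq> j"
      let ?r = "torus_dist (snd (y i)) (snd (y j))"
      have r: "\<rho> \<le> ?r"
      proof -
        have abs: "\<bar>real i * \<rho> - real j * \<rho>\<bar> = \<bar>real i - real j\<bar> * \<rho>"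
          using \<rho>(1) by (simp add: left_diff_distrib[symmetric] abs_mult)
        have "1 \<le> \<bar>real i - real j\<bar>" "\<bar>real i - real j\<bar> \<le> real k + 1" using ij by auto
        then have "1 * \<rho> \<le> \<bar>real i - real j\<bar> * \<rho>" "\<bar>real i - real j\<bar> * \<rho> \<le> (real k + 1) * \<rho>"
          using \<rho>(1) by (auto intro!: mult_right_mono)
        moreover have "(real k + 1) * \<rho> = 1 - \<rho>" by (simp add: \<rho>_def field_simps)
        ultimately show ?thesis by (simp add: y_def torus_dist_diagonal abs)
      qed
      have r1: "?r \<le> 1 / 2" by (rule torus_dist_le_half)
      have rd: "\<rho> ^ ?d \<le> ?r ^ ?d" "?r ^ ?d \<le> 1"
        using r r1 \<rho>(1) by (auto intro: power_mono power_le_one)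
      have rd0: "0 < \<rho> ^ ?d" using \<rho>(1) by simp
      have q: "pair_ratio torus_dist \<mu> (y i) (y j) = t * t / (\<mu> * ?r ^ ?d)"
        by (simp add: pair_ratio_def y_def)
      have den: "0 < \<mu> * ?r ^ ?d" using \<mu> rd rd0 by (intro mult_pos_pos) linarith+
      have "ratio_allows m \<gamma> ({i, j} \<in> E) (pair_ratio torus_dist \<mu> (y i) (y j))"
      proof (cases "m = Sub")
        case True
        have "\<mu> * ?r ^ ?d \<le> \<mu> * 1" using \<mu> rd by (intro mult_left_mono) auto
        also have "\<dots> < t * t" using \<mu> True by (simp add: t_def algebra_simps) (smt (verit) mult_nonneg_nonneg)
        finally show ?thesis unfolding q using den
          by (intro ratio_allows_of_gt_1[OF True]) (simp add: less_divide_eq)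
      next
        case False
        have "\<rho> ^ ?d < 1" using \<rho> by (simp add: power_less_one_iff)
        then have "t * t < 1 * \<rho> ^ ?d" using False rd0 by (simp add: t_def)
        also have "\<dots> \<le> \<mu> * ?r ^ ?d" using \<mu> rd rd0 by (intro mult_mono) auto
        finally show ?thesis unfolding q using den t0 easy False
          by (intro ratio_allows_of_lt_1) (auto simp: divide_less_eq)
      qed
      moreover have "\<epsilon> < ?r" using r \<epsilon>(2) \<epsilon>0(2) by linarith
      moreover have "?r < 1 / \<epsilon>"
      proof -
        have "\<epsilon> < 1" using \<epsilon>(2) \<epsilon>0(2) \<rho>(2) by linarith
        then have "1 < 1 / \<epsilon>" using \<epsilon>(1) by (simp add: less_divide_eq)
        with r1 show ?thesis by linarith
      qed
      ultimately show "\<epsilon> < ?r \<and> ?r < 1 / \<epsilon> \<and>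
          ratio_allows m \<gamma> ({i, j} \<in> E) (pair_ratio torus_dist \<mu> (y i) (y j))" by blast
    qed
    moreover have "t \<in> {\<epsilon>..1 / \<epsilon>}"
    proof -
      have "\<epsilon> \<le> t" "\<epsilon> \<le> 1 / t" using \<epsilon>(2) \<epsilon>0(3,4) by linarith+
      then show ?thesis using \<epsilon>(1) t0 by (simp add: field_simps)
    qed
    ultimately show "strict_configuration torus_dist m k E \<gamma> \<mu> \<epsilon> y \<and>
      (\<forall>i\<in>{1..k}. fst (y i) \<in> {\<epsilon>..1 / \<epsilon>} \<and> snd (y i) \<in> torus)"
      using in_torus by (simp add: y_def)
  qed
qed

lemma exists_strict_configuration_space:
  fixes t :: real
  assumes \<mu>: "1 \<le> \<mu>" and easy: "m = Sub \<or> \<gamma> < \<infinity>" and t: "1 \<le> t"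
  obtains \<epsilon>0 and y :: "nat \<Rightarrow> real \<times> (real ^ 'd)" where "0 < \<epsilon>0" "\<epsilon>0 < 1"
    "\<And>\<epsilon>. 0 < \<epsilon> \<Longrightarrow> \<epsilon> < \<epsilon>0 \<Longrightarrow> strict_configuration sup_dist m k E \<gamma> \<mu> \<epsilon> y"
    "\<And>i. fst (y i) = t"
proof -
  let ?d = "CARD('d)"
  have d1: "1 \<le> ?d" by (simp add: Suc_leI)
  \<comment> \<open>Here the weight is given, and the distances, which are between h and \<open>(k + 1) h\<close>, are
    adapted: small ones for large ratios, large ones for small ratios.\<close>
  define h where "h = (if m = Sub then 1 / ((real k + 1) * (\<mu> + 1)) else t * t + 1)"
  have h0: "0 < h" using \<mu> t by (auto simp: h_def intro: add_nonneg_pos)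
  define y :: "nat \<Rightarrow> real \<times> (real ^ 'd)" where "y i = (t, \<chi> _. real i * h)" for i
  define \<epsilon>0 where "\<epsilon>0 = Min {1 / 2, h, 1 / ((real k + 1) * h)}"
  have kh: "0 < (real k + 1) * h" using h0 by simp
  have \<epsilon>0: "0 < \<epsilon>0" "\<epsilon>0 \<le> 1 / 2" "\<epsilon>0 \<le> h" "\<epsilon>0 \<le> 1 / ((real k + 1) * h)"
    using h0 kh by (auto simp: \<epsilon>0_def)
  show thesis
  proof
    show "0 < \<epsilon>0" by fact
    show "\<epsilon>0 < 1" using \<epsilon>0(2) by linarith
    show "fst (y i) = t" for i by (simp add: y_def)
    fix \<epsilon> :: real assume \<epsilon>: "0 < \<epsilon>" "\<epsilon> < \<epsilon>0"
    show "strict_configuration sup_dist m k E \<gamma> \<mu> \<epsilon> y"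
      unfolding strict_configuration_def
    proof (intro ballI impI)
      fix i j assume ij: "i \<in> {1..k}" "j \<in> {1..k}" "i \<noteq> j"
      let ?r = "sup_dist (snd (y i)) (snd (y j))"
      have "?r = \<bar>real i - real j\<bar> * h"
        using h0 by (simp add: y_def sup_dist_diagonal left_diff_distrib[symmetric] abs_mult)
      moreover have "1 \<le> \<bar>real i - real j\<bar>" "\<bar>real i - real j\<bar> \<le> real k + 1" using ij by auto
      then have "1 * h \<le> \<bar>real i - real j\<bar> * h" "\<bar>real i - real j\<bar> * h \<le> (real k + 1) * h"
        using h0 by (auto intro!: mult_right_mono)
      ultimately have r: "h \<le> ?r" "?r \<le> (real k + 1) * h" by simp_all
      have r0: "0 < ?r" using r(1) h0 by linarith
      have q: "pair_ratio sup_dist \<mu> (y i) (y j) = t * t / (\<mu> * ?r ^ ?d)"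
        by (simp add: pair_ratio_def y_def)
      have den: "0 < \<mu> * ?r ^ ?d" using \<mu> r0 by simp
      have tt: "1 \<le> t * t" using t mult_mono[of 1 t 1 t] by simp
      have "ratio_allows m \<gamma> ({i, j} \<in> E) (pair_ratio sup_dist \<mu> (y i) (y j))"
      proof (cases "m = Sub")
        case True
        have "(real k + 1) * h = 1 / (\<mu> + 1)" using True by (simp add: h_def)
        then have r1: "?r \<le> 1 / (\<mu> + 1)" using r(2) by simp
        also have "1 / (\<mu> + 1) \<le> 1" using \<mu> by simp
        finally have "?r ^ ?d \<le> ?r ^ 1" using r0 d1 by (intro power_decreasing) auto
        then have "\<mu> * ?r ^ ?d \<le> \<mu> * (1 / (\<mu> + 1))" using r1 \<mu> by (intro mult_left_mono) auto
        also have "\<dots> < 1" using \<mu> by simp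
        finally show ?thesis unfolding q using den tt
          by (intro ratio_allows_of_gt_1[OF True]) (simp add: less_divide_eq)
      next
        case False
        then have h1: "h = t * t + 1" by (simp add: h_def)
        then have "1 \<le> ?r" using r(1) tt by linarith
        then have "?r ^ 1 \<le> ?r ^ ?d" using d1 by (intro power_increasing) auto
        moreover have "1 * ?r ^ ?d \<le> \<mu> * ?r ^ ?d" using \<mu> r0 by (intro mult_right_mono) auto
        ultimately have "t * t < \<mu> * ?r ^ ?d" using r(1) h1 by simp
        then show ?thesis unfolding q using den tt easy False
          by (intro ratio_allows_of_lt_1) (auto simp: divide_less_eq intro!: divide_pos_pos)
      qed
      moreover have "\<epsilon> < ?r" using r \<epsilon>(2) \<epsilon>0(3) by linarith
      moreover have "?r < 1 / \<epsilon>"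
      proof -
        have "\<epsilon> < 1 / ((real k + 1) * h)" using \<epsilon>(2) \<epsilon>0(4) by linarith
        then have "(real k + 1) * h < 1 / \<epsilon>" using \<epsilon>(1) kh by (simp add: field_simps)
        with r(2) show ?thesis by linarith
      qed
      ultimately show "\<epsilon> < ?r \<and> ?r < 1 / \<epsilon> \<and>
          ratio_allows m \<gamma> ({i, j} \<in> E) (pair_ratio sup_dist \<mu> (y i) (y j))" by blast
    qed
  qed
qed

context power_law
begin

lemma exists_support_point:
  obtains t \<epsilon>1 where "0 < \<epsilon>1" "\<epsilon>1 < 1" "1 \<le> t" "\<And>\<epsilon>. 0 < \<epsilon> \<Longrightarrow> \<epsilon> < \<epsilon>1 \<Longrightarrow> t \<in> weight_cluster 0 \<epsilon>"
proof -
  \<comment> \<open>Windows that exhaust the half-line of positive weights, so that one of them has mass.\<close>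
  define J where "J N = {1 / (real N + 2)..1 / (1 / (real N + 2))}" for N :: nat
  have "\<exists>N. 0 < prob (J N)"
  proof (rule ccontr)
    assume "\<not> ?thesis"
    then have "prob (J N) = 0" for N using measure_nonneg[of \<nu> "J N"] by (metis not_less order_antisym)
    then have "(\<Union>N. J N) \<in> null_sets \<nu>"
      by (intro null_sets_UN) (auto simp: null_sets_def emeasure_eq_measure J_def)
    then have "AE t in \<nu>. t \<notin> (\<Union>N. J N)" by (rule AE_not_in)
    then have "AE t in \<nu>. False"
      using weights_ge_1
    proof eventually_elim
      case (elim t)
      obtain N :: nat where "t \<le> real N" using real_arch_simple by blast
      moreover have "1 / (real N + 2) \<le> 1" by simp
      with elim(2) have "1 / (real N + 2) \<le> t" by linarith
      ultimately have "t \<in> J N" by (simp add: J_def)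
      with elim(1) show False by blast
    qed
    then show False by simp
  qed
  then obtain N where N: "0 < prob (J N)" by blast
  define \<epsilon>1 where "\<epsilon>1 = 1 / (real N + 2)"
  have \<epsilon>1: "0 < \<epsilon>1" "\<epsilon>1 < 1" by (simp_all add: \<epsilon>1_def)
  have J: "J N = {\<epsilon>1..1 / \<epsilon>1}" by (simp add: J_def \<epsilon>1_def)
  define supp where "supp t \<longleftrightarrow> (\<forall>\<delta>>0. 0 < prob {s \<in> J N. \<bar>s - t\<bar> < \<delta>})" for t
  have "\<exists>t. 1 \<le> t \<and> supp t"
  proof (rule ccontr)
    assume none: "\<nexists>t. 1 \<le> t \<and> supp t"
    have "AE t in \<nu>. t \<notin> J N"
      using weights_ge_1 AE_support[of \<epsilon>1] unfolding J[symmetric] supp_def[symmetric]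
      by eventually_elim (use none in auto)
    then have "prob (J N) = 0" by (subst prob_eq_0) (auto simp: J_def)
    with N show False by simp
  qed
  then obtain t where t: "1 \<le> t" "supp t" by blast
  have "t \<in> weight_cluster 0 \<epsilon>" if \<epsilon>: "0 < \<epsilon>" "\<epsilon> < \<epsilon>1" for \<epsilon>
  proof (rule weight_cluster_0I)
    fix \<delta> :: real assume "0 < \<delta>"
    then have "0 < prob {s \<in> {\<epsilon>1..1 / \<epsilon>1}. \<bar>s - t\<bar> < \<delta>}" using t(2) by (simp add: supp_def J)
    also have "\<dots> \<le> prob {s \<in> {\<epsilon>..1 / \<epsilon>}. \<bar>s - t\<bar> < \<delta>}"
    proof (intro finite_measure_mono)
      have "1 / \<epsilon>1 \<le> 1 / \<epsilon>" using \<epsilon> by (intro divide_left_mono) auto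
      then show "{s \<in> {\<epsilon>1..1 / \<epsilon>1}. \<bar>s - t\<bar> < \<delta>} \<subseteq> {s \<in> {\<epsilon>..1 / \<epsilon>}. \<bar>s - t\<bar> < \<delta>}"
        using \<epsilon> by auto
    qed simp
    finally show "0 < prob {s \<in> {\<epsilon>..1 / \<epsilon>}. \<bar>s - t\<bar> < \<delta>}" .
  qed
  with \<epsilon>1 t(1) show thesis by (rule that)
qed

end

section \<open>Concentration of the count in the optimal class\<close>

lemma card_vertex_tuples_le: "card (vertex_tuples k n) \<le> n ^ k"
proof -
  have "card (vertex_tuples k n) \<le> card ({1..k} \<rightarrow>\<^sub>E {1..n})"
    by (intro card_mono finite_PiE) (auto simp: vertex_tuples_def)
  then show ?thesis by (simp add: card_PiE)
qed

lemma card_vertex_tuples_ge: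
  assumes "2 * k \<le> n"
  shows "(real n / 2) ^ k \<le> card (vertex_tuples k n)"
proof -
  have "card (vertex_tuples k n) = (\<Prod>i\<in>{0..<k}. n - i)"
    unfolding vertex_tuples_def by (subst card_inj_on_subset_funcset) auto
  then have "real (card (vertex_tuples k n)) = (\<Prod>i\<in>{0..<k}. real (n - i))" by simp
  moreover have "(\<Prod>i\<in>{0..<k}. real n / 2) \<le> (\<Prod>i\<in>{0..<k}. real (n - i))"
    using assms by (intro prod_mono) auto
  ultimately show ?thesis by simp
qed

context power_law
begin

lemma tuple_prob_lower_torus:
  fixes y :: "nat \<Rightarrow> real \<times> (real ^ 'd)"
  assumes E: "E \<subseteq> vertex_pairs k" and k: "1 \<le> k" and \<epsilon>: "0 < \<epsilon>" "\<epsilon> < 1" and \<gamma>: "1 < \<gamma>"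
    and const: "\<And>i. i \<in> {1..k} \<Longrightarrow> fst p i = 1 / 2" "\<And>e. e \<in> vertex_pairs k \<Longrightarrow> snd p e = 0"
    and y: "strict_configuration torus_dist m k E \<gamma> (\<integral>t. t \<partial>\<nu>) \<epsilon> y"
      "\<And>i. i \<in> {1..k} \<Longrightarrow> fst (y i) \<in> {\<epsilon>..1 / \<epsilon>} \<and> snd (y i) \<in> torus"
  shows "\<exists>C>0. \<forall>\<^sub>F n in sequentially.
      C * real n powr ((1 - \<tau>) * (1 / 2) * k + real CARD('d) * 0 * (real k - 1))
        \<le> tuple_prob TYPE('d::finite) m k E \<gamma> \<nu> n \<epsilon> p"
proof -
  have place: "\<exists>\<delta>>0. \<delta> \<le> \<delta>0 \<and> (\<exists>\<zeta>>0. \<forall>\<^sub>F n in sequentially.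
      \<exists>Z. placement torus_dist k (real n powr 0) \<delta> (\<lambda>i. snd (y i)) Z \<and>
          \<zeta> * real n powr (- (real CARD('d) * 0)) \<le> card Z)" if \<delta>0_pos: "0 < \<delta>0" for \<delta>0
  proof -
    obtain \<delta> where \<delta>: "0 < \<delta>" "\<delta> \<le> \<delta>0" "placement torus_dist k 1 \<delta> (\<lambda>i. snd (y i)) {0}"
      using placement_torus[OF _ \<delta>0_pos, of k "\<lambda>i. snd (y i)"] y(2) by blast
    have "\<forall>\<^sub>F n in sequentially.
      \<exists>Z. placement torus_dist k (real n powr 0) \<delta> (\<lambda>i. snd (y i)) Z \<and>
          1 * real n powr (- (real CARD('d) * 0)) \<le> card Z"
      using eventually_ge_at_top[of 1]
      by eventually_elim (use \<delta>(3) in \<open>auto intro!: exI[of _ "{0}"]\<close>)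
    with \<delta>(1,2) show ?thesis by (intro exI[of _ \<delta>] conjI exI[of _ "1::real"]) auto
  qed
  obtain C where "0 < C" "\<forall>\<^sub>F n in sequentially.
      C * real n powr ((1 - \<tau>) * (1 / 2) * k + real CARD('d) * 0 * (real k - 1))
        \<le> tuple_prob TYPE('d) m k E \<gamma> \<nu> n \<epsilon> p"
  proof (rule tuple_prob_lower[OF E k \<epsilon>(1) \<gamma> const _ continuous_on_torus_dist y(1) _ place])
    show "fst (y i) \<in> weight_cluster (1 / 2) \<epsilon>" if "i \<in> {1..k}" for i
      using y(2)[OF that] \<epsilon> by (intro weight_cluster_interval) auto
  qed auto
  then show ?thesis by blast
qed

lemma tuple_prob_lower_space:
  fixes y :: "nat \<Rightarrow> real \<times> (real ^ 'd)"
  assumes E: "E \<subseteq> vertex_pairs k" and k: "1 \<le> k" and \<epsilon>: "0 < \<epsilon>" and \<gamma>: "1 < \<gamma>"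
    and const: "\<And>i. i \<in> {1..k} \<Longrightarrow> fst p i = 0" "\<And>e. e \<in> vertex_pairs k \<Longrightarrow> snd p e = - 1 / real CARD('d)"
    and y: "strict_configuration sup_dist m k E \<gamma> (\<integral>t. t \<partial>\<nu>) \<epsilon> y"
      "\<And>i. i \<in> {1..k} \<Longrightarrow> fst (y i) \<in> weight_cluster 0 \<epsilon>"
  shows "\<exists>C>0. \<forall>\<^sub>F n in sequentially.
      C * real n powr ((1 - \<tau>) * 0 * k + real CARD('d) * (- 1 / real CARD('d)) * (real k - 1))
        \<le> tuple_prob TYPE('d::finite) m k E \<gamma> \<nu> n \<epsilon> p"
proof -
  have place: "\<exists>\<delta>>0. \<delta> \<le> \<delta>0 \<and> (\<exists>\<zeta>>0. \<forall>\<^sub>F n in sequentially.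
      \<exists>Z. placement sup_dist k (real n powr (- 1 / real CARD('d))) \<delta> (\<lambda>i. snd (y i)) Z \<and>
          \<zeta> * real n powr (- (real CARD('d) * (- 1 / real CARD('d)))) \<le> card Z)" if \<delta>0_pos: "0 < \<delta>0" for \<delta>0
  proof -
    define \<delta> where "\<delta> = min \<delta>0 1"
    have \<delta>: "0 < \<delta>" "\<delta> \<le> 1" "\<delta> \<le> \<delta>0" using \<delta>0_pos by (auto simp: \<delta>_def)
    obtain \<zeta> where \<zeta>: "0 < \<zeta>" "\<forall>\<^sub>F n in sequentially.
        \<exists>Z. placement sup_dist k (real n powr (- 1 / real CARD('d))) \<delta> (\<lambda>i. snd (y i)) Z \<and> \<zeta> * real n \<le> card Z"
      using placement_cells[OF k \<delta>(1,2)] by blast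
    have "\<forall>\<^sub>F n in sequentially.
      \<exists>Z. placement sup_dist k (real n powr (- 1 / real CARD('d))) \<delta> (\<lambda>i. snd (y i)) Z \<and>
          \<zeta> * real n powr (- (real CARD('d) * (- 1 / real CARD('d)))) \<le> card Z"
      using \<zeta>(2) by eventually_elim simp
    with \<delta> \<zeta>(1) show ?thesis by blast
  qed
  obtain C where "0 < C" "\<forall>\<^sub>F n in sequentially.
      C * real n powr ((1 - \<tau>) * 0 * k + real CARD('d) * (- 1 / real CARD('d)) * (real k - 1))
        \<le> tuple_prob TYPE('d) m k E \<gamma> \<nu> n \<epsilon> p"
    by (rule tuple_prob_lower[OF E k \<epsilon> \<gamma> const _ continuous_on_sup_dist y(1) y(2) place]) auto
  then show ?thesis by blast
qed

end

text \<open>The class has constant exponents a and b, and \<open>2 a = 1 + d b\<close> puts all pairs at the connection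
  threshold. The number f is the exponent of the mean. The last assumption says that the pairs of
  copies with t vertices altogether, whose number has mean of order at most \<open>n^(t (1 + (1 - \<tau>) a) + d b (t - 1))\<close>
  if they share a vertex, are negligible against the squared mean.\<close>

locale critical_class = power_law \<nu> \<tau> c for \<nu> \<tau> c +
  fixes \<gamma> :: ereal and M :: "nat \<Rightarrow> 'a measure" and w :: "nat \<Rightarrow> nat \<Rightarrow> 'a \<Rightarrow> real"
    and x :: "nat \<Rightarrow> nat \<Rightarrow> 'a \<Rightarrow> real ^ 'd" and G :: "nat \<Rightarrow> 'a \<Rightarrow> nat set set"
    and m :: mode and k :: nat and E :: "nat set set"
    and ps :: "(nat \<Rightarrow> real) \<times> (nat set \<Rightarrow> real)" and a b f :: real
  assumes gamma: "1 < \<gamma>" and girgs: "\<And>n. 1 \<le> n \<Longrightarrow> girg (M n) \<gamma> \<nu> n (w n) (x n) (G n)"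
    and k: "1 \<le> k" and E: "E \<subseteq> vertex_pairs k"
    and const: "\<And>i. i \<in> {1..k} \<Longrightarrow> fst ps i = a" "\<And>e. e \<in> vertex_pairs k \<Longrightarrow> snd ps e = b"
    and ab: "2 * a = 1 + real CARD('d) * b"
    and f: "f = real k + (1 - \<tau>) * a * k + real CARD('d) * b * (real k - 1)"
    and overlap: "\<And>t. t \<in> {1..2 * k - 1} \<Longrightarrow>
      real t * (1 + (1 - \<tau>) * a) + real CARD('d) * b * (real t - 1) < 2 * f"
begin

abbreviation count :: "(nat \<Rightarrow> real) \<times> (nat set \<Rightarrow> real) \<Rightarrow> real \<Rightarrow> nat \<Rightarrow> 'a \<Rightarrow> real" where
  "count p \<epsilon> n \<omega> \<equiv> class_count m k E n \<epsilon> p (w n) (x n) (G n) \<omega>"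

abbreviation attainable :: "real \<Rightarrow> bool" where
  "attainable \<epsilon> \<equiv> class_attainable m k E \<epsilon> ps M w x G"

definition full_order :: "real \<Rightarrow> bool" where
  "full_order \<epsilon> \<longleftrightarrow> (\<exists>C>0. \<forall>\<^sub>F n in sequentially.
     C * real n powr (f - real k) \<le> tuple_prob TYPE('d) m k E \<gamma> \<nu> n \<epsilon> ps)"

definition concentrated :: "real \<Rightarrow> real \<Rightarrow> real \<Rightarrow> bool" where
  "concentrated \<epsilon> g1 g2 \<longleftrightarrow> (\<lambda>n. measure (M n) {\<omega> \<in> space (M n).
     g1 * real n powr f \<le> count ps \<epsilon> n \<omega> \<and> count ps \<epsilon> n \<omega> \<le> g2 * real n powr f}) \<longlonglongrightarrow> 1"

lemma weighted_girgs: "1 \<le> n \<Longrightarrow> weighted_girg (M n) \<gamma> \<nu> n (w n) (x n) (G n)"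
  using girgs real_distribution_axioms by (simp add: weighted_girg_def weighted_girg_axioms_def)

lemma objective_ps: "objective CARD('d) k E \<tau> \<gamma> ps = ereal f"
proof -
  have "(\<Sum>i\<in>e. fst ps i) - real CARD('d) * snd ps e - 1 = 0" if "e \<in> E" for e
  proof -
    have e: "e \<in> vertex_pairs k" using that E by blast
    then obtain i j where "e = {i, j}" "i < j" "1 \<le> i" "j \<le> k" by (rule vertex_pairs_cases)
    then have "(\<Sum>i\<in>e. fst ps i) = a + a" using const(1)[of i] const(1)[of j] by simp
    then show ?thesis using ab const(2)[OF e] by simp
  qed
  then have "(\<Sum>e\<in>E. min ((\<Sum>i\<in>e. fst ps i) - real CARD('d) * snd ps e - 1) 0) = 0"
    by (intro sum.neutral) auto
  moreover have "(\<Sum>j=2..k. Min ((\<lambda>i. snd ps {i, j}) ` {1..<j})) = (\<Sum>j=2..k. b)"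
  proof (intro sum.cong refl)
    fix j assume j: "j \<in> {2..k}"
    then have "(\<lambda>i. snd ps {i, j}) ` {1..<j} = {b}"
      using const(2)[OF doubleton_in_vertex_pairs] by (force simp: image_iff)
    then show "Min ((\<lambda>i. snd ps {i, j}) ` {1..<j}) = b" by simp
  qed
  moreover have "(\<Sum>j=2..k. b) = (real k - 1) * b" using k by (simp add: of_nat_diff)
  moreover have "(\<Sum>i = 1..k. fst ps i) = real k * a" using const(1) by simp
  ultimately have "objective CARD('d) k E \<tau> \<gamma> ps
      = ereal (real k + (1 - \<tau>) * (real k * a) + real CARD('d) * ((real k - 1) * b)) + \<gamma> * ereal 0"
    by (simp only: objective_def case_prod_beta)
  also have "\<gamma> * ereal 0 = 0" by (simp add: zero_ereal_def[symmetric])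
  finally show ?thesis by (simp add: f mult_ac)
qed

lemma expectation_upper:
  assumes \<epsilon>: "0 < \<epsilon>"
  obtains C where "0 < C" "\<And>n. 1 \<le> n \<Longrightarrow>
    real n ^ k * tuple_prob TYPE('d) m k E \<gamma> \<nu> n \<epsilon> ps \<le> C * real n powr f"
proof -
  have "0 \<le> ratio_exponent CARD('d) ps e" if "e \<in> E" for e
  proof -
    have e: "e \<in> vertex_pairs k" using that E by blast
    then obtain i j where "e = {i, j}" "i < j" "1 \<le> i" "j \<le> k" by (rule vertex_pairs_cases)
    then have "(\<Sum>i\<in>e. fst ps i) = a + a" using const(1)[of i] const(1)[of j] by simp
    then show ?thesis using ab const(2)[OF e] by (simp add: ratio_exponent_def)
  qed
  then obtain C where C: "0 < C" "\<And>n. 1 \<le> n \<Longrightarrow> tuple_prob TYPE('d) m k E \<gamma> \<nu> n \<epsilon> ps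
      \<le> C * real n powr (real_of_ereal (objective CARD('d) k E \<tau> \<gamma> ps) - real k)"
    using tuple_prob_upper[OF E \<epsilon> gamma, of ps m] by blast
  have "real n ^ k * tuple_prob TYPE('d) m k E \<gamma> \<nu> n \<epsilon> ps \<le> C * real n powr f" if n: "1 \<le> n" for n
  proof -
    have "real n ^ k * tuple_prob TYPE('d) m k E \<gamma> \<nu> n \<epsilon> ps \<le> real n ^ k * (C * real n powr (f - real k))"
      using C(2)[OF n] by (intro mult_left_mono) (auto simp: objective_ps)
    also have "\<dots> = C * real n powr f"
      using n by (simp add: powr_diff powr_realpow)
    finally show ?thesis .
  qed
  with C(1) show thesis by (rule that)
qed

lemma variance_negligible:
  assumes \<epsilon>: "0 < \<epsilon>"
  defines "V n \<equiv> (\<Sum>t = 1..2 * k - 1. real n ^ t * real ((2 * k) ^ k) ^ 2 *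
    (measure \<nu> {\<epsilon> * real n powr a..} ^ t * ((6 * (real n powr b / \<epsilon>)) ^ CARD('d)) ^ (t - 1)))"
  shows "(\<lambda>n. V n / (real n powr f)\<^sup>2) \<longlonglongrightarrow> 0"
proof -
  let ?d = "real CARD('d)"
  obtain C where C: "0 < C" "\<And>t. 0 < t \<Longrightarrow> prob {t..} \<le> C * t powr (1 - \<tau>)" using tail_upper by blast
  define T where "T t n = real n ^ t * real ((2 * k) ^ k) ^ 2 *
    (measure \<nu> {\<epsilon> * real n powr a..} ^ t * ((6 * (real n powr b / \<epsilon>)) ^ CARD('d)) ^ (t - 1)) / (real n powr f)\<^sup>2" for t n
  have T0: "(\<lambda>n. T t n) \<longlonglongrightarrow> 0" if t: "t \<in> {1..2 * k - 1}" for t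
  proof -
    define K where "K = real ((2 * k) ^ k) ^ 2 * ((C * \<epsilon> powr (1 - \<tau>)) ^ t * ((6 / \<epsilon>) ^ CARD('d)) ^ (t - 1))"
    define e where "e = real t * (1 + (1 - \<tau>) * a) + ?d * b * (real t - 1) - 2 * f"
    have e: "e < 0" using overlap[OF t] by (simp add: e_def)
    have bound: "T t n \<le> K * real n powr e" if n: "1 \<le> n" for n
    proof -
      have n0: "0 < real n" using n by simp
      have tail: "prob {\<epsilon> * real n powr a..} \<le> (C * \<epsilon> powr (1 - \<tau>)) * real n powr ((1 - \<tau>) * a)"
      proof -
        have "prob {\<epsilon> * real n powr a..} \<le> C * (\<epsilon> * real n powr a) powr (1 - \<tau>)"
          using \<epsilon> n0 by (intro C) simp
        also have "\<dots> = (C * \<epsilon> powr (1 - \<tau>)) * real n powr ((1 - \<tau>) * a)"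
          using \<epsilon> n0 by (simp add: powr_mult powr_powr mult.commute[of a])
        finally show ?thesis .
      qed
      have ball: "(6 * (real n powr b / \<epsilon>)) ^ CARD('d) = (6 / \<epsilon>) ^ CARD('d) * real n powr (?d * b)"
      proof -
        have "6 * (real n powr b / \<epsilon>) = 6 / \<epsilon> * real n powr b" by simp
        then show ?thesis using n0 by (simp only: power_mult_distrib) (simp add: powr_power)
      qed
      have "T t n \<le> real n ^ t * real ((2 * k) ^ k) ^ 2 *
          (((C * \<epsilon> powr (1 - \<tau>)) * real n powr ((1 - \<tau>) * a)) ^ t *
           ((6 / \<epsilon>) ^ CARD('d) * real n powr (?d * b)) ^ (t - 1)) / (real n powr f)\<^sup>2"
        unfolding T_def ball using tail \<epsilon>
        by (intro divide_right_mono mult_left_mono mult_right_mono power_mono) auto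
      also have "\<dots> = K * (real n ^ t * (real n powr ((1 - \<tau>) * a)) ^ t * (real n powr (?d * b)) ^ (t - 1) / (real n powr f)\<^sup>2)"
        by (simp add: K_def power_mult_distrib mult_ac)
      also have "real n ^ t * (real n powr ((1 - \<tau>) * a)) ^ t * (real n powr (?d * b)) ^ (t - 1) / (real n powr f)\<^sup>2
          = real n powr real t * real n powr (real t * ((1 - \<tau>) * a)) * real n powr (real (t - 1) * (?d * b)) / real n powr (2 * f)"
        using n0 by (simp add: powr_power powr_realpow)
      also have "\<dots> = real n powr e"
      proof -
        have "real (t - 1) = real t - 1" using t by auto
        then show ?thesis
          by (simp add: powr_add[symmetric] powr_diff[symmetric] e_def algebra_simps)
      qed
      finally show ?thesis .
    qed
    have "(\<lambda>n. K * real n powr e) \<longlonglongrightarrow> K * 0"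
      by (intro tendsto_mult_left tendsto_neg_powr[OF e] filterlim_real_sequentially)
    then have lim: "(\<lambda>n. K * real n powr e) \<longlonglongrightarrow> 0" by simp
    show ?thesis
    proof (rule tendsto_sandwich[OF _ _ tendsto_const lim])
      show "\<forall>\<^sub>F n in sequentially. 0 \<le> T t n"
        using \<epsilon> by (simp add: T_def)
      show "\<forall>\<^sub>F n in sequentially. T t n \<le> K * real n powr e"
        using eventually_ge_at_top[of 1] by eventually_elim (rule bound)
    qed
  qed
  have "(\<lambda>n. \<Sum>t = 1..2 * k - 1. T t n) \<longlonglongrightarrow> 0"
    by (rule tendsto_null_sum) (rule T0)
  then show ?thesis by (simp add: V_def T_def sum_divide_distrib)
qed

text \<open>The lower bound for the mean has the same exponent as the upper bound, and the variance is
  of smaller order than the squared mean.\<close>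

lemma concentration:
  assumes \<epsilon>: "0 < \<epsilon>"
    and lower: "full_order \<epsilon>"
  obtains g1 g2 where "0 < g1" "0 < g2" "concentrated \<epsilon> g1 g2"
proof -
  let ?N = "\<lambda>n. count ps \<epsilon> n"
  let ?V = "\<lambda>n. (\<Sum>t = 1..2 * k - 1. real n ^ t * real ((2 * k) ^ k) ^ 2 *
    (measure \<nu> {\<epsilon> * real n powr a..} ^ t * ((6 * (real n powr b / \<epsilon>)) ^ CARD('d)) ^ (t - 1)))"
  obtain Cl where Cl: "0 < Cl" and ev: "\<forall>\<^sub>F n in sequentially.
      Cl * real n powr (f - real k) \<le> tuple_prob TYPE('d) m k E \<gamma> \<nu> n \<epsilon> ps"
    using lower unfolding full_order_def by blast
  obtain Cu where Cu: "0 < Cu" "\<And>n. 1 \<le> n \<Longrightarrow>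
    real n ^ k * tuple_prob TYPE('d) m k E \<gamma> \<nu> n \<epsilon> ps \<le> Cu * real n powr f"
    using expectation_upper[OF \<epsilon>] by blast
  \<comment> \<open>For \<open>n \<ge> 2 k\<close> there are at least \<open>(n / 2)^k\<close> tuples, hence the factor \<open>(1 / 2)^k\<close>.\<close>
  define l where "l = (1 / 2) ^ k * Cl"
  have l: "0 < l" using Cl by (simp add: l_def)
  let ?good = "\<lambda>n. {\<omega> \<in> space (M n). l / 2 * real n powr f \<le> ?N n \<omega> \<and> ?N n \<omega> \<le> 2 * Cu * real n powr f}"
  have main: "\<forall>\<^sub>F n in sequentially.
      1 - 4 / l\<^sup>2 * (?V n / (real n powr f)\<^sup>2) \<le> measure (M n) (?good n) \<and> measure (M n) (?good n) \<le> 1"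
    using ev eventually_ge_at_top[of "2 * k"]
  proof eventually_elim
    case (elim n)
    have n: "1 \<le> n" using elim(2) k by simp
    then have n0: "0 < real n" by simp
    interpret girg_n: weighted_girg "M n" \<gamma> \<nu> n "w n" "x n" "G n" by (rule weighted_girgs[OF n])
    let ?q = "tuple_prob TYPE('d) m k E \<gamma> \<nu> n \<epsilon> ps"
    have EN: "girg_n.expectation (?N n) = card (vertex_tuples k n) * ?q"
      by (rule girg_n.expectation_class_count[OF E])
    have q0: "0 \<le> ?q"
    proof -
      have "0 \<le> Cl * real n powr (f - real k)" using Cl by simp
      then show ?thesis using elim(1) by linarith
    qed
    have "l * real n powr f = (real n / 2) ^ k * (Cl * real n powr (f - real k))"
      using n0 by (simp add: l_def powr_diff powr_realpow power_divide)
    also have "\<dots> \<le> card (vertex_tuples k n) * ?q"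
      using elim(1) card_vertex_tuples_ge[OF elim(2)] Cl by (intro mult_mono) auto
    finally have lo: "l * real n powr f \<le> girg_n.expectation (?N n)" using EN by simp
    have "card (vertex_tuples k n) * ?q \<le> real (n ^ k) * ?q"
      using card_vertex_tuples_le[of k n] q0 by (intro mult_right_mono of_nat_mono) auto
    also have "\<dots> \<le> Cu * real n powr f" using Cu(2)[OF n] by simp
    finally have hi: "girg_n.expectation (?N n) \<le> Cu * real n powr f" using EN by simp
    have "0 < l * real n powr f" using l n0 by simp
    from girg_n.prob_class_count_between[OF E this lo hi]
    have "1 - 4 * girg_n.variance (?N n) / (l * real n powr f)\<^sup>2 \<le> measure (M n) (?good n)"
      by (simp add: mult.assoc)
    moreover have "4 * girg_n.variance (?N n) / (l * real n powr f)\<^sup>2 \<le> 4 * ?V n / (l * real n powr f)\<^sup>2"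
      using girg_n.variance_class_count_le[OF E k \<epsilon> const] by (intro divide_right_mono) auto
    moreover have "4 * ?V n / (l * real n powr f)\<^sup>2 = 4 / l\<^sup>2 * (?V n / (real n powr f)\<^sup>2)"
      by (simp add: power_mult_distrib)
    ultimately show ?case by (auto intro: girg_n.prob_le_1)
  qed
  have lim: "(\<lambda>n. 1 - 4 / l\<^sup>2 * (?V n / (real n powr f)\<^sup>2)) \<longlonglongrightarrow> 1 - 4 / l\<^sup>2 * 0"
    by (intro tendsto_diff tendsto_const tendsto_mult_left variance_negligible[OF \<epsilon>])
  show thesis
  proof
    show "0 < l / 2" "0 < 2 * Cu" using l Cu(1) by auto
    show "concentrated \<epsilon> (l / 2) (2 * Cu)"
      unfolding concentrated_def
    proof (rule tendsto_sandwich[OF _ _ _ tendsto_const])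
      show "\<forall>\<^sub>F n in sequentially. 1 - 4 / l\<^sup>2 * (?V n / (real n powr f)\<^sup>2) \<le> measure (M n) (?good n)"
        using main by eventually_elim blast
      show "\<forall>\<^sub>F n in sequentially. measure (M n) (?good n) \<le> 1"
        using main by eventually_elim blast
      show "(\<lambda>n. 1 - 4 / l\<^sup>2 * (?V n / (real n powr f)\<^sup>2)) \<longlonglongrightarrow> 1" using lim by simp
    qed
  qed
qed

text \<open>Markov's inequality makes the numerator smaller than any multiple of \<open>n^f\<close>, which is the
  order of the denominator.\<close>

lemma ratio_tendsto_0:
  assumes g1: "0 < g1" and conc: "concentrated \<epsilon> g1 g2"
    and small: "(\<lambda>n. real n ^ k * tuple_prob TYPE('d) m k E \<gamma> \<nu> n \<epsilon> p / real n powr f) \<longlonglongrightarrow> 0"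
    and \<delta>: "0 < \<delta>"
  shows "(\<lambda>n. measure (M n) {\<omega> \<in> space (M n).
      let N = count p \<epsilon> n \<omega>; Ns = count ps \<epsilon> n \<omega> in Ns = 0 \<or> \<delta> < \<bar>N / Ns\<bar>}) \<longlonglongrightarrow> 0"
proof -
  let ?Ns = "\<lambda>n. count ps \<epsilon> n" and ?N = "\<lambda>n. count p \<epsilon> n"
  let ?good = "\<lambda>n. {\<omega> \<in> space (M n). g1 * real n powr f \<le> ?Ns n \<omega> \<and> ?Ns n \<omega> \<le> g2 * real n powr f}"
  let ?bad = "\<lambda>n. {\<omega> \<in> space (M n). let N = ?N n \<omega>; Ns = ?Ns n \<omega> in Ns = 0 \<or> \<delta> < \<bar>N / Ns\<bar>}"
  let ?q = "\<lambda>n. real n ^ k * tuple_prob TYPE('d) m k E \<gamma> \<nu> n \<epsilon> p / real n powr f"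
  have upper: "\<forall>\<^sub>F n in sequentially. measure (M n) (?bad n) \<le> (1 - measure (M n) (?good n)) + 1 / (\<delta> * g1) * ?q n"
    using eventually_ge_at_top[of 1]
  proof eventually_elim
    case (elim n)
    then have n0: "0 < real n" by simp
    interpret girg_n: weighted_girg "M n" \<gamma> \<nu> n "w n" "x n" "G n" by (rule weighted_girgs[OF elim])
    let ?big = "{\<omega> \<in> space (M n). \<delta> * (g1 * real n powr f) \<le> ?N n \<omega>}"
    have s: "0 < g1 * real n powr f" using g1 n0 by simp
    have sub: "?bad n \<subseteq> (space (M n) - ?good n) \<union> ?big"
    proof
      fix \<omega> assume \<omega>: "\<omega> \<in> ?bad n"
      show "\<omega> \<in> (space (M n) - ?good n) \<union> ?big"
      proof (cases "\<omega> \<in> ?good n")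
        case True
        then have Ns: "g1 * real n powr f \<le> ?Ns n \<omega>" by simp
        then have Ns0: "0 < ?Ns n \<omega>" using s by linarith
        have "\<omega> \<in> space (M n)" using \<omega> by simp
        from girg_n.class_count_bounds(1)[OF this] have N0: "0 \<le> ?N n \<omega>" .
        have "\<delta> < ?N n \<omega> / ?Ns n \<omega>" using \<omega> Ns0 N0 by (auto simp: Let_def)
        then have "\<delta> * ?Ns n \<omega> < ?N n \<omega>" using Ns0 by (simp add: less_divide_eq)
        moreover have "\<delta> * (g1 * real n powr f) \<le> \<delta> * ?Ns n \<omega>" using Ns \<delta> by (intro mult_left_mono) auto
        ultimately show ?thesis using \<omega> by auto
      qed (use \<omega> in auto)
    qed
    have good_meas: "?good n \<in> sets (M n)" by measurable
    have big_meas: "?big \<in> sets (M n)" by measurable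
    have "measure (M n) (?bad n) \<le> measure (M n) ((space (M n) - ?good n) \<union> ?big)"
      using sub good_meas big_meas by (intro girg_n.finite_measure_mono) auto
    also have "\<dots> \<le> measure (M n) (space (M n) - ?good n) + measure (M n) ?big"
      using good_meas big_meas by (intro measure_Un_le) auto
    also have "measure (M n) (space (M n) - ?good n) = 1 - measure (M n) (?good n)"
      by (rule girg_n.prob_compl[OF good_meas])
    also have "measure (M n) ?big \<le> girg_n.expectation (?N n) / (\<delta> * (g1 * real n powr f))"
      using girg_n.class_count_bounds(1) s \<delta>
      by (intro integral_Markov_inequality_measure[where A = "{}"] girg_n.integrable_class_count) auto
    also have "\<dots> \<le> (real n ^ k * tuple_prob TYPE('d) m k E \<gamma> \<nu> n \<epsilon> p) / (\<delta> * (g1 * real n powr f))"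
    proof (intro divide_right_mono)
      have q0: "0 \<le> tuple_prob TYPE('d) m k E \<gamma> \<nu> n \<epsilon> p"
        unfolding tuple_prob_def by (intro integral_nonneg_AE AE_I2 pattern_density_bounds)
      have "girg_n.expectation (?N n) = card (vertex_tuples k n) * tuple_prob TYPE('d) m k E \<gamma> \<nu> n \<epsilon> p"
        by (rule girg_n.expectation_class_count[OF E])
      also have "\<dots> \<le> real (n ^ k) * tuple_prob TYPE('d) m k E \<gamma> \<nu> n \<epsilon> p"
        using card_vertex_tuples_le[of k n] q0 by (intro mult_right_mono of_nat_mono) auto
      finally show "girg_n.expectation (?N n) \<le> real n ^ k * tuple_prob TYPE('d) m k E \<gamma> \<nu> n \<epsilon> p" by simp
      show "0 \<le> \<delta> * (g1 * real n powr f)" using s \<delta> by simp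
    qed
    also have "\<dots> = 1 / (\<delta> * g1) * ?q n" by simp
    finally show ?case by linarith
  qed
  have "(\<lambda>n. (1 - measure (M n) (?good n)) + 1 / (\<delta> * g1) * ?q n) \<longlonglongrightarrow> (1 - 1) + 1 / (\<delta> * g1) * 0"
    by (intro tendsto_add tendsto_diff tendsto_const tendsto_mult_left
        conc[unfolded concentrated_def] small)
  then have lim: "(\<lambda>n. (1 - measure (M n) (?good n)) + 1 / (\<delta> * g1) * ?q n) \<longlonglongrightarrow> 0" by simp
  show ?thesis
  proof (rule tendsto_sandwich[OF _ upper tendsto_const lim])
    show "\<forall>\<^sub>F n in sequentially. 0 \<le> measure (M n) (?bad n)" by simp
  qed
qed

lemma attainable_frequently:
  assumes "attainable \<epsilon>" and "eventually P sequentially"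
  obtains n where "1 \<le> n" "P n"
    "0 < measure (M n) {\<omega> \<in> space (M n). 0 < count ps \<epsilon> n \<omega>}"
proof -
  from assms(1) have "\<exists>\<^sub>F n in sequentially.
      0 < measure (M n) {\<omega> \<in> space (M n). 0 < count ps \<epsilon> n \<omega>}"
    by (simp add: class_attainable_def)
  moreover have "\<forall>\<^sub>F n in sequentially. 1 \<le> n \<and> P n"
    using assms(2) eventually_ge_at_top[of 1] by eventually_elim simp
  ultimately have "\<exists>\<^sub>F n in sequentially. (1 \<le> n \<and> P n) \<and>
      0 < measure (M n) {\<omega> \<in> space (M n). 0 < count ps \<epsilon> n \<omega>}"
    by (rule frequently_eventually_conj)
  then show thesis using that by (auto dest: frequently_ex)
qed

lemma attainable_of_lower_bound:
  assumes \<epsilon>: "0 < \<epsilon>"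
    and lower: "full_order \<epsilon>"
  shows "attainable \<epsilon>"
proof -
  let ?N = "\<lambda>n. count ps \<epsilon> n"
  obtain g1 g2 where g: "0 < g1" and conc: "concentrated \<epsilon> g1 g2"
    using concentration[OF \<epsilon> lower] by blast
  have "\<forall>\<^sub>F n in sequentially. 0 < measure (M n)
      {\<omega> \<in> space (M n). g1 * real n powr f \<le> ?N n \<omega> \<and> ?N n \<omega> \<le> g2 * real n powr f}"
    using order_tendstoD(1)[OF conc[unfolded concentrated_def], of 0] by simp
  then have "\<forall>\<^sub>F n in sequentially. 0 < measure (M n) {\<omega> \<in> space (M n). 0 < ?N n \<omega>}"
    using eventually_ge_at_top[of 1]
  proof eventually_elim
    case (elim n)
    interpret girg_n: weighted_girg "M n" \<gamma> \<nu> n "w n" "x n" "G n" by (rule weighted_girgs[OF elim(2)])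
    have "0 < g1 * real n powr f" using g elim(2) by simp
    then have "{\<omega> \<in> space (M n). g1 * real n powr f \<le> ?N n \<omega> \<and> ?N n \<omega> \<le> g2 * real n powr f}
        \<subseteq> {\<omega> \<in> space (M n). 0 < ?N n \<omega>}" by auto
    then have "measure (M n) {\<omega> \<in> space (M n). g1 * real n powr f \<le> ?N n \<omega> \<and> ?N n \<omega> \<le> g2 * real n powr f}
        \<le> measure (M n) {\<omega> \<in> space (M n). 0 < ?N n \<omega>}"
      by (intro girg_n.finite_measure_mono) auto
    with elim(1) show ?case by linarith
  qed
  then show ?thesis
    unfolding class_attainable_def by (intro eventually_frequently) auto
qed

text \<open>Positive probability for a single large n already gives a strict configuration. Since this
  does not depend on n, it gives the lower bound for all large n.\<close>

lemma lower_bound_of_attainable: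
  assumes \<epsilon>: "0 < \<epsilon>" "\<epsilon> < 1"
    and shape: "(a = 1 / 2 \<and> b = 0) \<or> (a = 0 \<and> b = - 1 / real CARD('d))"
    and att: "attainable \<epsilon>"
  shows "full_order \<epsilon>"
  using shape
proof
  have \<mu>: "0 < (\<integral>t. t \<partial>\<nu>)" using mean_ge_1 by linarith
  {
    assume s: "a = 1 / 2 \<and> b = 0"
    then have const': "\<And>i. i \<in> {1..k} \<Longrightarrow> fst ps i = 1 / 2" "\<And>e. e \<in> vertex_pairs k \<Longrightarrow> snd ps e = 0"
      using const by auto
    obtain n where n: "1 \<le> n"
      "0 < measure (M n) {\<omega> \<in> space (M n). 0 < count ps \<epsilon> n \<omega>}"
      using attainable_frequently[OF att eventually_True] by blast
    interpret girg_n: weighted_girg "M n" \<gamma> \<nu> n "w n" "x n" "G n" by (rule weighted_girgs[OF n(1)])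
    obtain y :: "nat \<Rightarrow> real \<times> (real ^ 'd)" where y:
      "strict_configuration torus_dist m k E \<gamma> (\<integral>t. t \<partial>\<nu>) \<epsilon> y"
      "\<And>i. i \<in> {1..k} \<Longrightarrow> fst (y i) \<in> {\<epsilon>..1 / \<epsilon>} \<and> snd (y i) \<in> torus"
      using girg_n.strict_configuration_torus[OF E \<epsilon>(1) gamma \<mu> const' n(2)] by blast
    have "f - real k = (1 - \<tau>) * (1 / 2) * k + real CARD('d) * 0 * (real k - 1)" using s f by simp
    then show "full_order \<epsilon>"
      using tuple_prob_lower_torus[OF E k \<epsilon> gamma const' y] by (simp only: full_order_def)
  next
    assume s: "a = 0 \<and> b = - 1 / real CARD('d)"
    then have const': "\<And>i. i \<in> {1..k} \<Longrightarrow> fst ps i = 0"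
      "\<And>e. e \<in> vertex_pairs k \<Longrightarrow> snd ps e = - 1 / real CARD('d)"
      using const by auto
    have lim: "(\<lambda>n. real n powr (- 1 / real CARD('d)) / \<epsilon>) \<longlonglongrightarrow> 0 / \<epsilon>"
      using \<epsilon> by (intro tendsto_divide tendsto_const tendsto_neg_powr filterlim_real_sequentially) auto
    have "\<forall>\<^sub>F n in sequentially. real n powr (- 1 / real CARD('d)) / \<epsilon> < 1 / 4"
      by (rule order_tendstoD(2)[OF lim]) simp
    then obtain n where n: "1 \<le> n" "real n powr (- 1 / real CARD('d)) / \<epsilon> < 1 / 4"
      "0 < measure (M n) {\<omega> \<in> space (M n). 0 < count ps \<epsilon> n \<omega>}"
      using attainable_frequently[OF att] by blast
    interpret girg_n: weighted_girg "M n" \<gamma> \<nu> n "w n" "x n" "G n" by (rule weighted_girgs[OF n(1)])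
    have Pw: "AE t in \<nu>. t \<in> {\<epsilon>..1 / \<epsilon>} \<longrightarrow> t \<in> weight_cluster 0 \<epsilon>"
      using AE_support[of \<epsilon>] by eventually_elim (blast intro: weight_cluster_0I)
    obtain y :: "nat \<Rightarrow> real \<times> (real ^ 'd)" where y:
      "strict_configuration sup_dist m k E \<gamma> (\<integral>t. t \<partial>\<nu>) \<epsilon> y"
      "\<And>i. i \<in> {1..k} \<Longrightarrow> fst (y i) \<in> weight_cluster 0 \<epsilon>"
      using girg_n.strict_configuration_space[OF E k \<epsilon>(1) gamma \<mu> const' Pw n(2,3)] by blast
    from tuple_prob_lower_space[OF E k \<epsilon>(1) gamma const' y] s
    show "full_order \<epsilon>" unfolding full_order_def by (simp add: f)
  }
qed

text \<open>For small \<open>\<epsilon>\<close> there is a strict configuration, and by concentration the count is then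
  positive with high probability.\<close>

lemma attainable_for_small_epsilon:
  assumes easy: "m = Sub \<or> \<gamma> < \<infinity>"
    and shape: "(a = 1 / 2 \<and> b = 0) \<or> (a = 0 \<and> b = - 1 / real CARD('d))"
  shows "\<exists>\<epsilon>0\<in>{0<..<1}. \<forall>\<epsilon>\<in>{0<..<\<epsilon>0}. attainable \<epsilon>"
  using shape
proof
  assume s: "a = 1 / 2 \<and> b = 0"
  then have const': "\<And>i. i \<in> {1..k} \<Longrightarrow> fst ps i = 1 / 2" "\<And>e. e \<in> vertex_pairs k \<Longrightarrow> snd ps e = 0"
    using const by auto
  obtain \<epsilon>0 and y :: "nat \<Rightarrow> real \<times> (real ^ 'd)" where \<epsilon>0: "0 < \<epsilon>0" "\<epsilon>0 < 1"
    and y: "\<And>\<epsilon>. 0 < \<epsilon> \<Longrightarrow> \<epsilon> < \<epsilon>0 \<Longrightarrow> strict_configuration torus_dist m k E \<gamma> (\<integral>t. t \<partial>\<nu>) \<epsilon> y \<and>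
      (\<forall>i\<in>{1..k}. fst (y i) \<in> {\<epsilon>..1 / \<epsilon>} \<and> snd (y i) \<in> torus)"
    using exists_strict_configuration_torus[OF mean_ge_1 easy] by blast
  have "attainable \<epsilon>" if "\<epsilon> \<in> {0<..<\<epsilon>0}" for \<epsilon>
  proof (rule attainable_of_lower_bound)
    have \<epsilon>: "0 < \<epsilon>" "\<epsilon> < 1" "\<epsilon> < \<epsilon>0" using that \<epsilon>0 by auto
    show "0 < \<epsilon>" by fact
    show "full_order \<epsilon>"
    proof -
      have "f - real k = (1 - \<tau>) * (1 / 2) * k + real CARD('d) * 0 * (real k - 1)" using s f by simp
      moreover have "strict_configuration torus_dist m k E \<gamma> (\<integral>t. t \<partial>\<nu>) \<epsilon> y"
        "\<And>i. i \<in> {1..k} \<Longrightarrow> fst (y i) \<in> {\<epsilon>..1 / \<epsilon>} \<and> snd (y i) \<in> torus"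
        using y[OF \<epsilon>(1,3)] by blast+
      note tuple_prob_lower_torus[OF E k \<epsilon>(1,2) gamma const' this]
      ultimately show ?thesis by (simp only: full_order_def)
    qed
  qed
  with \<epsilon>0 show ?thesis by (intro bexI[of _ \<epsilon>0]) simp_all
next
  assume s: "a = 0 \<and> b = - 1 / real CARD('d)"
  then have const': "\<And>i. i \<in> {1..k} \<Longrightarrow> fst ps i = 0"
    "\<And>e. e \<in> vertex_pairs k \<Longrightarrow> snd ps e = - 1 / real CARD('d)"
    using const by auto
  obtain t \<epsilon>1 where \<epsilon>1: "0 < \<epsilon>1" "\<epsilon>1 < 1" and t: "1 \<le> t"
    "\<And>\<epsilon>. 0 < \<epsilon> \<Longrightarrow> \<epsilon> < \<epsilon>1 \<Longrightarrow> t \<in> weight_cluster 0 \<epsilon>"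
    by (rule exists_support_point) (rule that; assumption)
  obtain \<epsilon>0 and y :: "nat \<Rightarrow> real \<times> (real ^ 'd)" where \<epsilon>0: "0 < \<epsilon>0" "\<epsilon>0 < 1"
    and y: "\<And>\<epsilon>. 0 < \<epsilon> \<Longrightarrow> \<epsilon> < \<epsilon>0 \<Longrightarrow> strict_configuration sup_dist m k E \<gamma> (\<integral>t. t \<partial>\<nu>) \<epsilon> y"
      "\<And>i. fst (y i) = t"
    using exists_strict_configuration_space[OF mean_ge_1 easy t(1)] by blast
  have "attainable \<epsilon>" if "\<epsilon> \<in> {0<..<min \<epsilon>0 \<epsilon>1}" for \<epsilon>
  proof (rule attainable_of_lower_bound)
    have \<epsilon>: "0 < \<epsilon>" "\<epsilon> < \<epsilon>0" "\<epsilon> < \<epsilon>1" using that by auto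
    show "0 < \<epsilon>" by fact
    have "fst (y i) \<in> weight_cluster 0 \<epsilon>" for i using y(2) t(2)[OF \<epsilon>(1,3)] by simp
    from tuple_prob_lower_space[OF E k \<epsilon>(1) gamma const' y(1)[OF \<epsilon>(1,2)] this] s
    show "full_order \<epsilon>" unfolding full_order_def by (simp add: f)
  qed
  then have "\<forall>\<epsilon>\<in>{0<..<min \<epsilon>0 \<epsilon>1}. attainable \<epsilon>" by blast
  moreover have "min \<epsilon>0 \<epsilon>1 \<in> {0<..<1}" using \<epsilon>0 \<epsilon>1 by auto
  ultimately show ?thesis by blast
qed

text \<open>The exponent of the mean of a class is at most its objective value, which is smaller than f at
  all other points of the optimization problem. At a feasible point that violates a constraint of
  the induced problem, a forbidden pair is connected and the class contains no copy for large n.\<close>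

lemma suboptimal_mean_negligible:
  assumes \<epsilon>: "0 < \<epsilon>" and p: "p \<in> feasible CARD('d) k \<tau>"
    and less: "p \<in> mode_feasible m CARD('d) k E \<tau> \<Longrightarrow>
      objective CARD('d) k E \<tau> \<gamma> p < objective CARD('d) k E \<tau> \<gamma> ps"
  shows "(\<lambda>n. real n ^ k * tuple_prob TYPE('d) m k E \<gamma> \<nu> n \<epsilon> p / real n powr f) \<longlonglongrightarrow> 0"
proof (cases "(\<exists>e\<in>forbidden_pairs m k E. 0 < ratio_exponent CARD('d) p e) \<or>
      (\<gamma> = \<infinity> \<and> (\<exists>e\<in>E. ratio_exponent CARD('d) p e < 0))")
  case True
  have "0 < (\<integral>t. t \<partial>\<nu>)" using mean_ge_1 by linarith
  from eventually_tuple_prob_eq_0[OF E this \<epsilon> gamma True]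
  have "\<forall>\<^sub>F n in sequentially. 0 = real n ^ k * tuple_prob TYPE('d) m k E \<gamma> \<nu> n \<epsilon> p / real n powr f"
    by eventually_elim simp
  then show ?thesis by (rule Lim_transform_eventually[OF tendsto_const])
next
  case False
  have "p \<in> mode_feasible m CARD('d) k E \<tau>"
  proof (cases m)
    case Ind
    have "fst p i + fst p j \<le> 1 + real CARD('d) * snd p {i, j}"
      if ij: "i \<in> {1..k}" "j \<in> {1..k}" "i \<noteq> j" "{i, j} \<notin> E" for i j
    proof -
      have "{i, j} \<in> forbidden_pairs m k E"
        using doubleton_in_vertex_pairs[OF ij(1-3)] ij(4) Ind by (simp add: forbidden_pairs_def)
      then have "ratio_exponent CARD('d) p {i, j} \<le> 0" using False by (meson not_less)
      then show ?thesis using ij(3) by (simp add: ratio_exponent_def)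
    qed
    then show ?thesis using p Ind by (cases p) (auto simp: mode_feasible_def)
  qed (use p in \<open>simp add: mode_feasible_def\<close>)
  from less[OF this] have less: "objective CARD('d) k E \<tau> \<gamma> p < ereal f" by (simp add: objective_ps)
  obtain C where C: "0 < C"
    "\<And>n. 1 \<le> n \<Longrightarrow> tuple_prob TYPE('d) m k E \<gamma> \<nu> n \<epsilon> p
      \<le> C * real n powr (real_of_ereal (objective CARD('d) k E \<tau> \<gamma> p) - real k)"
    "\<bar>objective CARD('d) k E \<tau> \<gamma> p\<bar> \<noteq> \<infinity>"
    using tuple_prob_upper[OF E \<epsilon> gamma, of p m] False by (metis not_less)
  define F where "F = real_of_ereal (objective CARD('d) k E \<tau> \<gamma> p)"
  have F: "F < f" using less C(3) by (cases "objective CARD('d) k E \<tau> \<gamma> p") (auto simp: F_def)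
  have "(\<lambda>n. C * real n powr (F - f)) \<longlonglongrightarrow> C * 0"
    using F by (intro tendsto_mult_left tendsto_neg_powr filterlim_real_sequentially) auto
  then have lim: "(\<lambda>n. C * real n powr (F - f)) \<longlonglongrightarrow> 0" by simp
  show ?thesis
  proof (rule tendsto_sandwich[OF _ _ tendsto_const lim])
    have "0 \<le> tuple_prob TYPE('d) m k E \<gamma> \<nu> n \<epsilon> p" for n
      unfolding tuple_prob_def by (intro integral_nonneg_AE AE_I2 pattern_density_bounds)
    then show "\<forall>\<^sub>F n in sequentially. 0 \<le> real n ^ k * tuple_prob TYPE('d) m k E \<gamma> \<nu> n \<epsilon> p / real n powr f"
      by simp
    show "\<forall>\<^sub>F n in sequentially. real n ^ k * tuple_prob TYPE('d) m k E \<gamma> \<nu> n \<epsilon> p / real n powr f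
        \<le> C * real n powr (F - f)"
      using eventually_ge_at_top[of 1]
    proof eventually_elim
      case (elim n)
      then have n0: "0 < real n" by simp
      have "real n ^ k * tuple_prob TYPE('d) m k E \<gamma> \<nu> n \<epsilon> p / real n powr f
          \<le> real n ^ k * (C * real n powr (F - real k)) / real n powr f"
        using C(2)[OF elim] by (intro divide_right_mono mult_left_mono) (auto simp: F_def)
      also have "\<dots> = C * real n powr (F - f)"
        using n0 by (simp add: powr_diff powr_realpow)
      finally show ?case .
    qed
  qed
qed

end

lemma less_of_unique_arg_max:
  fixes g :: "'b \<Rightarrow> ereal"
  assumes unique: "{p. is_arg_max g P p} = {q}" and p: "P p" "p \<noteq> q"
  shows "g p < g q"
proof (rule ccontr)
  assume "\<not> g p < g q"
  then have "g q \<le> g p" by simp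
  moreover have "is_arg_max g P q" using unique by auto
  ultimately have "is_arg_max g P p"
    using p(1) unfolding is_arg_max_def by (meson le_less_trans not_less less_le_trans)
  then show False using unique p(2) by auto
qed

theorem theorem2p5:
  fixes \<tau> c :: real and \<gamma> :: ereal and \<nu> :: "real measure"
    and M :: "nat \<Rightarrow> 'a measure"
    and w :: "nat \<Rightarrow> nat \<Rightarrow> 'a \<Rightarrow> real"
    and x :: "nat \<Rightarrow> nat \<Rightarrow> 'a \<Rightarrow> real ^ 'd"
    and G :: "nat \<Rightarrow> 'a \<Rightarrow> nat set set"
    and k :: nat and E :: "nat set set" and m :: mode
    and \<alpha>s :: "nat \<Rightarrow> real" and \<beta>s :: "nat set \<Rightarrow> real"
  assumes "2 < \<tau>" and "\<tau> < 3" and "1 < \<gamma>" and "0 < c"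
    and "weight_law \<tau> c \<nu>"
    and "\<And>n. 1 \<le> n \<Longrightarrow> girg (M n) \<gamma> \<nu> n (w n) (x n) (G n)"
    and "1 \<le> k" and "E \<subseteq> vertex_pairs k"
    and unique_solution:
      "{p. is_arg_max (objective CARD('d) k E \<tau> \<gamma>) (\<lambda>q. q \<in> mode_feasible m CARD('d) k E \<tau>) p}
         = {(\<alpha>s, \<beta>s)}"
    and shape:
      "((\<forall>i\<in>{1..k}. \<alpha>s i = 1 / 2) \<and> (\<forall>e\<in>vertex_pairs k. \<beta>s e = 0)) \<or>
       ((\<forall>i\<in>{1..k}. \<alpha>s i = 0) \<and> (\<forall>e\<in>vertex_pairs k. \<beta>s e = - 1 / real CARD('d)))"
  shows
    "(\<exists>g1 g2 :: real \<Rightarrow> real.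
        (\<forall>\<epsilon>\<in>{0<..<1}. 0 < g1 \<epsilon> \<and> 0 < g2 \<epsilon>) \<and>
        (\<forall>\<epsilon>\<in>{0<..<1}. class_attainable m k E \<epsilon> (\<alpha>s, \<beta>s) M w x G \<longrightarrow>
           (\<lambda>n. measure (M n) {\<omega> \<in> space (M n).
                  let N = class_count m k E n \<epsilon> (\<alpha>s, \<beta>s) (w n) (x n) (G n) \<omega>;
                      s = real n powr real_of_ereal (objective CARD('d) k E \<tau> \<gamma> (\<alpha>s, \<beta>s))
                  in g1 \<epsilon> \<le> N / s \<and> N / s \<le> g2 \<epsilon>})
           \<longlonglongrightarrow> 1))
     \<and>
     (\<forall>p \<in> feasible CARD('d) k \<tau> - {(\<alpha>s, \<beta>s)}.
        \<forall>\<epsilon>\<in>{0<..<1}. class_attainable m k E \<epsilon> (\<alpha>s, \<beta>s) M w x G \<longrightarrow>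
          (\<forall>\<delta>>0.
             (\<lambda>n. measure (M n) {\<omega> \<in> space (M n).
                    let N = class_count m k E n \<epsilon> p (w n) (x n) (G n) \<omega>;
                        Ns = class_count m k E n \<epsilon> (\<alpha>s, \<beta>s) (w n) (x n) (G n) \<omega>
                    in Ns = 0 \<or> \<delta> < \<bar>N / Ns\<bar>})
             \<longlonglongrightarrow> 0))
     \<and>
     (m = Sub \<or> \<gamma> < \<infinity> \<longrightarrow>
        (\<exists>\<epsilon>0\<in>{0<..<1}. \<forall>\<epsilon>\<in>{0<..<\<epsilon>0}. class_attainable m k E \<epsilon> (\<alpha>s, \<beta>s) M w x G))"
proof -
  let ?ps = "(\<alpha>s, \<beta>s)"
  let ?N = "\<lambda>p \<epsilon> n \<omega>. class_count m k E n \<epsilon> p (w n) (x n) (G n) \<omega>"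
  obtain a b where exponents: "(a = 1 / 2 \<and> b = 0) \<or> (a = 0 \<and> b = - 1 / real CARD('d))"
    and const: "\<And>i. i \<in> {1..k} \<Longrightarrow> fst ?ps i = a" "\<And>e. e \<in> vertex_pairs k \<Longrightarrow> snd ?ps e = b"
    using shape by (metis fst_conv snd_conv)
  define f where "f = real k + (1 - \<tau>) * a * k + real CARD('d) * b * (real k - 1)"
  have rd: "real_distribution \<nu>" using assms(5) by (simp add: weight_law_def)
  interpret power_law \<nu> \<tau> c
    using rd assms(1,2,4,5) by (simp add: power_law_def power_law_axioms_def)
  interpret critical_class \<nu> \<tau> c \<gamma> M w x G m k E ?ps a b f
  proof (intro critical_class.intro critical_class_axioms.intro)
    show "power_law \<nu> \<tau> c" by (rule power_law_axioms)
    show "1 < \<gamma>" "1 \<le> k" "E \<subseteq> vertex_pairs k" by fact+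
    show "girg (M n) \<gamma> \<nu> n (w n) (x n) (G n)" if "1 \<le> n" for n
      by (rule assms(6)[OF that])
    show "fst ?ps i = a" if "i \<in> {1..k}" for i using const(1)[OF that] .
    show "snd ?ps e = b" if "e \<in> vertex_pairs k" for e using const(2)[OF that] .
    show "2 * a = 1 + real CARD('d) * b" using exponents by auto
    show "f = real k + (1 - \<tau>) * a * k + real CARD('d) * b * (real k - 1)" by (rule f_def)
    fix t assume t: "t \<in> {1..2 * k - 1}"
    from exponents show "real t * (1 + (1 - \<tau>) * a) + real CARD('d) * b * (real t - 1) < 2 * f"
    proof
      assume s: "a = 1 / 2 \<and> b = 0"
      have "real t < 2 * real k" using t by auto
      then have "real t * ((3 - \<tau>) / 2) < 2 * real k * ((3 - \<tau>) / 2)"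
        using assms(2) by (intro mult_strict_right_mono) auto
      moreover have a: "a = 1 / 2" and b: "b = 0" using s by auto
      have "real t * (1 + (1 - \<tau>) * a) + real CARD('d) * b * (real t - 1) = real t * ((3 - \<tau>) / 2)"
        "2 * f = 2 * real k * ((3 - \<tau>) / 2)"
        unfolding f_def a b by (simp_all add: field_simps)
      ultimately show ?thesis by (simp only:)
    qed (simp add: f_def)
  qed
  have conc: "\<exists>g1 g2. 0 < g1 \<and> 0 < g2 \<and> concentrated \<epsilon> g1 g2"
    if \<epsilon>: "\<epsilon> \<in> {0<..<1}" and att: "class_attainable m k E \<epsilon> ?ps M w x G" for \<epsilon>
  proof -
    have "0 < \<epsilon>" "\<epsilon> < 1" using \<epsilon> by auto
    from concentration[OF this(1) lower_bound_of_attainable[OF this exponents att]]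
    show ?thesis by blast
  qed
  have "\<exists>g :: real \<times> real. 0 < fst g \<and> 0 < snd g \<and>
      (class_attainable m k E \<epsilon> ?ps M w x G \<longrightarrow> concentrated \<epsilon> (fst g) (snd g))"
    if \<epsilon>: "\<epsilon> \<in> {0<..<1}" for \<epsilon>
  proof (cases "class_attainable m k E \<epsilon> ?ps M w x G")
    case True
    obtain g1 g2 where "0 < g1" "0 < g2" "concentrated \<epsilon> g1 g2"
      using conc[OF \<epsilon> True] by blast
    then show ?thesis by (intro exI[of _ "(g1, g2)"]) simp
  next
    case False
    then show ?thesis by (intro exI[of _ "(1, 1)"]) simp
  qed
  then have "\<forall>\<epsilon>\<in>{0<..<1}. \<exists>g :: real \<times> real. 0 < fst g \<and> 0 < snd g \<and>
      (class_attainable m k E \<epsilon> ?ps M w x G \<longrightarrow> concentrated \<epsilon> (fst g) (snd g))"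
    by (rule ballI)
  from bchoice[OF this] obtain g :: "real \<Rightarrow> real \<times> real" where
    g: "\<forall>\<epsilon>\<in>{0<..<1}. 0 < fst (g \<epsilon>) \<and> 0 < snd (g \<epsilon>) \<and>
      (class_attainable m k E \<epsilon> ?ps M w x G \<longrightarrow> concentrated \<epsilon> (fst (g \<epsilon>)) (snd (g \<epsilon>)))" ..
  have first: "(\<lambda>n. measure (M n) {\<omega> \<in> space (M n).
        let N = ?N ?ps \<epsilon> n \<omega>; s = real n powr real_of_ereal (objective CARD('d) k E \<tau> \<gamma> ?ps)
        in fst (g \<epsilon>) \<le> N / s \<and> N / s \<le> snd (g \<epsilon>)}) \<longlonglongrightarrow> 1"
    if \<epsilon>: "\<epsilon> \<in> {0<..<1}" and att: "class_attainable m k E \<epsilon> ?ps M w x G" for \<epsilon>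
  proof (rule Lim_transform_eventually)
    show "(\<lambda>n. measure (M n) {\<omega> \<in> space (M n). fst (g \<epsilon>) * real n powr f \<le> ?N ?ps \<epsilon> n \<omega> \<and>
        ?N ?ps \<epsilon> n \<omega> \<le> snd (g \<epsilon>) * real n powr f}) \<longlonglongrightarrow> 1"
      using bspec[OF g \<epsilon>] att unfolding concentrated_def by blast
    show "\<forall>\<^sub>F n in sequentially. measure (M n) {\<omega> \<in> space (M n). fst (g \<epsilon>) * real n powr f \<le> ?N ?ps \<epsilon> n \<omega> \<and>
        ?N ?ps \<epsilon> n \<omega> \<le> snd (g \<epsilon>) * real n powr f}
      = measure (M n) {\<omega> \<in> space (M n).
        let N = ?N ?ps \<epsilon> n \<omega>; s = real n powr real_of_ereal (objective CARD('d) k E \<tau> \<gamma> ?ps)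
        in fst (g \<epsilon>) \<le> N / s \<and> N / s \<le> snd (g \<epsilon>)}"
      using eventually_ge_at_top[of 1]
      by eventually_elim (simp add: objective_ps Let_def le_divide_eq divide_le_eq)
  qed
  have second: "(\<lambda>n. measure (M n) {\<omega> \<in> space (M n).
        let N = ?N p \<epsilon> n \<omega>; Ns = ?N ?ps \<epsilon> n \<omega> in Ns = 0 \<or> \<delta> < \<bar>N / Ns\<bar>}) \<longlonglongrightarrow> 0"
    if p: "p \<in> feasible CARD('d) k \<tau> - {?ps}" and \<epsilon>: "\<epsilon> \<in> {0<..<1}"
      and att: "class_attainable m k E \<epsilon> ?ps M w x G" and \<delta>: "0 < \<delta>" for p \<epsilon> \<delta>
  proof -
    obtain g1 g2 where g: "0 < g1" "concentrated \<epsilon> g1 g2"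
      using conc[OF \<epsilon> att] by blast
    have "(\<lambda>n. real n ^ k * tuple_prob TYPE('d) m k E \<gamma> \<nu> n \<epsilon> p / real n powr f) \<longlonglongrightarrow> 0"
    proof (rule suboptimal_mean_negligible)
      show "objective CARD('d) k E \<tau> \<gamma> p < objective CARD('d) k E \<tau> \<gamma> ?ps"
        if "p \<in> mode_feasible m CARD('d) k E \<tau>"
        using less_of_unique_arg_max[OF unique_solution that] p by simp
    qed (use p \<epsilon> in auto)
    from ratio_tendsto_0[OF g this \<delta>] show ?thesis .
  qed
  show ?thesis
  proof (intro conjI)
    show "\<exists>g1 g2 :: real \<Rightarrow> real.
        (\<forall>\<epsilon>\<in>{0<..<1}. 0 < g1 \<epsilon> \<and> 0 < g2 \<epsilon>) \<and>
        (\<forall>\<epsilon>\<in>{0<..<1}. class_attainable m k E \<epsilon> (\<alpha>s, \<beta>s) M w x G \<longrightarrow>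
           (\<lambda>n. measure (M n) {\<omega> \<in> space (M n).
                  let N = class_count m k E n \<epsilon> (\<alpha>s, \<beta>s) (w n) (x n) (G n) \<omega>;
                      s = real n powr real_of_ereal (objective CARD('d) k E \<tau> \<gamma> (\<alpha>s, \<beta>s))
                  in g1 \<epsilon> \<le> N / s \<and> N / s \<le> g2 \<epsilon>})
           \<longlonglongrightarrow> 1)"
    proof (rule exI[of _ "\<lambda>\<epsilon>. fst (g \<epsilon>)"], rule exI[of _ "\<lambda>\<epsilon>. snd (g \<epsilon>)"],
        intro conjI ballI impI)
      fix \<epsilon> :: real assume \<epsilon>: "\<epsilon> \<in> {0<..<1}"
      show "0 < fst (g \<epsilon>)" "0 < snd (g \<epsilon>)" using bspec[OF g \<epsilon>] by blast+
    qed (rule first)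
    show "\<forall>p \<in> feasible CARD('d) k \<tau> - {(\<alpha>s, \<beta>s)}.
        \<forall>\<epsilon>\<in>{0<..<1}. class_attainable m k E \<epsilon> (\<alpha>s, \<beta>s) M w x G \<longrightarrow>
          (\<forall>\<delta>>0.
             (\<lambda>n. measure (M n) {\<omega> \<in> space (M n).
                    let N = class_count m k E n \<epsilon> p (w n) (x n) (G n) \<omega>;
                        Ns = class_count m k E n \<epsilon> (\<alpha>s, \<beta>s) (w n) (x n) (G n) \<omega>
                    in Ns = 0 \<or> \<delta> < \<bar>N / Ns\<bar>})
             \<longlonglongrightarrow> 0)"
      by (intro ballI allI impI) (rule second)
    show "m = Sub \<or> \<gamma> < \<infinity> \<longrightarrow>
        (\<exists>\<epsilon>0\<in>{0<..<1}. \<forall>\<epsilon>\<in>{0<..<\<epsilon>0}. class_attainable m k E \<epsilon> (\<alpha>s, \<beta>s) M w x G)"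
      using attainable_for_small_epsilon exponents by blast
  qed
qed

end
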